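(* Let $n\ge2$, let $I\subset\mathbb{C}[\Theta]$ be the symplectic Plücker ideal of the complete symplectic flag variety $F$ of $Sp_{2n}(\mathbb{C})$, and let $\widetilde I=\pi(I_{\mathrm A})\subset\mathbb{C}[\Theta]$ be the image of the type A Plücker ideal $I_{\mathrm A}\subset S$ under the projection $\pi:S\to\mathbb{C}[\Theta]$. Then there exists a monomial order $\widetilde<$ on $\mathbb{C}[\Theta]$ such that $\mathrm{in}_{\widetilde<}I=\widetilde I$.
   Context: **Index set.** $(N,\lessdot)$ is the totally ordered set $\{1\lessdot\dots\lessdot n\lessdot -n\lessdot\dots\lessdot -1\}$. A tuple $(i_1,\dots,i_k)$ of elements of $N$ is *admissible* if for every $l\in[1,n]$ the number of its elements with $|i_j|\le l$ does not exceed $l$. $\Theta$ is the set of admissible tuples with $i_1\lessdot\dots\lessdot i_k$ ($k\in[1,n]$), and $\Theta_k\subset\Theta$ the subset of $k$-tuples. **Symplectic side.** $\mathbb{C}^N\simeq\mathbb{C}^{2n}$ has basis $\{e_i\}_{i\in N}$ and the symplectic form with $\langle e_i,e_{-i}\rangle=1$ for $i\in[1,n]$ and $\langle e_i,e_j\rangle=0$ for $j\ne-i$. The fundamental representation $V_{\omega_k}$ of $\mathfrak{sp}_{2n}(\mathbb{C})$ is embedded in $\wedge^k\mathbb{C}^N$ in the standard way (as the subrepresentation generated by $e_1\wedge\dots\wedge e_k$). Let $\{X_{i_1,\dots,i_k}\}_{i_1\lessdot\dots\lessdot i_k}$ be the basis of $(\wedge^k\mathbb{C}^N)^*$ dual to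 $\{e_{i_1}\wedge\dots\wedge e_{i_k}\}$. It is known that $\{X_{i_1,\dots,i_k}\}_{(i_1,\dots,i_k)\in\Theta_k}$ projects to a basis of $V_{\omega_k}^*$. Hence the multihomogeneous coordinate ring of $\mathbb{P}=\mathbb{P}(V_{\omega_1})\times\dots\times\mathbb{P}(V_{\omega_n})$ is identified with $\mathbb{C}[\Theta]=\mathbb{C}[X_{i_1,\dots,i_k}]_{(i_1,\dots,i_k)\in\Theta}$. The complete symplectic flag variety $F$ (flags of isotropic subspaces of dimensions $1,\dots,n$ in $\mathbb{C}^N$) is embedded in $\mathbb{P}$ by the Plücker embedding, and $I\subset\mathbb{C}[\Theta]$ is its (multihomogeneous vanishing) ideal. **Type A side.** $F_{\mathrm A}$ is the variety of partial flags in $\mathbb{C}^N$ of signature $(1,\dots,n)$, embedded in $\mathbb{P}_{\mathrm A}=\mathbb{P}(\wedge^1\mathbb{C}^N)\times\dots\times\mathbb{P}(\wedge^n\mathbb{C}^N)$ with multihomogeneous coordinate ring $S=\mathbb{C}[X_{i_1,\dots,i_k}]_{k\in[1,n],\{i_1\lessdot\dots\lessdot i_k\}\subset N}$; $I_{\mathrm A}\subset S$ is its Plücker ideal. $\pi:S\to\mathbb{C}[\Theta]$ is the surjection mapping all $X_{i_1,\dots,i_k}\notin\mathbb{C}[\Theta]$ to $0$ and fixing $\mathbb{C}[\Theta]$. **Initial ideals.** A monomial order $<$ on a polynomial ring $\mathbb{C}[x_a]_a$ is a strict partial order on the set of monomials that is multiplicative ($M_1<M_2$ iff $M_1x_a<M_2x_a$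 for every variable $x_a$) and weak (incomparability is an equivalence relation). $\mathrm{in}_<p$ is the sum of those monomials occurring in $p$ which are $<$-maximal among them, with the same coefficients as in $p$; for an ideal $I$, $\mathrm{in}_<I$ is the linear span of all $\mathrm{in}_<p$, $p\in I$. *)

theory Defs
  imports
    Complex_Main
    "HOL-Library.Poly_Mapping"
    "HOL-Library.Function_Algebras"
    "HOL-Algebra.QuotRing"
    "Jordan_Normal_Form.Determinant"
begin

section \<open>Polynomials, ideals and initial ideals\<close>

text \<open>Polynomials in variables of type \<open>'x\<close> are finitely supported functions from monomials
  (exponent functions \<open>'x \<Rightarrow>\<^sub>0 nat\<close>) to \<open>complex\<close>. Polynomial rings over a set \<open>A\<close> of variables are
  subrings of this type.\<close>

type_synonym 'x monomial = "'x \<Rightarrow>\<^sub>0 nat"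
type_synonym 'x mpoly = "'x monomial \<Rightarrow>\<^sub>0 complex"

definition monomials :: "'x set \<Rightarrow> 'x monomial set" where
  "monomials A = {m. Poly_Mapping.keys m \<subseteq> A}"

definition polys :: "'x set \<Rightarrow> 'x mpoly set" where
  "polys A = {p. Poly_Mapping.keys p \<subseteq> monomials A}"

definition poly_ring :: "'x set \<Rightarrow> 'x mpoly ring" where
  "poly_ring A = \<lparr>carrier = polys A, monoid.mult = (*), one = 1, zero = 0, add = (+)\<rparr>"

definition const :: "complex \<Rightarrow> 'x mpoly" where
  "const c = Poly_Mapping.single 0 c"

definition var :: "'x \<Rightarrow> 'x mpoly" where
  "var a = Poly_Mapping.single (Poly_Mapping.single a 1) 1"

text \<open>The ring homomorphism that acts on coefficients by \<open>h\<close> and sends the variable \<open>a\<close> to \<open>f a\<close>.\<close>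

definition poly_hom :: "(complex \<Rightarrow> 'b::comm_ring_1) \<Rightarrow> ('x \<Rightarrow> 'b) \<Rightarrow> 'x mpoly \<Rightarrow> 'b" where
  "poly_hom h f p =
     (\<Sum>m\<in>Poly_Mapping.keys p. h (Poly_Mapping.lookup p m) *
        (\<Prod>a\<in>Poly_Mapping.keys m. f a ^ Poly_Mapping.lookup m a))"

definition peval :: "('x \<Rightarrow> complex) \<Rightarrow> 'x mpoly \<Rightarrow> complex" where
  "peval = poly_hom (\<lambda>c. c)"

definition monomial_order :: "'x set \<Rightarrow> ('x monomial \<Rightarrow> 'x monomial \<Rightarrow> bool) \<Rightarrow> bool" where
  "monomial_order A lt \<longleftrightarrow>
     irreflp_on (monomials A) lt \<and>
     transp_on (monomials A) lt \<and>
     (\<forall>m1\<in>monomials A. \<forall>m2\<in>monomials A. \<forall>a\<in>A.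
        lt m1 m2 \<longleftrightarrow> lt (m1 + Poly_Mapping.single a 1) (m2 + Poly_Mapping.single a 1)) \<and>
     equiv (monomials A)
       {(m1, m2). m1 \<in> monomials A \<and> m2 \<in> monomials A \<and> \<not> lt m1 m2 \<and> \<not> lt m2 m1}"

definition initial_form :: "('x monomial \<Rightarrow> 'x monomial \<Rightarrow> bool) \<Rightarrow> 'x mpoly \<Rightarrow> 'x mpoly" where
  "initial_form lt p =
     (\<Sum>m\<in>{m \<in> Poly_Mapping.keys p. \<not> (\<exists>m'\<in>Poly_Mapping.keys p. lt m m')}.
        Poly_Mapping.single m (Poly_Mapping.lookup p m))"

definition poly_scale :: "complex \<Rightarrow> 'x mpoly \<Rightarrow> 'x mpoly" where
  "poly_scale c p = const c * p"

definition initial_ideal :: "('x monomial \<Rightarrow> 'x monomial \<Rightarrow> bool) \<Rightarrow> 'x mpoly set \<Rightarrow> 'x mpoly set" where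
  "initial_ideal lt J = Modules.module.span poly_scale (initial_form lt ` J)"

section \<open>The index set and tuples\<close>

definition index_set :: "nat \<Rightarrow> int set" where
  "index_set n = {1..int n} \<union> {- int n..-1}"

text \<open>The order \<open>1 < \<dots> < n < -n < \<dots> < -1\<close>: positive indices precede negative ones, and within each
  sign the order is the usual one.\<close>

definition idx_less :: "int \<Rightarrow> int \<Rightarrow> bool" where
  "idx_less i j \<longleftrightarrow> (i > 0 \<and> j < 0) \<or> (sgn i = sgn j \<and> i < j)"

text \<open>The variable \<open>X\<^bsub>i\<^sub>1,\<dots>,i\<^sub>k\<^esub>\<close> is indexed by the list of its subscripts.\<close>

definition tuples :: "nat \<Rightarrow> int list set" where
  "tuples n = {is. set is \<subseteq> index_set n \<and> sorted_wrt idx_less is \<and> length is \<in> {1..n}}"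

definition admissible :: "nat \<Rightarrow> int list \<Rightarrow> bool" where
  "admissible n is \<longleftrightarrow> (\<forall>l\<in>{1..n}. length (filter (\<lambda>i. \<bar>i\<bar> \<le> int l) is) \<le> l)"

definition Theta :: "nat \<Rightarrow> int list set" where
  "Theta n = {is \<in> tuples n. admissible n is}"

section \<open>Flags in \<open>\<complex>\<^sup>N\<close>\<close>

text \<open>Vectors of \<open>\<complex>\<^sup>N\<close> are functions \<open>int \<Rightarrow> complex\<close> that vanish outside the index set.\<close>

definition CN :: "nat \<Rightarrow> (int \<Rightarrow> complex) set" where
  "CN n = {v. \<forall>i. i \<notin> index_set n \<longrightarrow> v i = 0}"

definition scaleV :: "complex \<Rightarrow> (int \<Rightarrow> complex) \<Rightarrow> (int \<Rightarrow> complex)" where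
  "scaleV c v = (\<lambda>i. c * v i)"

text \<open>The alternating bilinear form with \<open>\<langle>e\<^sub>i, e\<^bsub>-i\<^esub>\<rangle> = 1\<close> for \<open>i > 0\<close>.\<close>

definition symp_form :: "nat \<Rightarrow> (int \<Rightarrow> complex) \<Rightarrow> (int \<Rightarrow> complex) \<Rightarrow> complex" where
  "symp_form n v w = (\<Sum>i\<in>{1..int n}. v i * w (- i) - v (- i) * w i)"

text \<open>Only the values \<open>V 1, \<dots>, V n\<close> of a flag matter.\<close>

definition flags :: "nat \<Rightarrow> (nat \<Rightarrow> (int \<Rightarrow> complex) set) set" where
  "flags n = {V. (\<forall>k\<in>{1..n}. V k \<subseteq> CN n \<and> Modules.module.subspace scaleV (V k) \<and>
                              vector_space.dim scaleV (V k) = k) \<and>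
                 (\<forall>k\<in>{1..<n}. V k \<subseteq> V (Suc k))}"

definition symplectic_flags :: "nat \<Rightarrow> (nat \<Rightarrow> (int \<Rightarrow> complex) set) set" where
  "symplectic_flags n =
     {V \<in> flags n. \<forall>k\<in>{1..n}. \<forall>v\<in>V k. \<forall>w\<in>V k. symp_form n v w = 0}"

section \<open>Pluecker coordinates and Pluecker ideals\<close>

definition basis_list :: "(int \<Rightarrow> complex) list \<Rightarrow> (int \<Rightarrow> complex) set \<Rightarrow> bool" where
  "basis_list bs V \<longleftrightarrow> distinct bs \<and> \<not> Modules.module.dependent scaleV (set bs) \<and>
     Modules.module.span scaleV (set bs) = V"

text \<open>The coordinate of \<open>b\<^sub>1 \<and> \<dots> \<and> b\<^sub>k\<close> at \<open>e\<^bsub>i\<^sub>1\<^esub> \<and> \<dots> \<and> e\<^bsub>i\<^sub>k\<^esub>\<close>, for \<open>i\<^sub>1, \<dots>, i\<^sub>k\<close> increasing.\<close>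

definition wedge_coord :: "(int \<Rightarrow> complex) list \<Rightarrow> int list \<Rightarrow> complex" where
  "wedge_coord bs is =
     Determinant.det (mat (length bs) (length bs) (\<lambda>(a, b). (bs ! a) (is ! b)))"

text \<open>The homogeneous coordinate vectors of the images of the flags in \<open>F\<close> under the Pluecker
  embedding. As \<open>bs\<close> runs through the bases of \<open>V k\<close>, the vectors \<open>b\<^sub>1 \<and> \<dots> \<and> b\<^sub>k\<close> run through all
  nonzero vectors of the line \<open>\<and>\<^sup>k (V k)\<close>, so all representatives of the point of the product of
  projective spaces occur. For an isotropic flag these vectors lie in the fundamental
  representations \<open>V\<^bsub>\<omega>\<^sub>k\<^esub> \<subseteq> \<and>\<^sup>k \<complex>\<^sup>N\<close>. The coordinate \<open>X\<^bsub>i\<^sub>1,\<dots>,i\<^sub>k\<^esub>\<close> on \<open>V\<^bsub>\<omega>\<^sub>k\<^esub>\<close> is the restriction of the one on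
  \<open>\<and>\<^sup>k \<complex>\<^sup>N\<close>, so both the symplectic and the type A embedding have the same coordinates, except that
  the former uses only those indexed by \<open>Theta n\<close>.\<close>

definition plucker_vectors ::
  "nat \<Rightarrow> (nat \<Rightarrow> (int \<Rightarrow> complex) set) set \<Rightarrow> (int list \<Rightarrow> complex) set" where
  "plucker_vectors n F =
     {x. \<exists>V\<in>F. \<forall>k\<in>{1..n}. \<exists>bs. basis_list bs (V k) \<and>
           (\<forall>is\<in>tuples n. length is = k \<longrightarrow> x is = wedge_coord bs is)}"

definition multidegree :: "int list monomial \<Rightarrow> nat \<Rightarrow> nat" where
  "multidegree m k = (\<Sum>is\<in>{is \<in> Poly_Mapping.keys m. length is = k}. Poly_Mapping.lookup m is)"

definition multihomogeneous :: "int list mpoly \<Rightarrow> bool" where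
  "multihomogeneous p \<longleftrightarrow>
     (\<forall>m\<in>Poly_Mapping.keys p. \<forall>m'\<in>Poly_Mapping.keys p. multidegree m = multidegree m')"

text \<open>The multihomogeneous vanishing ideal of the image of \<open>F\<close>, in the polynomial ring in the
  Pluecker variables \<open>A\<close>.\<close>

definition vanishing_ideal ::
  "nat \<Rightarrow> int list set \<Rightarrow> (nat \<Rightarrow> (int \<Rightarrow> complex) set) set \<Rightarrow> int list mpoly set" where
  "vanishing_ideal n A F =
     Idl\<^bsub>poly_ring A\<^esub> {p \<in> polys A. multihomogeneous p \<and> (\<forall>x\<in>plucker_vectors n F. peval x p = 0)}"

definition symplectic_plucker_ideal :: "nat \<Rightarrow> int list mpoly set" where
  "symplectic_plucker_ideal n = vanishing_ideal n (Theta n) (symplectic_flags n)"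

definition typeA_plucker_ideal :: "nat \<Rightarrow> int list mpoly set" where
  "typeA_plucker_ideal n = vanishing_ideal n (tuples n) (flags n)"

definition proj_Theta :: "nat \<Rightarrow> int list mpoly \<Rightarrow> int list mpoly" where
  "proj_Theta n = poly_hom const (\<lambda>is. if is \<in> Theta n then var is else 0)"

section \<open>The ambient algebraic structures\<close>

text \<open>The following facts discharge the premises of the library notions \<open>Idl\<close>, \<open>span\<close>,
  \<open>dependent\<close>, \<open>subspace\<close> and \<open>dim\<close> used above.\<close>

lemma vector_space_scaleV: "vector_space scaleV"
  by unfold_locales (auto simp: scaleV_def fun_eq_iff algebra_simps)

lemma vector_space_poly_scale: "vector_space poly_scale"
  by unfold_locales
     (auto simp: poly_scale_def const_def algebra_simps single_add mult_single mult.assoc[symmetric])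

lemma monomials_add: "m1 \<in> monomials A \<Longrightarrow> m2 \<in> monomials A \<Longrightarrow> m1 + m2 \<in> monomials A"
  using Poly_Mapping.keys_add[of m1 m2] by (auto simp: monomials_def)

lemma polys_closed:
  shows "0 \<in> polys A" and "1 \<in> polys A"
    and "p \<in> polys A \<Longrightarrow> q \<in> polys A \<Longrightarrow> p + q \<in> polys A"
    and "p \<in> polys A \<Longrightarrow> q \<in> polys A \<Longrightarrow> p * q \<in> polys A"
    and "p \<in> polys A \<Longrightarrow> - p \<in> polys A"
proof -
  show "0 \<in> polys A" "1 \<in> polys A"
    by (auto simp: polys_def monomials_def)
  show "p \<in> polys A \<Longrightarrow> q \<in> polys A \<Longrightarrow> p + q \<in> polys A"
    using Poly_Mapping.keys_add[of p q] by (auto simp: polys_def)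
  show "p \<in> polys A \<Longrightarrow> q \<in> polys A \<Longrightarrow> p * q \<in> polys A"
    using Poly_Mapping.keys_mult[of p q] monomials_add unfolding polys_def by blast
  show "p \<in> polys A \<Longrightarrow> - p \<in> polys A"
    by (auto simp: polys_def)
qed

lemma cring_poly_ring: "cring (poly_ring A)"
proof (rule cringI)
  show "abelian_group (poly_ring A)"
  proof (rule abelian_groupI)
    fix x assume "x \<in> carrier (poly_ring A)"
    then show "\<exists>y\<in>carrier (poly_ring A). y \<oplus>\<^bsub>poly_ring A\<^esub> x = \<zero>\<^bsub>poly_ring A\<^esub>"
      using polys_closed(5)[of x A] by (auto simp: poly_ring_def intro!: bexI[of _ "- x"])
  qed (auto simp: poly_ring_def polys_closed algebra_simps)
  show "comm_monoid (poly_ring A)"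
    by (rule comm_monoidI) (auto simp: poly_ring_def polys_closed algebra_simps)
qed (auto simp: poly_ring_def polys_closed algebra_simps)

end

theory Submission
  imports Defs
begin

text \<open>Give the index \<open>i > 0\<close> the weight \<open>2 ^ (n + 1) - 2 ^ i\<close>, negative indices the weight \<open>0\<close>, and order
  monomials by total weight. Let \<open>Z\<close> be the set of frames \<open>z\<^sub>0, \<dots>, z\<^bsub>n-1\<^esub>\<close> in which \<open>z\<^sub>a\<close> vanishes at the indices of
  absolute value at most \<open>a\<close> (a Schubert variety of the type A flag variety). The initial ideal of \<open>I\<close>,
  the projection of the type A ideal and the ideal of \<open>Z\<close> are shown to coincide by a cycle of inclusions.

  On isotropic flags every non-admissible Pluecker coordinate is a linear combination of admissible
  ones of smaller weight, since contraction with the symplectic form allows pairs \<open>(j, -j)\<close> to be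
  exchanged for pairs further out. Substituting these expressions into a weight-homogeneous element of
  the type A ideal gives an element of \<open>I\<close> whose initial form is its projection.

  Conversely, every frame in \<open>Z\<close> is a limit of symplectic frames acted on by the one-parameter torus
  of the weight, so initial forms of elements of \<open>I\<close> vanish on \<open>Z\<close>.

  Finally, sort the entries of tuples by \<open>1 < -1 < 2 < -2 < \<dots>\<close>. By type A straightening every polynomial
  is congruent to a combination of semistandard monomials modulo the type A ideal. Those with only
  admissible columns are King's symplectic tableaux; they have distinct leading terms on \<open>Z\<close>, hence are
  linearly independent there, while the others vanish on \<open>Z\<close>. So a polynomial vanishing on \<open>Z\<close> is the
  projection of an element of the type A ideal.\<close>

section \<open>Polynomials\<close>

text \<open>The cycle runs from the projected type A ideal to the initial ideal, then to the ideal
  of \<open>Z\<close>, and back. Closing it takes the place of comparing dimensions: spanning is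
  proved on all frames and independence on \<open>Z\<close>. The weight has two jobs. A pair (j, -j)
  weighs \<open>2 ^ (n + 1) - 2 ^ j\<close>, and \<open>2 ^ (l + 1)\<close> exceeds the sum of
  \<open>2 ^ 1\<close>, ..., \<open>2 ^ l\<close>; so trading pairs inside 1..l for equally many
  pairs, one of them beyond l, lowers the weight whatever the others are. Moreover
  \<open>2 ^ j\<close> increases with j, so in the symplectic form rescaled by the torus the terms
  with small j dominate as t tends to 0: isotropy of two rows becomes an equation for one entry,
  whose solution tends to 0. The number of pairs is constant in every relation, so
  \<open>2 ^ (n + 1)\<close> only serves to make all weights natural numbers. The obstacle in the
  first step is that a contraction relation contains several coordinates whose exchanged pair stays
  inside 1..l, possibly none of them light. All relations of this kind have to be solved together,
  which is possible because an inclusion matrix between sets of pairs has full rank exactly in the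
  non-admissible case that occurs.\<close>

definition mon_eval :: "('x \<Rightarrow> 'b::comm_ring_1) \<Rightarrow> 'x monomial \<Rightarrow> 'b" where
  "mon_eval f m = (\<Prod>a\<in>Poly_Mapping.keys m. f a ^ Poly_Mapping.lookup m a)"

definition wt :: "('x \<Rightarrow> nat) \<Rightarrow> 'x monomial \<Rightarrow> nat" where
  "wt w m = (\<Sum>a\<in>Poly_Mapping.keys m. Poly_Mapping.lookup m a * w a)"

lemma mon_eval_superset:
  assumes "finite K" "Poly_Mapping.keys m \<subseteq> K"
  shows "mon_eval f m = (\<Prod>a\<in>K. f a ^ Poly_Mapping.lookup m a)"
  unfolding mon_eval_def using assms
  by (intro prod.mono_neutral_left) (auto simp: in_keys_iff)

lemma wt_superset:
  assumes "finite K" "Poly_Mapping.keys m \<subseteq> K"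
  shows "wt w m = (\<Sum>a\<in>K. Poly_Mapping.lookup m a * w a)"
  unfolding wt_def using assms
  by (intro sum.mono_neutral_left) (auto simp: in_keys_iff)

lemma mon_eval_0 [simp]: "mon_eval f 0 = 1"
  by (simp add: mon_eval_def)

lemma wt_0 [simp]: "wt w 0 = 0"
  by (simp add: wt_def)

lemma mon_eval_add: "mon_eval f (m + m') = mon_eval f m * mon_eval f m'"
proof -
  let ?K = "Poly_Mapping.keys m \<union> Poly_Mapping.keys m'"
  have "Poly_Mapping.keys (m + m') \<subseteq> ?K"
    by (rule Poly_Mapping.keys_add)
  then show ?thesis
    by (subst (1 2 3) mon_eval_superset[of ?K])
       (auto simp: lookup_add power_add prod.distrib)
qed

lemma wt_add: "wt w (m + m') = wt w m + wt w m'"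
proof -
  let ?K = "Poly_Mapping.keys m \<union> Poly_Mapping.keys m'"
  have "Poly_Mapping.keys (m + m') \<subseteq> ?K"
    by (rule Poly_Mapping.keys_add)
  then show ?thesis
    by (subst (1 2 3) wt_superset[of ?K])
       (auto simp: lookup_add algebra_simps sum.distrib)
qed

lemma mon_eval_single: "mon_eval f (Poly_Mapping.single a k) = f a ^ k"
  by (cases "k = 0") (auto simp: mon_eval_def)

lemma wt_single: "wt w (Poly_Mapping.single a k) = k * w a"
  by (cases "k = 0") (auto simp: wt_def)

lemma wt_mono: "(\<And>a. a \<in> Poly_Mapping.keys m \<Longrightarrow> w a \<le> w' a) \<Longrightarrow> wt w m \<le> wt w' m"
  unfolding wt_def by (intro sum_mono mult_left_mono) auto

lemma mon_eval_cong:
  "(\<And>a. a \<in> Poly_Mapping.keys m \<Longrightarrow> f a = g a) \<Longrightarrow> mon_eval f m = mon_eval g m"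
  unfolding mon_eval_def by (intro prod.cong) auto

lemma mon_eval_rescale:
  "mon_eval (\<lambda>a. c ^ w a * x a) m = c ^ wt w m * mon_eval x m"
  by (simp add: mon_eval_def wt_def power_mult_distrib prod.distrib power_sum
      flip: power_mult) (simp add: mult.commute)

lemma poly_hom_alt:
  "poly_hom h f p = (\<Sum>m\<in>Poly_Mapping.keys p. h (Poly_Mapping.lookup p m) * mon_eval f m)"
  by (simp add: poly_hom_def mon_eval_def)

text \<open>Evaluation and substitution of polynomials are both instances of
  \<open>poly_hom\<close>: \<open>h\<close> is the identity for the former and \<open>const\<close>
  for the latter.\<close>

locale coeff_hom =
  fixes h :: "complex \<Rightarrow> 'b::comm_ring_1"
  assumes hom_add: "h (a + b) = h a + h b"
    and hom_mult: "h (a * b) = h a * h b"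
    and hom_1: "h 1 = 1"
begin

lemma hom_0: "h 0 = 0"
  using hom_add[of 0 0] by simp

lemma poly_hom_superset:
  assumes "finite K" "Poly_Mapping.keys p \<subseteq> K"
  shows "poly_hom h f p = (\<Sum>m\<in>K. h (Poly_Mapping.lookup p m) * mon_eval f m)"
  unfolding poly_hom_alt using assms
  by (intro sum.mono_neutral_left) (auto simp: in_keys_iff hom_0)

lemma poly_hom_single: "poly_hom h f (Poly_Mapping.single m c) = h c * mon_eval f m"
  by (cases "c = 0") (auto simp: poly_hom_alt hom_0)

lemma poly_hom_0: "poly_hom h f 0 = 0"
  by (simp add: poly_hom_alt)

lemma poly_hom_1: "poly_hom h f 1 = 1"
  using poly_hom_single[of f 0 1] by (simp add: hom_1)

lemma poly_hom_add: "poly_hom h f (p + q) = poly_hom h f p + poly_hom h f q"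
proof -
  let ?K = "Poly_Mapping.keys p \<union> Poly_Mapping.keys q"
  have "Poly_Mapping.keys (p + q) \<subseteq> ?K"
    by (rule Poly_Mapping.keys_add)
  then show ?thesis
    by (subst (1 2 3) poly_hom_superset[of ?K])
       (auto simp: lookup_add hom_add algebra_simps sum.distrib)
qed

lemma poly_hom_sum: "poly_hom h f (\<Sum>i\<in>A. p i) = (\<Sum>i\<in>A. poly_hom h f (p i))"
  by (induction A rule: infinite_finite_induct) (auto simp: poly_hom_0 poly_hom_add)

end

lemma poly_expand: "p = (\<Sum>m\<in>Poly_Mapping.keys p. Poly_Mapping.single m (Poly_Mapping.lookup p m))"
  by (rule poly_mapping_eqI)
     (auto simp: lookup_sum lookup_single when_def in_keys_iff)

context coeff_hom
begin

lemma poly_hom_mult: "poly_hom h f (p * q) = poly_hom h f p * poly_hom h f q"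
proof -
  have "poly_hom h f (p * q) =
    poly_hom h f (\<Sum>m\<in>Poly_Mapping.keys p. \<Sum>m'\<in>Poly_Mapping.keys q.
        Poly_Mapping.single (m + m') (Poly_Mapping.lookup p m * Poly_Mapping.lookup q m'))"
    by (subst poly_expand[of p], subst poly_expand[of q])
       (simp add: sum_product mult_single)
  also have "\<dots> = (\<Sum>m\<in>Poly_Mapping.keys p. \<Sum>m'\<in>Poly_Mapping.keys q.
        h (Poly_Mapping.lookup p m) * mon_eval f m * (h (Poly_Mapping.lookup q m') * mon_eval f m'))"
    by (simp add: poly_hom_sum poly_hom_single mon_eval_add hom_mult algebra_simps)
  also have "\<dots> = poly_hom h f p * poly_hom h f q"
    by (simp add: poly_hom_alt sum_product)
  finally show ?thesis .
qed

lemma poly_hom_uminus: "poly_hom h f (- p) = - poly_hom h f p"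
  using poly_hom_add[of f "- p" p] by (simp add: poly_hom_0 eq_neg_iff_add_eq_0)

lemma poly_hom_diff: "poly_hom h f (p - q) = poly_hom h f p - poly_hom h f q"
  using poly_hom_add[of f p "- q"] by (simp add: poly_hom_uminus)

end

interpretation id_hom: coeff_hom "\<lambda>c::complex. c"
  by unfold_locales auto

interpretation const_hom: coeff_hom const
  by unfold_locales (auto simp: const_def single_add mult_single)

lemmas peval_add = id_hom.poly_hom_add[folded peval_def]
  and peval_sum = id_hom.poly_hom_sum[folded peval_def]
  and peval_mult = id_hom.poly_hom_mult[folded peval_def]
  and peval_diff = id_hom.poly_hom_diff[folded peval_def]
  and peval_uminus = id_hom.poly_hom_uminus[folded peval_def]
  and peval_0 [simp] = id_hom.poly_hom_0[folded peval_def]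
  and peval_1 [simp] = id_hom.poly_hom_1[folded peval_def]
  and peval_single = id_hom.poly_hom_single[folded peval_def]

lemma peval_const [simp]: "peval x (const c) = c"
  by (simp add: const_def peval_single)

lemma peval_var [simp]: "peval x (var a) = x a"
  by (simp add: var_def peval_single mon_eval_single)

lemma peval_power: "peval x (p ^ k) = peval x p ^ k"
  by (induction k) (auto simp: peval_mult)

lemma peval_prod: "peval x (\<Prod>i\<in>A. p i) = (\<Prod>i\<in>A. peval x (p i))"
  by (induction A rule: infinite_finite_induct) (auto simp: peval_mult)

lemma peval_alt: "peval x p = (\<Sum>m\<in>Poly_Mapping.keys p. Poly_Mapping.lookup p m * mon_eval x m)"
  by (simp add: peval_def poly_hom_alt)

lemma peval_cong:
  assumes "p \<in> polys A" "\<And>a. a \<in> A \<Longrightarrow> x a = y a"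
  shows "peval x p = peval y p"
  unfolding peval_alt using assms
  by (intro sum.cong refl arg_cong2[where f = "(*)"] mon_eval_cong)
     (auto simp: polys_def monomials_def)

lemma peval_poly_hom:
  "peval x (poly_hom const f p) = peval (\<lambda>a. peval x (f a)) p"
  by (simp add: poly_hom_alt peval_sum peval_mult peval_alt[of "\<lambda>a. peval x (f a)"]
      mon_eval_def peval_prod peval_power)

section \<open>Components of a polynomial\<close>

definition restrict_poly :: "('x monomial \<Rightarrow> bool) \<Rightarrow> 'x mpoly \<Rightarrow> 'x mpoly" where
  "restrict_poly P p =
     (\<Sum>m\<in>{m \<in> Poly_Mapping.keys p. P m}. Poly_Mapping.single m (Poly_Mapping.lookup p m))"

lemma lookup_restrict_poly:
  "Poly_Mapping.lookup (restrict_poly P p) m = (if P m then Poly_Mapping.lookup p m else 0)"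
  by (auto simp: restrict_poly_def lookup_sum lookup_single when_def in_keys_iff)

lemma keys_restrict_poly:
  "Poly_Mapping.keys (restrict_poly P p) = {m \<in> Poly_Mapping.keys p. P m}"
  by (auto simp: in_keys_iff lookup_restrict_poly split: if_splits)

lemma restrict_poly_polys: "p \<in> polys A \<Longrightarrow> restrict_poly P p \<in> polys A"
  by (auto simp: polys_def keys_restrict_poly)

lemma restrict_poly_add: "restrict_poly P (p + q) = restrict_poly P p + restrict_poly P q"
  by (rule poly_mapping_eqI) (auto simp: lookup_restrict_poly lookup_add)

lemma restrict_poly_0 [simp]: "restrict_poly P 0 = 0"
  by (rule poly_mapping_eqI) (auto simp: lookup_restrict_poly)

lemma restrict_poly_sum: "restrict_poly P (\<Sum>i\<in>A. p i) = (\<Sum>i\<in>A. restrict_poly P (p i))"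
  by (induction A rule: infinite_finite_induct) (auto simp: restrict_poly_add)

lemma sum_components:
  assumes "finite D" "\<And>m. m \<in> Poly_Mapping.keys p \<Longrightarrow> g m \<in> D"
  shows "p = (\<Sum>d\<in>D. restrict_poly (\<lambda>m. g m = d) p)"
  using assms
  by (intro poly_mapping_eqI) (auto simp: lookup_sum lookup_restrict_poly in_keys_iff)

lemma initial_form_eq_restrict:
  "initial_form lt p = restrict_poly (\<lambda>m. \<not> (\<exists>m'\<in>Poly_Mapping.keys p. lt m m')) p"
  by (simp add: initial_form_def restrict_poly_def)

text \<open>For fixed \<open>x\<close> the value at the rescaled point is a polynomial in
  \<open>t\<close> whose coefficients are the values at \<open>x\<close> of the components of
  \<open>p\<close>; infinitely many roots make all of them zero. Hence the polynomials vanishing on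
  a set stable under a torus form a homogeneous ideal.\<close>

lemma component_vanishes:
  assumes "\<And>t. t \<noteq> 0 \<Longrightarrow> peval (\<lambda>a. t ^ w a * x a) p = 0"
  shows "peval x (restrict_poly (\<lambda>m. wt w m = d) p) = 0"
proof -
  \<comment> \<open>Inserting \<open>d\<close> puts it in the range of exponents even if no monomial
    of \<open>p\<close> has weight \<open>d\<close>, and keeps \<open>Max\<close> defined for
    \<open>p = 0\<close>.\<close>
  define N where "N = Max (insert d (wt w ` Poly_Mapping.keys p))"
  define c where "c = (\<lambda>i. peval x (restrict_poly (\<lambda>m. wt w m = i) p))"
  have N: "wt w m \<in> {..N}" if "m \<in> Poly_Mapping.keys p" for m
    using that by (auto simp: N_def)
  have d: "d \<le> N"
    by (simp add: N_def)
  have *: "peval (\<lambda>a. t ^ w a * x a) p = (\<Sum>i\<le>N. c i * t ^ i)" for t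
  proof -
    have "peval (\<lambda>a. t ^ w a * x a) p =
        (\<Sum>i\<le>N. peval (\<lambda>a. t ^ w a * x a) (restrict_poly (\<lambda>m. wt w m = i) p))"
      unfolding peval_sum[symmetric]
      by (rule arg_cong[where f = "peval _"], rule sum_components) (use N in auto)
    also have "\<dots> = (\<Sum>i\<le>N. c i * t ^ i)"
      by (auto simp: c_def peval_alt keys_restrict_poly mon_eval_rescale sum_distrib_right
         lookup_restrict_poly intro!: sum.cong)
    finally show ?thesis .
  qed
  have inf: "\<not> finite {t. (\<Sum>i\<le>N. c i * t ^ i) = 0}"
  proof
    assume "finite {t. (\<Sum>i\<le>N. c i * t ^ i) = 0}"
    then have "finite (UNIV - {0::complex})"
      by (rule rev_finite_subset) (use assms * in auto)
    then show False
      using infinite_UNIV_char_0[where 'a = complex] by simp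
  qed
  have "c i = 0" if "i \<le> N" for i
    using polyfun_finite_roots[of c N] inf that by blast
  then show ?thesis
    using d by (simp add: c_def)
qed

lemma polys_sum: "(\<And>i. i \<in> I \<Longrightarrow> p i \<in> polys A) \<Longrightarrow> (\<Sum>i\<in>I. p i) \<in> polys A"
  by (induction I rule: infinite_finite_induct) (auto simp: polys_closed)

lemma polys_prod: "(\<And>i. i \<in> I \<Longrightarrow> p i \<in> polys A) \<Longrightarrow> (\<Prod>i\<in>I. p i) \<in> polys A"
  by (induction I rule: infinite_finite_induct) (auto simp: polys_closed)

lemma polys_power: "p \<in> polys A \<Longrightarrow> p ^ k \<in> polys A"
  by (induction k) (auto simp: polys_closed)

lemma polys_diff: "p \<in> polys A \<Longrightarrow> q \<in> polys A \<Longrightarrow> p - q \<in> polys A"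
  using polys_closed(3)[of p A "- q"] polys_closed(5)[of q A] by simp

lemma const_polys [simp]: "const c \<in> polys A"
  by (auto simp: const_def polys_def monomials_def)

lemma single_polys: "m \<in> monomials A \<Longrightarrow> Poly_Mapping.single m c \<in> polys A"
  by (auto simp: polys_def)

lemma polys_mono: "A \<subseteq> B \<Longrightarrow> polys A \<subseteq> polys B"
  by (auto simp: polys_def monomials_def)

lemma var_polys: "a \<in> A \<Longrightarrow> var a \<in> polys A"
  by (auto simp: var_def intro!: single_polys) (auto simp: monomials_def)

lemma single_conv_var:
  "Poly_Mapping.single m c = const c * mon_eval var m"
proof -
  have 1: "var a ^ k = Poly_Mapping.single (Poly_Mapping.single a k) 1" for a :: 'a and k
    by (induction k) (auto simp: var_def mult_single single_add[symmetric])
  have 2: "(\<Prod>a\<in>K. Poly_Mapping.single (Poly_Mapping.single a (g a)) (1::complex)) =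
     Poly_Mapping.single (\<Sum>a\<in>K. Poly_Mapping.single a (g a)) 1" for K :: "'a set" and g :: "'a \<Rightarrow> nat"
    by (induction K rule: infinite_finite_induct) (auto simp: mult_single)
  have 3: "m = (\<Sum>a\<in>Poly_Mapping.keys m. Poly_Mapping.single a (Poly_Mapping.lookup m a))"
    by (rule poly_mapping_eqI)
       (auto simp: lookup_sum lookup_single when_def in_keys_iff)
  show ?thesis
    by (simp add: mon_eval_def 1 2 const_def mult_single flip: 3)
qed

section \<open>Frames and minors\<close>

interpretation V: vector_space scaleV
  by (rule vector_space_scaleV)

text \<open>Extracts many equations between exponents from a single equation between weights;
  applied to multidegrees and later to the rows of tableaux.\<close>

lemma digits_unique:
  fixes a b :: "nat \<Rightarrow> nat"
  assumes "(\<Sum>k<N. a k * B ^ k) = (\<Sum>k<N. b k * B ^ k)"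
    and "\<And>k. k < N \<Longrightarrow> a k < B" "\<And>k. k < N \<Longrightarrow> b k < B" "k < N"
  shows "a k = b k"
  using assms
proof (induction N arbitrary: a b k)
  case 0
  then show ?case by simp
next
  case (Suc N)
  have split: "(\<Sum>k<Suc N. c k * B ^ k) = c 0 + B * (\<Sum>k<N. c (Suc k) * B ^ k)" for c
    by (simp add: sum.lessThan_Suc_shift sum_distrib_left algebra_simps del: sum.lessThan_Suc)
  have B: "a 0 < B" "b 0 < B"
    using Suc.prems by auto
  have eq: "a 0 + B * (\<Sum>k<N. a (Suc k) * B ^ k) = b 0 + B * (\<Sum>k<N. b (Suc k) * B ^ k)"
    using Suc.prems(1) by (simp only: split)
  from arg_cong[OF eq, of "\<lambda>x. x mod B"] have 0: "a 0 = b 0"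
    using B by simp
  with eq B have "(\<Sum>k<N. a (Suc k) * B ^ k) = (\<Sum>k<N. b (Suc k) * B ^ k)"
    by simp
  from Suc.IH[OF this] Suc.prems have "a (Suc k) = b (Suc k)" if "k < N" for k
    using that by simp
  with 0 Suc.prems(4) show ?case
    by (cases k) auto
qed

text \<open>The rows used are the first \<open>length is\<close> ones, so a single \<open>v\<close>
  yields the coordinates of every member of the flag spanned by its initial segments. Arbitrary
  lists are allowed as columns because straightening produces unsorted and repeated ones.\<close>

definition minor :: "(nat \<Rightarrow> int \<Rightarrow> complex) \<Rightarrow> int list \<Rightarrow> complex" where
  "minor v is = wedge_coord (map v [0..<length is]) is"

lemma wedge_coord_Leibniz:
  assumes "length is = length bs"
  shows "wedge_coord bs is =
    (\<Sum>p | p permutes {0..<length bs}. signof p * (\<Prod>i=0..<length bs. (bs ! p i) (is ! i)))"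
proof -
  let ?k = "length bs"
  let ?M = "mat ?k ?k (\<lambda>(a, b). (bs ! a) (is ! b))"
  \<comment> \<open>Transposing lets the permutation act on the rows and leaves the columns
    \<open>is\<close> in place.\<close>
  have "wedge_coord bs is = Determinant.det (transpose_mat ?M)"
    by (subst det_transpose[of _ ?k]) (auto simp: wedge_coord_def)
  also have "\<dots> = (\<Sum>p | p permutes {0..<?k}. signof p * (\<Prod>i=0..<?k. (transpose_mat ?M) $$ (i, p i)))"
    by (subst det_def'[of _ ?k]) auto
  also have "\<dots> = (\<Sum>p | p permutes {0..<?k}. signof p * (\<Prod>i=0..<?k. (bs ! p i) (is ! i)))"
    by (intro sum.cong refl arg_cong2[where f = "(*)"] prod.cong)
       (auto simp: permutes_def dest: permutes_in_image[THEN iffD2])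
  finally show ?thesis .
qed

lemma minor_Leibniz:
  "minor v is =
    (\<Sum>p | p permutes {0..<length is}. signof p * (\<Prod>i=0..<length is. v (p i) (is ! i)))"
  unfolding minor_def
  by (subst wedge_coord_Leibniz)
     (auto intro!: sum.cong prod.cong dest: permutes_in_image[THEN iffD2])

lemma minor_scale:
  "minor (\<lambda>a. scaleV (s a) (v a)) is = (\<Prod>a<length is. s a) * minor v is"
proof -
  have "(\<Prod>i=0..<length is. s (p i)) = (\<Prod>a<length is. s a)" if "p permutes {0..<length is}" for p
    using prod.permute[OF that, of s] by (simp add: atLeast0LessThan)
  then show ?thesis
    by (simp add: minor_Leibniz scaleV_def prod.distrib sum_distrib_left algebra_simps)
qed

section \<open>Independent families and frames\<close>

definition lin_indep :: "nat \<Rightarrow> (nat \<Rightarrow> int \<Rightarrow> complex) \<Rightarrow> bool" where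
  "lin_indep k v \<longleftrightarrow> (\<forall>c. (\<forall>i. (\<Sum>a<k. c a * v a i) = 0) \<longrightarrow> (\<forall>a<k. c a = 0))"

lemma lin_indepD:
  "lin_indep k v \<Longrightarrow> (\<And>i. (\<Sum>a<k. c a * v a i) = 0) \<Longrightarrow> a < k \<Longrightarrow> c a = 0"
  unfolding lin_indep_def by blast

lemma lin_indep_mono:
  assumes "lin_indep k v" "j \<le> k"
  shows "lin_indep j v"
  unfolding lin_indep_def
proof (intro allI impI)
  fix c a
  assume c: "\<forall>i. (\<Sum>a<j. c a * v a i) = 0" and "a < j"
  have "(\<Sum>a<k. (if a < j then c a else 0) * v a i) = (\<Sum>a<j. c a * v a i)" for i
    by (rule sum.mono_neutral_cong_right) (use \<open>j \<le> k\<close> in auto)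
  then have "(if a < j then c a else 0) = 0"
    using c \<open>a < j\<close> \<open>j \<le> k\<close> by (intro lin_indepD[OF assms(1), of "\<lambda>a. if a < j then c a else 0"]) auto
  then show "c a = 0"
    using \<open>a < j\<close> by simp
qed

lemma sum_scaleV: "(\<Sum>a\<in>A. scaleV (c a) (v a)) = (\<lambda>i. \<Sum>a\<in>A. c a * v a i)"
  by (induction A rule: infinite_finite_induct) (auto simp: scaleV_def fun_eq_iff)

text \<open>A repeated vector makes a family dependent, although its set of values may be
  independent; \<open>distinct\<close> accounts for the difference.\<close>

lemma lin_indep_iff:
  "lin_indep k v \<longleftrightarrow> distinct (map v [0..<k]) \<and> \<not> V.dependent (set (map v [0..<k]))"
proof
  assume L: "lin_indep k v"
  have inj: "inj_on v {..<k}"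
  proof (rule inj_onI, rule ccontr)
    fix a b assume ab: "a \<in> {..<k}" "b \<in> {..<k}" "v a = v b" "a \<noteq> b"
    have "(\<Sum>c<k. ((if c = a then 1 else 0) - (if c = b then 1 else 0)) * v c i) = 0" for i
      using ab by (simp add: left_diff_distrib sum_subtractf if_distrib[of "\<lambda>x. x * _"] cong: if_cong)
    from lin_indepD[OF L this, of a] show False
      using ab by auto
  qed
  moreover have "\<not> V.dependent (v ` {..<k})"
  proof
    assume "V.dependent (v ` {..<k})"
    then obtain u where u: "\<exists>x\<in>v ` {..<k}. u x \<noteq> 0" "(\<Sum>x\<in>v ` {..<k}. scaleV (u x) x) = 0"
      by (auto simp: V.dependent_finite)
    from u(2) have "(\<lambda>i. \<Sum>a<k. u (v a) * v a i) = 0"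
      using inj by (simp add: sum.reindex flip: sum_scaleV)
    then have "\<forall>a<k. u (v a) = 0"
      using L unfolding lin_indep_def by (auto simp: fun_eq_iff)
    with u(1) show False
      by auto
  qed
  ultimately show "distinct (map v [0..<k]) \<and> \<not> V.dependent (set (map v [0..<k]))"
    by (auto simp: distinct_map atLeast0LessThan)
next
  assume "distinct (map v [0..<k]) \<and> \<not> V.dependent (set (map v [0..<k]))"
  then have inj: "inj_on v {..<k}" and ind: "\<not> V.dependent (v ` {..<k})"
    by (auto simp: distinct_map atLeast0LessThan)
  show "lin_indep k v"
    unfolding lin_indep_def
  proof (intro allI impI)
    fix c a assume c: "\<forall>i. (\<Sum>a<k. c a * v a i) = 0" and a: "a < k"
    have "(\<Sum>x\<in>v ` {..<k}. scaleV (c (the_inv_into {..<k} v x)) x) = 0"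
      using inj c by (simp add: sum.reindex the_inv_into_f_f sum_scaleV fun_eq_iff)
    then have "\<forall>x\<in>v ` {..<k}. c (the_inv_into {..<k} v x) = 0"
      using ind by (auto simp: V.dependent_finite)
    then show "c a = 0"
      using a inj by (auto simp: the_inv_into_f_f)
  qed
qed

definition frames :: "nat \<Rightarrow> (nat \<Rightarrow> int \<Rightarrow> complex) set" where
  "frames n = {v. (\<forall>a<n. v a \<in> CN n) \<and> lin_indep n v}"

definition symplectic_frames :: "nat \<Rightarrow> (nat \<Rightarrow> int \<Rightarrow> complex) set" where
  "symplectic_frames n = {v \<in> frames n. \<forall>a<n. \<forall>b<n. symp_form n (v a) (v b) = 0}"

lemma subspace_CN: "V.subspace (CN n)"
  by (auto simp: V.subspace_def CN_def scaleV_def)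

lemma symp_form_linear:
  "symp_form n (u + v) w = symp_form n u w + symp_form n v w"
  "symp_form n (scaleV c v) w = c * symp_form n v w"
  "symp_form n 0 w = 0"
  by (auto simp: symp_form_def scaleV_def algebra_simps sum_distrib_left sum_subtractf sum.distrib)

lemma symp_form_swap: "symp_form n v w = - symp_form n w v"
  by (simp add: symp_form_def sum_negf[symmetric] algebra_simps)

lemma isotropic_span:
  assumes "\<And>v w. v \<in> S \<Longrightarrow> w \<in> S \<Longrightarrow> symp_form n v w = 0" "v \<in> V.span S" "w \<in> V.span S"
  shows "symp_form n v w = 0"
proof -
  have sub: "V.subspace {v. symp_form n v w = 0}" for w
    by (auto simp: V.subspace_def symp_form_linear)
  have "V.span S \<subseteq> {v. symp_form n v w = 0}" if "w \<in> S" for w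
    by (rule V.span_minimal) (use assms(1) that sub in auto)
  then have "V.span S \<subseteq> {w. symp_form n w v = 0}"
    using assms(2) by (intro V.span_minimal sub) (auto simp: symp_form_swap[of n _ v])
  then show ?thesis
    using assms(3) symp_form_swap[of n v w] by auto
qed

lemma basis_list_frame:
  assumes "lin_indep n v" "k \<le> n"
  shows "basis_list (map v [0..<k]) (V.span (v ` {..<k}))"
  using lin_indep_mono[OF assms] unfolding lin_indep_iff basis_list_def
  by (auto simp: atLeast0LessThan)

lemma basis_list_length: "basis_list bs W \<Longrightarrow> length bs = V.dim W"
  unfolding basis_list_def using V.dim_span_eq_card_independent[of "set bs"]
  by (auto simp: distinct_card)

lemma minor_in_plucker_vectors:
  assumes "v \<in> frames n" "(\<lambda>k. V.span (v ` {..<k})) \<in> F"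
  shows "minor v \<in> plucker_vectors n F"
  unfolding plucker_vectors_def
proof (intro CollectI bexI[OF _ assms(2)] ballI)
  fix k assume "k \<in> {1..n}"
  then show "\<exists>bs. basis_list bs (V.span (v ` {..<k})) \<and>
      (\<forall>is\<in>tuples n. length is = k \<longrightarrow> minor v is = wedge_coord bs is)"
    using assms basis_list_frame[of n v k]
    by (intro exI[of _ "map v [0..<k]"]) (auto simp: frames_def minor_def)
qed

lemma span_frame_flags:
  assumes "v \<in> frames n"
  shows "(\<lambda>k. V.span (v ` {..<k})) \<in> flags n"
proof -
  have "V.span (v ` {..<k}) \<subseteq> CN n" if "k \<le> n" for k
    by (rule V.span_minimal) (use assms that subspace_CN in \<open>auto simp: frames_def\<close>)
  moreover have "V.dim (V.span (v ` {..<k})) = k" if "k \<le> n" for k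
    using basis_list_length[OF basis_list_frame[of n v k]] assms that by (auto simp: frames_def)
  moreover have "V.span (v ` {..<k}) \<subseteq> V.span (v ` {..<Suc k})" for k
    by (rule V.span_mono) auto
  ultimately show ?thesis
    by (auto simp: flags_def)
qed

lemma span_symplectic_frame_flags:
  assumes "v \<in> symplectic_frames n"
  shows "(\<lambda>k. V.span (v ` {..<k})) \<in> symplectic_flags n"
  unfolding symplectic_flags_def
proof (intro CollectI conjI ballI)
  show "(\<lambda>k. V.span (v ` {..<k})) \<in> flags n"
    using assms by (intro span_frame_flags) (simp add: symplectic_frames_def)
  fix k x y assume k: "k \<in> {1..n}" and xy: "x \<in> V.span (v ` {..<k})" "y \<in> V.span (v ` {..<k})"
  have "symp_form n v' w = 0" if "v' \<in> v ` {..<k}" "w \<in> v ` {..<k}" for v' w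
    using that k assms by (auto simp: symplectic_frames_def)
  from isotropic_span[OF this xy] show "symp_form n x y = 0" .
qed

lemma extend_to_next:
  assumes "V.subspace W" "V.dim W = Suc k" "length vs = k" "distinct vs"
    "\<not> V.dependent (set vs)" "set vs \<subseteq> W"
  shows "\<exists>u. u \<notin> V.span (set vs) \<and> V.span (insert u (set vs)) = W"
proof -
  obtain B where B: "B \<subseteq> W" "\<not> V.dependent B" "W \<subseteq> V.span B" "card B = Suc k"
    using V.basis_exists[of W] assms(2) by metis
  have finB: "finite B"
    using B(4) by (metis card.infinite nat.distinct(1))
  \<comment> \<open>The span of \<open>k\<close> vectors cannot contain \<open>k + 1\<close>
    independent ones.\<close>
  have "\<not> W \<subseteq> V.span (set vs)"
  proof
    assume "W \<subseteq> V.span (set vs)"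
    then have "card B \<le> card (set vs)"
      using B V.independent_span_bound[of "set vs" B] by auto
    then show False
      using B(4) assms(3,4) by (simp add: distinct_card)
  qed
  then obtain u where u: "u \<in> W" "u \<notin> V.span (set vs)"
    by auto
  have ind: "\<not> V.dependent (insert u (set vs))"
    using assms(5) u(2) by (rule V.independent_insertI[rotated])
  have un: "u \<notin> set vs"
    using u(2) V.span_base by blast
  have "W \<subseteq> V.span (insert u (set vs))"
  proof
    fix w assume w: "w \<in> W"
    show "w \<in> V.span (insert u (set vs))"
    proof (rule ccontr)
      \<comment> \<open>Such a \<open>w\<close> would yield \<open>k + 2\<close> independent vectors
        in the span of the \<open>k + 1\<close> vectors of \<open>B\<close>.\<close>
      assume nw: "w \<notin> V.span (insert u (set vs))"
      then have "\<not> V.dependent (insert w (insert u (set vs)))"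
        using ind by (rule V.independent_insertI)
      moreover have "insert w (insert u (set vs)) \<subseteq> V.span B"
        using w u(1) assms(6) B(3) by auto
      ultimately have "card (insert w (insert u (set vs))) \<le> card B"
        using V.independent_span_bound[OF finB] by blast
      moreover have "w \<notin> insert u (set vs)"
        using nw V.span_base by blast
      ultimately show False
        using B(4) un assms(3,4) by (simp add: distinct_card)
    qed
  qed
  moreover have "V.span (insert u (set vs)) \<subseteq> W"
    using u(1) assms(1,6) by (intro V.span_minimal) auto
  ultimately show ?thesis
    using u(2) by blast
qed

lemma adapted_basis:
  assumes "V \<in> flags n"
  shows "\<exists>v. lin_indep n v \<and> (\<forall>k\<in>{1..n}. V.span (v ` {..<k}) = V k)"
proof -
  have "\<exists>vs. length vs = k \<and> distinct vs \<and> \<not> V.dependent (set vs) \<and>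
     (\<forall>j\<in>{1..k}. V.span (set (take j vs)) = V j)" if "k \<le> n" for k
    using that
  proof (induction k)
    case 0
    then show ?case by (auto simp: V.independent_empty)
  next
    case (Suc k)
    then obtain vs where vs: "length vs = k" "distinct vs" "\<not> V.dependent (set vs)"
      "\<forall>j\<in>{1..k}. V.span (set (take j vs)) = V j"
      by auto
    have W: "V.subspace (V (Suc k))" "V.dim (V (Suc k)) = Suc k"
      using assms Suc.prems by (auto simp: flags_def)
    have "set vs \<subseteq> V (Suc k)"
    \<comment> \<open>\<open>flags\<close> says nothing about \<open>V 0\<close>; for
      \<open>k = 0\<close> the list \<open>vs\<close> is empty.\<close>
    proof (cases "k = 0")
      case False
      then have "V.span (set (take k vs)) = V k"
        using vs(4) by auto
      then have "V k = V.span (set vs)"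
        using vs(1) by simp
      moreover have "V k \<subseteq> V (Suc k)"
        using assms Suc.prems False by (auto simp: flags_def)
      ultimately show ?thesis
        using V.span_base by blast
    qed (use vs in auto)
    from extend_to_next[OF W vs(1-3) this] obtain u where
      u: "u \<notin> V.span (set vs)" "V.span (insert u (set vs)) = V (Suc k)"
      by blast
    have "u \<notin> set vs"
      using u(1) V.span_base by blast
    moreover have "\<not> V.dependent (insert u (set vs))"
      using u(1) vs(3) by (rule V.independent_insertI)
    moreover have "V.span (set (take j (vs @ [u]))) = V j" if "j \<in> {1..Suc k}" for j
      using that vs u(2) by (cases "j = Suc k") auto
    ultimately show ?case
      using vs(1,2) by (intro exI[of _ "vs @ [u]"]) auto
  qed
  from this[of n] obtain vs where vs: "length vs = n" "distinct vs" "\<not> V.dependent (set vs)"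
      "\<forall>j\<in>{1..n}. V.span (set (take j vs)) = V j"
    by auto
  have m: "map (\<lambda>a. vs ! a) [0..<n] = vs"
    using map_nth[of vs] vs(1) by simp
  have "(!) vs ` {..<k} = set (take k vs)" if "k \<le> n" for k
    using that vs(1) nth_image[of k vs] by (simp add: atLeast0LessThan)
  then show ?thesis
    using vs m by (intro exI[of _ "\<lambda>a. vs ! a"]) (auto simp: lin_indep_iff)
qed

text \<open>The factor is the determinant of the transition matrix, invertible because the reverse
  transition matrix is its inverse.\<close>

lemma wedge_coord_change_of_basis:
  assumes "basis_list bs W" "basis_list vs W"
  shows "\<exists>c. c \<noteq> 0 \<and> (\<forall>is. wedge_coord bs is = c * wedge_coord vs is)"
proof -
  define k where "k = length bs"
  have len: "length bs = k" "length vs = k"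
    using basis_list_length assms by (auto simp: k_def)
  define T where "T = (\<lambda>xs ys. mat k k (\<lambda>(a, b). V.representation (set ys) (xs ! a) (ys ! b)))"
  have rep: "(\<Sum>b=0..<k. scaleV (V.representation (set ys) x (ys ! b)) (ys ! b)) = x"
    if "basis_list ys W" "length ys = k" "x \<in> W" for ys x
  proof -
    have "bij_betw (\<lambda>b. ys ! b) {..<k} (set ys)"
      using that bij_betw_nth[of ys "{..<k}" "set ys"] by (simp add: basis_list_def)
    then have "(\<Sum>b\<in>{..<k}. scaleV (V.representation (set ys) x (ys ! b)) (ys ! b)) =
       (\<Sum>y\<in>set ys. scaleV (V.representation (set ys) x y) y)"
      by (rule sum.reindex_bij_betw)
    also have "\<dots> = x"
      using that by (intro V.sum_representation_eq) (auto simp: basis_list_def)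
    finally show ?thesis
      by (simp add: atLeast0LessThan)
  qed
  have inW: "ys ! b \<in> W" if "basis_list ys W" "length ys = k" "b < k" for ys b
    using that V.span_base[of "ys ! b" "set ys"] by (auto simp: basis_list_def)
  have w: "wedge_coord bs is = Determinant.det (T bs vs) * wedge_coord vs is" for "is"
  proof -
    have "mat k k (\<lambda>(a, b). (bs ! a) (is ! b)) = T bs vs * mat k k (\<lambda>(a, b). (vs ! a) (is ! b))"
    proof (rule eq_matI)
      fix a b assume ab: "a < dim_row (T bs vs * mat k k (\<lambda>(a, b). (vs ! a) (is ! b)))"
        "b < dim_col (T bs vs * mat k k (\<lambda>(a, b). (vs ! a) (is ! b)))"
      then have ab: "a < k" "b < k"
        by (auto simp: T_def)
      have "(bs ! a) (is ! b) =
         (\<Sum>c=0..<k. scaleV (V.representation (set vs) (bs ! a) (vs ! c)) (vs ! c)) (is ! b)"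
        using rep[OF assms(2) len(2) inW[OF assms(1) len(1) ab(1)]] by simp
      then show "mat k k (\<lambda>(a, b). (bs ! a) (is ! b)) $$ (a, b) =
          (T bs vs * mat k k (\<lambda>(a, b). (vs ! a) (is ! b))) $$ (a, b)"
        using ab by (simp add: T_def scalar_prod_def sum_scaleV)
    qed (auto simp: T_def)
    then show ?thesis
      using len det_mult[of "T bs vs" k "mat k k (\<lambda>(a, b). (vs ! a) (is ! b))"]
      by (simp add: wedge_coord_def T_def)
  qed
  have "T vs bs * T bs vs = 1\<^sub>m k"
  proof (rule eq_matI)
    fix a b assume "a < dim_row (1\<^sub>m k :: complex mat)" "b < dim_col (1\<^sub>m k :: complex mat)"
    then have ab: "a < k" "b < k"
      by auto
    have ind: "\<not> V.dependent (set vs)" and sp: "V.span (set vs) = W"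
      using assms(2) by (auto simp: basis_list_def)
    have "(T vs bs * T bs vs) $$ (a, b) =
       (\<Sum>c=0..<k. V.representation (set bs) (vs ! a) (bs ! c) * V.representation (set vs) (bs ! c) (vs ! b))"
      using ab by (simp add: T_def scalar_prod_def)
    also have "\<dots> = V.representation (set vs)
         (\<Sum>c=0..<k. scaleV (V.representation (set bs) (vs ! a) (bs ! c)) (bs ! c)) (vs ! b)"
      by (subst V.representation_sum[OF ind])
         (auto simp: sp V.representation_scale[OF ind] inW[OF assms(1) len(1)] intro!: sum.cong
            V.subspace_scale[OF V.subspace_span[of "set vs", unfolded sp]])
    also have "\<dots> = V.representation (set vs) (vs ! a) (vs ! b)"
      by (simp add: rep[OF assms(1) len(1) inW[OF assms(2) len(2) ab(1)]])
    also have "\<dots> = (if vs ! b = vs ! a then 1 else 0)"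
      using ab len by (subst V.representation_basis[OF ind]) auto
    also have "\<dots> = 1\<^sub>m k $$ (a, b)"
      using ab assms(2) len by (auto simp: basis_list_def nth_eq_iff_index_eq)
    finally show "(T vs bs * T bs vs) $$ (a, b) = 1\<^sub>m k $$ (a, b)" .
  qed (auto simp: T_def)
  then have "Determinant.det (T vs bs) * Determinant.det (T bs vs) = 1"
    using det_mult[of "T vs bs" k "T bs vs"] by (simp add: T_def)
  then have "Determinant.det (T bs vs) \<noteq> 0"
    by auto
  with w show ?thesis
    by blast
qed

lemma lin_indep_scale:
  assumes "lin_indep n v" "\<And>a. a < n \<Longrightarrow> s a \<noteq> 0"
  shows "lin_indep n (\<lambda>a. scaleV (s a) (v a))"
  unfolding lin_indep_def
proof (intro allI impI)
  fix c a assume "\<forall>i. (\<Sum>a<n. c a * scaleV (s a) (v a) i) = 0" "a < n"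
  then have "\<forall>i. (\<Sum>a<n. (c a * s a) * v a i) = 0"
    by (simp add: scaleV_def algebra_simps)
  from lin_indepD[OF assms(1), of "\<lambda>a. c a * s a" a] this \<open>a < n\<close> have "c a * s a = 0"
    by blast
  then show "c a = 0"
    using assms(2) \<open>a < n\<close> by auto
qed

text \<open>Coordinates of length \<open>k\<close> pick up the product of the first \<open>k\<close>
  row factors, so ratios of consecutive \<open>c k\<close> telescope to an arbitrary scaling in each
  length.\<close>

lemma rescale_frame:
  assumes "\<And>k. k \<in> {1..n} \<Longrightarrow> c k \<noteq> (0::complex)"
  shows "\<exists>s. (\<forall>a<n. s a \<noteq> 0) \<and>
    (\<forall>v is. length is \<in> {1..n} \<longrightarrow> minor (\<lambda>a. scaleV (s a) (v a)) is = c (length is) * minor v is)"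
proof -
  define s where "s = (\<lambda>a. if a = 0 then c 1 else c (Suc a) / c a)"
  have "(\<Prod>a<k. s a) = c k" if "k \<in> {1..n}" for k
    using that
  proof (induction k)
    case (Suc k)
    then show ?case
      using assms[of k] by (cases "k = 0") (auto simp: s_def)
  qed auto
  moreover have "s a \<noteq> 0" if "a < n" for a
    using assms[of a] assms[of "Suc a"] that by (auto simp: s_def)
  ultimately show ?thesis
    by (intro exI[of _ s]) (auto simp: minor_scale)
qed

lemma scale_frames:
  assumes "\<forall>a<n. s a \<noteq> 0"
  shows "v \<in> frames n \<Longrightarrow> (\<lambda>a. scaleV (s a) (v a)) \<in> frames n"
    and "v \<in> symplectic_frames n \<Longrightarrow> (\<lambda>a. scaleV (s a) (v a)) \<in> symplectic_frames n"
proof -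
  show *: "(\<lambda>a. scaleV (s a) (v a)) \<in> frames n" if "v \<in> frames n" for v
    using that assms lin_indep_scale[of n v s] V.subspace_scale[OF subspace_CN, of _ n]
    by (auto simp: frames_def)
  have "symp_form n (scaleV c u) (scaleV d w) = c * d * symp_form n u w" for c d u w
    using symp_form_swap[of n u w]
    by (simp add: symp_form_linear symp_form_swap[of n u "scaleV d w"])
  then show "(\<lambda>a. scaleV (s a) (v a)) \<in> symplectic_frames n" if "v \<in> symplectic_frames n"
    using that * by (auto simp: symplectic_frames_def)
qed

text \<open>In a Pluecker vector the bases of the different \<open>V k\<close> are chosen
  independently. An adapted basis matches all of them up to one scalar per \<open>k\<close>, and
  \<open>rescale_frame\<close> absorbs these scalars into the rows.\<close>

lemma plucker_vector_frame:
  assumes "x \<in> plucker_vectors n F" "F \<subseteq> flags n"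
  shows "\<exists>v\<in>frames n. (\<lambda>k. V.span (v ` {..<k})) \<in> flags n \<and>
    (\<exists>V\<in>F. \<forall>k\<in>{1..n}. v ` {..<k} \<subseteq> V k) \<and> (\<forall>is\<in>tuples n. x is = minor v is)"
proof -
  from assms(1) obtain V where V: "V \<in> F" and x: "\<forall>k\<in>{1..n}. \<exists>bs. basis_list bs (V k) \<and>
           (\<forall>is\<in>tuples n. length is = k \<longrightarrow> x is = wedge_coord bs is)"
    by (auto simp: plucker_vectors_def)
  from V assms(2) have Vf: "V \<in> flags n"
    by auto
  from adapted_basis[OF Vf] obtain v where
    v: "lin_indep n v" "\<And>k. k \<in> {1..n} \<Longrightarrow> V.span (v ` {..<k}) = V k"
    by blast
  have bl: "basis_list (map v [0..<k]) (V k)" if "k \<in> {1..n}" for k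
    using basis_list_frame[OF v(1), of k] v(2)[OF that] that by auto
  have "\<exists>c. c \<noteq> 0 \<and> (\<forall>is\<in>tuples n. length is = k \<longrightarrow> x is = c * minor v is)" if k: "k \<in> {1..n}" for k
  proof -
    from x k obtain bs where bs: "basis_list bs (V k)"
      "\<forall>is\<in>tuples n. length is = k \<longrightarrow> x is = wedge_coord bs is"
      by blast
    from wedge_coord_change_of_basis[OF bs(1) bl[OF k]] bs(2) show ?thesis
      by (auto simp: minor_def)
  qed
  then obtain c where c: "\<And>k. k \<in> {1..n} \<Longrightarrow> c k \<noteq> 0"
    "\<And>is. is \<in> tuples n \<Longrightarrow> length is \<in> {1..n} \<Longrightarrow> x is = c (length is) * minor v is"
    by metis
  from rescale_frame[OF c(1), of n "\<lambda>k. k"] obtain s where s: "\<forall>a<n. s a \<noteq> 0"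
    "\<And>v is. length is \<in> {1..n} \<Longrightarrow> minor (\<lambda>a. scaleV (s a) (v a)) is = c (length is) * minor v is"
    by blast
  define v' where "v' = (\<lambda>a. scaleV (s a) (v a))"
  have sub: "v ` {..<k} \<subseteq> V k" if "k \<in> {1..n}" for k
    using v(2)[OF that] V.span_superset[of "v ` {..<k}"] by simp
  have "v a \<in> CN n" if "a < n" for a
  proof -
    have n: "n \<in> {1..n}"
      using that by auto
    with sub have "v a \<in> V n"
      using that by blast
    then show ?thesis
      using Vf n unfolding flags_def by blast
  qed
  then have "v \<in> frames n"
    using v(1) by (simp add: frames_def)
  then have fr: "v' \<in> frames n"
    unfolding v'_def by (intro scale_frames s)
  have "v' ` {..<k} \<subseteq> V k" if "k \<in> {1..n}" for k
  proof
    fix y assume "y \<in> v' ` {..<k}"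
    then obtain a where a: "a < k" "y = scaleV (s a) (v a)"
      by (auto simp: v'_def)
    have "v a \<in> V k"
      using sub[OF that] a by auto
    then show "y \<in> V k"
      using Vf that V.subspace_scale[of "V k"] unfolding a flags_def by blast
  qed
  moreover have "x is = minor v' is" if "is \<in> tuples n" for "is"
    using c(2) s(2) that by (simp add: v'_def tuples_def)
  ultimately show ?thesis
    using fr V span_frame_flags[OF fr] by blast
qed

lemma plucker_vector_symplectic_frame:
  assumes "x \<in> plucker_vectors n (symplectic_flags n)"
  shows "\<exists>v\<in>symplectic_frames n. \<forall>is\<in>tuples n. x is = minor v is"
proof -
  obtain v V where v: "v \<in> frames n" "V \<in> symplectic_flags n" "\<forall>k\<in>{1..n}. v ` {..<k} \<subseteq> V k"
     "\<forall>is\<in>tuples n. x is = minor v is"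
    using plucker_vector_frame[OF assms] by (auto simp: symplectic_flags_def)
  have "symp_form n (v a) (v b) = 0" if ab: "a < n" "b < n" for a b
  proof -
    have n: "n \<in> {1..n}"
      using ab by auto
    then have "v ` {..<n} \<subseteq> V n"
      using v(3) by blast
    then have "v a \<in> V n" "v b \<in> V n"
      using ab by auto
    then show ?thesis
      using v(2) n unfolding symplectic_flags_def by blast
  qed
  with v show ?thesis
    by (auto simp: symplectic_frames_def)
qed

section \<open>The Pluecker ideals as vanishing ideals of frames\<close>

definition vanishing :: "int list set \<Rightarrow> (nat \<Rightarrow> int \<Rightarrow> complex) set \<Rightarrow> int list mpoly set" where
  "vanishing A Fr = {p \<in> polys A. \<forall>v\<in>Fr. peval (minor v) p = 0}"

lemma ideal_vanishing: "ideal (vanishing A Fr) (poly_ring A)"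
proof -
  interpret R: cring "poly_ring A"
    by (rule cring_poly_ring)
  show ?thesis
  proof (rule idealI)
    show "ring (poly_ring A)" ..
    show "subgroup (vanishing A Fr) (add_monoid (poly_ring A))"
    proof (rule R.add.subgroupI)
      fix p assume p: "p \<in> vanishing A Fr"
      then have "\<ominus>\<^bsub>poly_ring A\<^esub> p = - p"
        by (intro R.minus_equality) (auto simp: poly_ring_def vanishing_def polys_closed)
      then show "\<ominus>\<^bsub>poly_ring A\<^esub> p \<in> vanishing A Fr"
        using p by (auto simp: vanishing_def polys_closed peval_uminus)
    qed (auto simp: vanishing_def poly_ring_def polys_closed peval_add intro!: exI[of _ 0])
  qed (auto simp: vanishing_def poly_ring_def polys_closed peval_mult)
qed

text \<open>Packing the multidegree into digits lets one parameter \<open>t\<close> separate all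
  multidegrees at once.\<close>

lemma wt_power_length:
  assumes "m \<in> monomials (tuples n)"
  shows "wt (\<lambda>is. B ^ length is) m = (\<Sum>k<Suc n. multidegree m k * B ^ k)"
proof -
  have "(\<Sum>is\<in>Poly_Mapping.keys m. Poly_Mapping.lookup m is * B ^ length is) =
    (\<Sum>k<Suc n. \<Sum>is\<in>{is \<in> Poly_Mapping.keys m. length is = k}. Poly_Mapping.lookup m is * B ^ length is)"
    using assms by (intro sum.group[symmetric]) (auto simp: monomials_def tuples_def)
  then show ?thesis
    by (simp add: wt_def multidegree_def sum_distrib_right del: sum.lessThan_Suc)
qed

lemma multidegree_eqI:
  assumes "m \<in> monomials (tuples n)" "m' \<in> monomials (tuples n)"
    "wt (\<lambda>is. B ^ length is) m = wt (\<lambda>is. B ^ length is) m'"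
    "wt (\<lambda>_. 1) m < B" "wt (\<lambda>_. 1) m' < B"
  shows "multidegree m = multidegree m'"
proof
  fix k
  have le: "multidegree m k \<le> wt (\<lambda>_. 1) m" for m k
    unfolding multidegree_def wt_def by (auto intro!: sum_mono2)
  show "multidegree m k = multidegree m' k"
  proof (cases "k < Suc n")
    case True
    show ?thesis
      by (rule digits_unique[OF _ _ _ True, of _ B])
         (use assms le_less_trans[OF le] in \<open>simp_all add: wt_power_length del: sum.lessThan_Suc\<close>)
  next
    case False
    then have "{is \<in> Poly_Mapping.keys m. length is = k} = {}" "{is \<in> Poly_Mapping.keys m'. length is = k} = {}"
      using assms(1,2) by (auto simp: monomials_def tuples_def)
    then show ?thesis
      unfolding multidegree_def by (simp only: sum.empty)
  qed
qed

text \<open>Since \<open>Fr\<close> is stable under scaling of rows, every multihomogeneous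
  component of a polynomial vanishing on \<open>Fr\<close> vanishes as well. So the ideal generated
  by the multihomogeneous ones already contains all of them.\<close>

lemma vanishing_ideal_eq:
  assumes A: "A \<subseteq> tuples n"
    and 1: "\<And>x. x \<in> plucker_vectors n F \<Longrightarrow> \<exists>v\<in>Fr. \<forall>is\<in>tuples n. x is = minor v is"
    and 2: "\<And>v. v \<in> Fr \<Longrightarrow> minor v \<in> plucker_vectors n F"
    and scale: "\<And>v s. v \<in> Fr \<Longrightarrow> \<forall>a<n. s a \<noteq> 0 \<Longrightarrow> (\<lambda>a. scaleV (s a) (v a)) \<in> Fr"
  shows "vanishing_ideal n A F = vanishing A Fr"
proof -
  let ?G = "{p \<in> polys A. multihomogeneous p \<and> (\<forall>x\<in>plucker_vectors n F. peval x p = 0)}"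
  interpret R: cring "poly_ring A"
    by (rule cring_poly_ring)
  have carr: "?G \<subseteq> carrier (poly_ring A)"
    by (auto simp: poly_ring_def)
  have "?G \<subseteq> vanishing A Fr"
    using 2 by (auto simp: vanishing_def)
  then have "vanishing_ideal n A F \<subseteq> vanishing A Fr"
    unfolding vanishing_ideal_def by (intro R.genideal_minimal ideal_vanishing)
  moreover have "p \<in> vanishing_ideal n A F" if p: "p \<in> vanishing A Fr" for p
  proof -
    from p have pA: "p \<in> polys A"
      by (simp add: vanishing_def)
    \<comment> \<open>Larger than the degree of every monomial of \<open>p\<close>, so that the
      packed multidegrees have no carries.\<close>
    define B where "B = Suc (\<Sum>m\<in>Poly_Mapping.keys p. wt (\<lambda>_. 1) m)"
    define w where "w = (\<lambda>is :: int list. B ^ length is)"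
    define q where "q = (\<lambda>d. restrict_poly (\<lambda>m. wt w m = d) p)"
    have less: "wt (\<lambda>_. 1) m < B" if "m \<in> Poly_Mapping.keys p" for m
      using member_le_sum[OF that, of "wt (\<lambda>_. 1)"] by (auto simp: B_def)
    have mon: "m \<in> monomials (tuples n)" if "m \<in> Poly_Mapping.keys p" for m
      using that pA A by (auto simp: polys_def monomials_def)
    have "q d \<in> ?G" for d
    proof -
      have "multihomogeneous (q d)"
        unfolding multihomogeneous_def q_def keys_restrict_poly
      proof (intro ballI)
        fix m m'
        assume "m \<in> {m \<in> Poly_Mapping.keys p. wt w m = d}" "m' \<in> {m \<in> Poly_Mapping.keys p. wt w m = d}"
        then show "multidegree m = multidegree m'"
          using less mon by (intro multidegree_eqI[of m n m' B]) (simp_all add: w_def)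
      qed
      moreover have "peval x (q d) = 0" if x: "x \<in> plucker_vectors n F" for x
        unfolding q_def
      proof (rule component_vanishes)
        fix t :: complex assume t: "t \<noteq> 0"
        from 1[OF x] obtain v where v: "v \<in> Fr" "\<forall>is\<in>tuples n. x is = minor v is"
          by blast
        \<comment> \<open>Scaling the coordinates of length \<open>k\<close> by
          \<open>t ^ B ^ k\<close> is the torus action of weight \<open>w\<close>, realised inside
          \<open>Fr\<close>.\<close>
        from rescale_frame[of n "\<lambda>k. t ^ B ^ k"] t obtain s where s: "\<forall>a<n. s a \<noteq> 0"
          "\<And>v is. length is \<in> {1..n} \<Longrightarrow>
             minor (\<lambda>a. scaleV (s a) (v a)) is = t ^ B ^ length is * minor v is"
          by auto
        have "peval (\<lambda>a. t ^ w a * x a) p = peval (minor (\<lambda>a. scaleV (s a) (v a))) p"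
          by (rule peval_cong[OF pA]) (use A v s in \<open>auto simp: w_def tuples_def\<close>)
        also have "\<dots> = 0"
          using p scale[OF v(1) s(1)] by (auto simp: vanishing_def)
        finally show "peval (\<lambda>a. t ^ w a * x a) p = 0" .
      qed
      ultimately show ?thesis
        using pA by (auto simp: q_def restrict_poly_polys)
    qed
    then have q: "q d \<in> vanishing_ideal n A F" for d
      unfolding vanishing_ideal_def using R.genideal_self[OF carr] by blast
    interpret I: ideal "vanishing_ideal n A F" "poly_ring A"
      unfolding vanishing_ideal_def by (rule R.genideal_ideal[OF carr])
    have "(\<Sum>d\<in>D. q d) \<in> vanishing_ideal n A F" for D
    proof (induction D rule: infinite_finite_induct)
      case (insert d D)
      then show ?case
        using I.a_closed[of "q d" "\<Sum>d\<in>D. q d"] q by (simp add: poly_ring_def)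
    qed (use I.zero_closed in \<open>auto simp: poly_ring_def\<close>)
    moreover have "p = (\<Sum>d\<in>wt w ` Poly_Mapping.keys p. q d)"
      unfolding q_def by (rule sum_components) auto
    ultimately show ?thesis
      by metis
  qed
  ultimately show ?thesis
    by blast
qed

lemma Theta_subset: "Theta n \<subseteq> tuples n"
  by (auto simp: Theta_def)

lemma typeA_plucker_ideal_eq: "typeA_plucker_ideal n = vanishing (tuples n) (frames n)"
  unfolding typeA_plucker_ideal_def
proof (rule vanishing_ideal_eq)
  show "\<exists>v\<in>frames n. \<forall>is\<in>tuples n. x is = minor v is" if "x \<in> plucker_vectors n (flags n)" for x
    using plucker_vector_frame[OF that] by blast
qed (auto intro: scale_frames minor_in_plucker_vectors span_frame_flags)

lemma symplectic_plucker_ideal_eq: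
  "symplectic_plucker_ideal n = vanishing (Theta n) (symplectic_frames n)"
  unfolding symplectic_plucker_ideal_def
proof (rule vanishing_ideal_eq)
  show "\<exists>v\<in>symplectic_frames n. \<forall>is\<in>tuples n. x is = minor v is"
    if "x \<in> plucker_vectors n (symplectic_flags n)" for x
    using plucker_vector_symplectic_frame[OF that] .
  show "minor v \<in> plucker_vectors n (symplectic_flags n)" if "v \<in> symplectic_frames n" for v
    using that span_symplectic_frame_flags
    by (intro minor_in_plucker_vectors) (auto simp: symplectic_frames_def)
qed (auto intro: scale_frames Theta_subset[THEN subsetD])

lemma proj_Theta_eq_restrict:
  "proj_Theta n p = restrict_poly (\<lambda>m. Poly_Mapping.keys m \<subseteq> Theta n) p"
proof -
  let ?f = "\<lambda>is. if is \<in> Theta n then var is else 0"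
  have "const c * mon_eval ?f m = (if Poly_Mapping.keys m \<subseteq> Theta n then Poly_Mapping.single m c else 0)"
    for m c
  proof (cases "Poly_Mapping.keys m \<subseteq> Theta n")
    case True
    then have "mon_eval ?f m = mon_eval var m"
      by (intro mon_eval_cong) auto
    then show ?thesis
      using True by (simp add: single_conv_var)
  next
    case False
    then have "mon_eval ?f m = 0"
      unfolding mon_eval_def by (intro prod_zero) (auto simp: zero_power_eq in_keys_iff)
    then show ?thesis
      using False by simp
  qed
  then show ?thesis
    by (simp add: proj_Theta_def poly_hom_alt restrict_poly_def sum.If_cases Int_def)
qed

section \<open>Linear relations between symplectic minors\<close>

lemma minor_permute:
  assumes "p permutes {..<length is}"
  shows "minor v (permute_list p is) = signof p * minor v is"
proof -
  let ?S = "{0..<length is}"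
  let ?t = "\<lambda>q. signof q * (\<Prod>i\<in>?S. v (q i) (is ! i)) :: complex"
  have p: "p permutes ?S"
    using assms by (simp add: atLeast0LessThan)
  have "minor v (permute_list p is) =
     (\<Sum>q | q permutes ?S. signof q * (\<Prod>i\<in>?S. v (q i) (is ! p i)))"
    using assms by (auto simp: minor_Leibniz permute_list_nth intro!: sum.cong prod.cong)
  also have "\<dots> = (\<Sum>q | q permutes ?S. signof (q \<circ> p) * (\<Prod>i\<in>?S. v ((q \<circ> p) i) (is ! p i)))"
    by (rule sum_permutations_compose_right[OF p])
  also have "\<dots> = (\<Sum>q | q permutes ?S. signof p * ?t q)"
  proof (rule sum.cong[OF refl])
    fix q assume "q \<in> {q. q permutes ?S}"
    then have "sign (q \<circ> p) = sign q * sign p"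
      using p by (intro sign_compose permutation_permutes[THEN iffD2] exI[of _ ?S]) auto
    moreover have "(\<Prod>i\<in>?S. v (q (p i)) (is ! p i)) = (\<Prod>i\<in>?S. v (q i) (is ! i))"
      using prod.permute[OF p, of "\<lambda>i. v (q i) (is ! i)"] by (simp add: o_def)
    ultimately show "signof (q \<circ> p) * (\<Prod>i\<in>?S. v ((q \<circ> p) i) (is ! p i)) = signof p * ?t q"
      by (simp add: o_def)
  qed
  also have "\<dots> = signof p * minor v is"
    by (simp add: minor_Leibniz sum_distrib_left)
  finally show ?thesis .
qed

text \<open>The sign comes from the permutation alone. Choosing it before \<open>v\<close> is
  essential: it becomes a coefficient in polynomial identities valid for all frames.\<close>

lemma minor_mset_eq:
  assumes "mset is = mset js"
  shows "\<exists>\<epsilon>\<in>{1, -1}. \<forall>v. minor v is = \<epsilon> * minor v js"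
proof -
  from mset_eq_permutation[OF assms] obtain p where
    "p permutes {..<length js}" "permute_list p js = is"
    by blast
  then show ?thesis
    using minor_permute[of p js] by (intro bexI[of _ "signof p"]) (auto simp: sign_def)
qed

lemma minor_swap: "minor v (a @ x # y # b) = - minor v (a @ y # x # b)"
proof -
  let ?i = "length a"
  let ?p = "transpose ?i (Suc ?i)" and ?l = "a @ y # x # b"
  have p: "?p permutes {..<length ?l}"
    by (rule permutes_swap_id) auto
  have "permute_list ?p ?l = a @ x # y # b"
    by (rule nth_equalityI)
       (use p in \<open>auto simp: permute_list_nth transpose_def nth_append nth_Cons' \<close>)
  with minor_permute[OF p, of v] show ?thesis
    by (simp add: sign_swap_id)
qed

lemma minor_not_distinct:
  assumes "\<not> distinct is"
  shows "minor v is = 0"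
proof -
  from assms obtain a x b c where "is = a @ [x] @ b @ [x] @ c"
    using not_distinct_decomp by blast
  then have "mset is = mset (a @ x # x # (b @ c))"
    by simp
  from minor_mset_eq[OF this] obtain \<epsilon> where "minor v is = \<epsilon> * minor v (a @ x # x # (b @ c))"
    by blast
  moreover have "minor v (a @ x # x # (b @ c)) = 0"
    using minor_swap[of v a x x "b @ c"] by simp
  ultimately show ?thesis
    by simp
qed

text \<open>Summed over \<open>j\<close>, the first two columns contribute
  \<open>G (p 0) (p 1)\<close>, and isotropy of the rows says exactly that \<open>G\<close> is
  symmetric. Composing \<open>p\<close> with the transposition of 0 and 1 changes only the sign, so
  the sum is its own negative.\<close>

lemma symplectic_relation:
  assumes v: "v \<in> symplectic_frames n" and len: "length q + 2 \<le> n"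
  shows "(\<Sum>j\<in>{1..int n}. minor v (j # - j # q)) = 0"
proof -
  let ?k = "Suc (Suc (length q))"
  let ?S = "{0..<?k}"
  define G where "G = (\<lambda>a b. \<Sum>j\<in>{1..int n}. v a j * v b (- j))"
  define H where "H = (\<lambda>p :: nat \<Rightarrow> nat. \<Prod>i=0..<length q. v (p (Suc (Suc i))) (q ! i))"
  have G: "G a b = G b a" if "a < n" "b < n" for a b
  proof -
    have "symp_form n (v a) (v b) = 0"
      using v that by (simp add: symplectic_frames_def)
    then show ?thesis
      by (simp add: symp_form_def G_def sum_subtractf mult.commute)
  qed
  let ?p = "transpose 0 (1 :: nat)"
  have p: "?p permutes ?S"
    by (rule permutes_swap_id) auto
  have "minor v (j # - j # q) = (\<Sum>p | p permutes ?S. signof p * (v (p 0) j * v (p 1) (- j) * H p))" for j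
    by (simp add: minor_Leibniz prod.atLeast0_lessThan_Suc_shift H_def o_def mult.assoc
        del: prod.op_ivl_Suc)
  then have "(\<Sum>j\<in>{1..int n}. minor v (j # - j # q)) =
      (\<Sum>p | p permutes ?S. signof p * (G (p 0) (p 1) * H p))"
    by (simp, subst sum.swap) (simp add: G_def sum_distrib_left sum_distrib_right mult.assoc)
  also have "\<dots> = (\<Sum>p | p permutes ?S. signof (p \<circ> ?p) * (G ((p \<circ> ?p) 0) ((p \<circ> ?p) 1) * H (p \<circ> ?p)))"
    by (rule sum_permutations_compose_right[OF p])
  also have "\<dots> = (\<Sum>p | p permutes ?S. - (signof p * (G (p 0) (p 1) * H p)))"
  proof (rule sum.cong[OF refl])
    fix r assume "r \<in> {r. r permutes ?S}"
    then have r: "r permutes ?S"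
      by simp
    then have "sign (r \<circ> ?p) = sign r * sign ?p"
      using p by (intro sign_compose permutation_permutes[THEN iffD2] exI[of _ ?S]) auto
    moreover have "r 0 < n" "r 1 < n"
      using permutes_in_image[OF r, of 0] permutes_in_image[OF r, of 1] len by auto
    moreover have "H (r \<circ> ?p) = H r"
      by (simp add: H_def)
    ultimately show "signof (r \<circ> ?p) * (G ((r \<circ> ?p) 0) ((r \<circ> ?p) 1) * H (r \<circ> ?p)) =
        - (signof r * (G (r 0) (r 1) * H r))"
      using G[of "r 0" "r 1"] by (simp add: sign_swap_id)
  qed
  also have "\<dots> = - (\<Sum>p | p permutes ?S. signof p * (G (p 0) (p 1) * H p))"
    by (simp add: sum_negf)
  finally show ?thesis
    using \<open>(\<Sum>j\<in>{1..int n}. minor v (j # - j # q)) = _\<close> by simp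
qed

text \<open>The matrix of inclusion between the \<open>(b - 1)\<close>- and the \<open>b\<close>-element subsets of a set with fewer
  than \<open>2 * b\<close> elements has full rank: inclusion-exclusion over \<open>G\<close> expresses \<open>y B\<close> through the sums of
  \<open>y\<close> over all \<open>b\<close>-element supersets of a given small set.\<close>

lemma inclusion_sums:
  fixes y :: "'a set \<Rightarrow> 'z \<Rightarrow> complex" and R :: "('z \<Rightarrow> complex) set"
  assumes R0: "0 \<in> R" and Radd: "\<And>f g. f \<in> R \<Longrightarrow> g \<in> R \<Longrightarrow> f + g \<in> R"
    and Rscale: "\<And>c f. f \<in> R \<Longrightarrow> (\<lambda>z. c * f z) \<in> R"
    and L: "finite L"
    and rel: "\<And>D. D \<subseteq> L \<Longrightarrow> Suc (card D) = b \<Longrightarrow> (\<Sum>j\<in>L - D. y (insert j D)) \<in> R"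
  shows "D \<subseteq> L \<Longrightarrow> G \<subseteq> L \<Longrightarrow> card D + card G < b \<Longrightarrow> D \<inter> G = {} \<Longrightarrow>
    (\<Sum>B\<in>{B. B \<subseteq> L \<and> card B = b \<and> D \<subseteq> B \<and> B \<inter> G = {}}. y B) \<in> R"
proof -
  define e where "e = (\<lambda>D G. \<Sum>B\<in>{B. B \<subseteq> L \<and> card B = b \<and> D \<subseteq> B \<and> B \<inter> G = {}}. y B)"
  have Rsum: "(\<And>i. i \<in> I \<Longrightarrow> f i \<in> R) \<Longrightarrow> (\<Sum>i\<in>I. f i) \<in> R" for I :: "'a set" and f
    by (induction I rule: infinite_finite_induct) (auto simp: R0 Radd)
  have fin: "finite {B. B \<subseteq> L \<and> Q B}" for Q
    using L by (rule rev_finite_subset[OF finite_Pow_iff[THEN iffD2]]) auto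
  \<comment> \<open>Downward induction on \<open>card D\<close>: adding one more element
    \<open>j\<close> in all ways counts each superset of size \<open>b\<close> exactly
    \<open>b - card D\<close> times, an invertible factor.\<close>
  have base: "e D {} \<in> R" if "D \<subseteq> L" "card D < b" for D
    using that
  proof (induction "b - card D" arbitrary: D)
    case (Suc d)
    have finD: "finite D"
      using Suc.prems L finite_subset by blast
    have "(\<Sum>j\<in>L - D. e (insert j D) {}) \<in> R"
    proof (cases "Suc (card D) = b")
      case True
      have "e (insert j D) {} = y (insert j D)" if "j \<in> L - D" for j
      proof -
        have c: "card (insert j D) = b"
          using True that finD by simp
        have "insert j D = B" if "B \<subseteq> L" "card B = b" "insert j D \<subseteq> B" for B
          using that c L finite_subset[of B L] by (intro card_subset_eq) auto
        then have "{B. B \<subseteq> L \<and> card B = b \<and> insert j D \<subseteq> B \<and> B \<inter> {} = {}} = {insert j D}"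
          using c that Suc.prems(1) by auto
        then show ?thesis
          by (simp add: e_def)
      qed
      then show ?thesis
        using rel[OF Suc.prems(1) True] by simp
    next
      case False
      show ?thesis
        by (rule Rsum, rule Suc.hyps) (use Suc False finD in auto)
    qed
    also have "(\<Sum>j\<in>L - D. e (insert j D) {}) = (\<lambda>z. of_nat (b - card D) * e D {} z)"
    proof -
      let ?Bs = "{B. B \<subseteq> L \<and> card B = b \<and> D \<subseteq> B \<and> B \<inter> {} = {}}"
      have "(\<Sum>j\<in>L - D. e (insert j D) {}) = (\<Sum>j\<in>L - D. \<Sum>B\<in>{B \<in> ?Bs. j \<in> B}. y B)"
        unfolding e_def by (intro sum.cong refl) auto
      also have "\<dots> = (\<Sum>B\<in>?Bs. \<Sum>j\<in>{j \<in> L - D. j \<in> B}. y B)"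
        using L fin by (intro sum.swap_restrict) auto
      also have "\<dots> = (\<Sum>B\<in>?Bs. \<Sum>j\<in>B - D. y B)"
        by (intro sum.cong refl) auto
      also have "\<dots> = (\<lambda>z. of_nat (b - card D) * e D {} z)"
      proof
        fix z
        have app: "(\<Sum>B\<in>Q. g B) z = (\<Sum>B\<in>Q. g B z)" for Q :: "'c set" and g :: "'c \<Rightarrow> 'z \<Rightarrow> complex"
          by (induction Q rule: infinite_finite_induct) auto
        have "card (B - D) = b - card D" if "B \<in> ?Bs" for B
          using that finD by (auto simp: card_Diff_subset)
        then show "(\<Sum>B\<in>?Bs. \<Sum>j\<in>B - D. y B) z = of_nat (b - card D) * e D {} z"
          unfolding e_def app by (simp add: sum_distrib_left)
      qed
      finally show ?thesis .
    qed
    finally have "(\<lambda>z. inverse (of_nat (b - card D)) * (of_nat (b - card D) * e D {} z)) \<in> R"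
      by (rule Rscale)
    moreover have "(\<lambda>z. inverse (of_nat (b - card D)) * (of_nat (b - card D) * e D {} z)) = e D {}"
    proof -
      have "of_nat (b - card D) \<noteq> (0 :: complex)"
        using Suc.prems(2) by (simp del: of_nat_diff)
      then show ?thesis
        by (simp add: fun_eq_iff del: of_nat_diff of_nat_eq_0_iff)
    qed
    ultimately show ?case
      by simp
  qed auto
  \<comment> \<open>Forbidding \<open>g\<close> means subtracting the sets that contain
    \<open>g\<close>. This moves an element from \<open>G\<close> to \<open>D\<close> and so
    preserves the bound on \<open>card D + card G\<close>.\<close>
  have gen: "e D G \<in> R" if "finite G" "D \<subseteq> L" "G \<subseteq> L" "card D + card G < b" "D \<inter> G = {}" for D G
    using that
  proof (induction G arbitrary: D rule: finite_induct)
    case empty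
    then show ?case
      using base by simp
  next
    case (insert g G)
    have finD: "finite D"
      using insert.prems L finite_subset by blast
    let ?A = "{B. B \<subseteq> L \<and> card B = b \<and> D \<subseteq> B \<and> B \<inter> G = {}}"
    have "e D G = (\<Sum>B\<in>{B \<in> ?A. g \<notin> B}. y B) + (\<Sum>B\<in>{B \<in> ?A. g \<in> B}. y B)"
      unfolding e_def
      by (subst sum.union_disjoint[symmetric]) (auto intro!: sum.cong fin finite_subset[OF _ fin[of "\<lambda>_. True"]])
    also have "{B \<in> ?A. g \<notin> B} = {B. B \<subseteq> L \<and> card B = b \<and> D \<subseteq> B \<and> B \<inter> insert g G = {}}"
      by auto
    also have "{B \<in> ?A. g \<in> B} = {B. B \<subseteq> L \<and> card B = b \<and> insert g D \<subseteq> B \<and> B \<inter> G = {}}"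
      by auto
    finally have "e D G = e D (insert g G) + e (insert g D) G"
      by (simp only: e_def)
    then have "e D (insert g G) = e D G + (\<lambda>z. - 1 * e (insert g D) G z)"
      by (simp add: fun_eq_iff)
    moreover have "e D G \<in> R"
      using insert by auto
    moreover have "e (insert g D) G \<in> R"
      using insert finD by (intro insert.IH) (auto simp: card_insert_if)
    ultimately show ?case
      using Radd Rscale by metis
  qed
  show ?thesis if "D \<subseteq> L" "G \<subseteq> L" "card D + card G < b" "D \<inter> G = {}"
    using gen[OF finite_subset[OF that(2) L] that] by (simp only: e_def)
qed

text \<open>Take \<open>D = {}\<close> and \<open>G = L - B\<close> in
  \<open>inclusion_sums\<close>: a subset of \<open>L\<close> of the size of \<open>B\<close> that
  avoids \<open>L - B\<close> is \<open>B\<close> itself. The set \<open>R\<close> is thought of as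
  a subspace modulo which one computes.\<close>

lemma inclusion_full_rank:
  fixes y :: "'a set \<Rightarrow> 'z \<Rightarrow> complex" and R :: "('z \<Rightarrow> complex) set"
  assumes "0 \<in> R" "\<And>f g. f \<in> R \<Longrightarrow> g \<in> R \<Longrightarrow> f + g \<in> R"
    "\<And>c f. f \<in> R \<Longrightarrow> (\<lambda>z. c * f z) \<in> R"
    and L: "finite L"
    and rel: "\<And>D. D \<subseteq> L \<Longrightarrow> Suc (card D) = card B \<Longrightarrow> (\<Sum>j\<in>L - D. y (insert j D)) \<in> R"
    and B: "B \<subseteq> L" "card (L - B) < card B"
  shows "y B \<in> R"
proof -
  have "(\<Sum>B'\<in>{B'. B' \<subseteq> L \<and> card B' = card B \<and> {} \<subseteq> B' \<and> B' \<inter> (L - B) = {}}. y B') \<in> R"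
    by (rule inclusion_sums[OF assms(1-3) L rel]) (use B in auto)
  also have "{B'. B' \<subseteq> L \<and> card B' = card B \<and> {} \<subseteq> B' \<and> B' \<inter> (L - B) = {}} = {B}"
  proof -
    have "B' = B" if "B' \<subseteq> L" "card B' = card B" "B' \<inter> (L - B) = {}" for B'
      using that B L finite_subset by (intro card_subset_eq) auto
    then show ?thesis
      using B by auto
  qed
  finally show ?thesis
    by simp
qed


section \<open>Straightening non-admissible symplectic minors\<close>

definition idx_weight :: "nat \<Rightarrow> int \<Rightarrow> nat" where
  "idx_weight n i = (if i > 0 then 2 ^ Suc n - 2 ^ nat i else 0)"

definition tuple_weight :: "nat \<Rightarrow> int list \<Rightarrow> nat" where
  "tuple_weight n is = (\<Sum>i\<leftarrow>is. idx_weight n i)"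

definition tuple_of :: "int set \<Rightarrow> int list" where
  "tuple_of T = sorted_list_of_set {i \<in> T. i > 0} @ sorted_list_of_set {i \<in> T. i < 0}"

lemma finite_index_set: "finite (index_set n)"
  by (simp add: index_set_def)

lemma tuple_of:
  assumes "T \<subseteq> index_set n"
  shows "set (tuple_of T) = T" "distinct (tuple_of T)" "sorted_wrt idx_less (tuple_of T)"
    "length (tuple_of T) = card T"
proof -
  have fin: "finite T"
    using assms finite_index_set finite_subset by blast
  have 0: "0 \<notin> T"
    using assms by (auto simp: index_set_def)
  show set: "set (tuple_of T) = T"
    using fin 0 by (auto simp: tuple_of_def) (metis linorder_neqE_linordered_idom)
  show dist: "distinct (tuple_of T)"
    using fin by (auto simp: tuple_of_def)
  show "length (tuple_of T) = card T"
    using distinct_card[OF dist] set by simp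
  have srt: "sorted_wrt idx_less (sorted_list_of_set {i \<in> T. 0 < i})"
     "sorted_wrt idx_less (sorted_list_of_set {i \<in> T. i < 0})"
    using fin by (auto intro!: sorted_wrt_mono_rel[OF _ strict_sorted_list_of_set] simp: idx_less_def)
  show "sorted_wrt idx_less (tuple_of T)"
    unfolding tuple_of_def sorted_wrt_append using srt fin by (auto simp: idx_less_def)
qed

lemma tuple_of_tuples:
  assumes "T \<subseteq> index_set n" "card T \<in> {1..n}"
  shows "tuple_of T \<in> tuples n"
  using tuple_of[OF assms(1)] assms by (simp add: tuples_def)

lemma tuples_distinct: "is \<in> tuples n \<Longrightarrow> distinct is"
  unfolding tuples_def distinct_conv_nth sorted_wrt_iff_nth_less idx_less_def
  by (auto, metis less_irrefl nat_neq_iff order_less_asym)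

lemma tuple_weight_set: "distinct is \<Longrightarrow> tuple_weight n is = (\<Sum>i\<in>set is. idx_weight n i)"
  by (simp add: tuple_weight_def sum_list_distinct_conv_sum_set)

section \<open>Minors as functions of a set of pairs\<close>

definition pair_list :: "int list \<Rightarrow> int list" where
  "pair_list ps = concat (map (\<lambda>j. [j, - j]) ps)"

text \<open>Moving a pair past another takes four transpositions, hence no sign. The symplectic
  relations therefore get all coefficients 1, as the inclusion matrix requires.\<close>

lemma minor_pair_list_insort:
  "minor v (a @ pair_list (insort j ps) @ b) = minor v (a @ j # - j # pair_list ps @ b)"
proof (induction ps arbitrary: a)
  case (Cons l ps)
  show ?case
  proof (cases "j \<le> l")
    case False
    have "minor v (a @ pair_list (insort j (l # ps)) @ b) =
        minor v ((a @ [l, - l]) @ pair_list (insort j ps) @ b)"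
      using False by (simp add: pair_list_def)
    also have "\<dots> = minor v ((a @ [l, - l]) @ j # - j # pair_list ps @ b)"
      by (rule Cons.IH)
    also have "\<dots> = - minor v ((a @ [l]) @ j # - l # - j # pair_list ps @ b)"
      using minor_swap[of v "a @ [l]" "- l" j] by simp
    also have "\<dots> = minor v ((a @ [l, j]) @ - j # - l # pair_list ps @ b)"
      using minor_swap[of v "a @ [l, j]" "- l" "- j"] by simp
    also have "\<dots> = - minor v (a @ j # l # - j # - l # pair_list ps @ b)"
      using minor_swap[of v a l j] by simp
    also have "\<dots> = minor v ((a @ [j]) @ - j # l # - l # pair_list ps @ b)"
      using minor_swap[of v "a @ [j]" l "- j"] by simp
    also have "\<dots> = minor v (a @ j # - j # pair_list (l # ps) @ b)"
      by (simp add: pair_list_def)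
    finally show ?thesis .
  qed (simp add: pair_list_def)
qed (simp add: pair_list_def)

definition pair_minor :: "int list \<Rightarrow> int set \<Rightarrow> (nat \<Rightarrow> int \<Rightarrow> complex) \<Rightarrow> complex" where
  "pair_minor s P v = minor v (pair_list (sorted_list_of_set P) @ s)"

lemma pair_minor_insert:
  assumes "finite P" "j \<notin> P"
  shows "pair_minor s (insert j P) v = minor v (j # - j # pair_list (sorted_list_of_set P) @ s)"
  using minor_pair_list_insort[of v "[]" j "sorted_list_of_set P" s] assms
  by (simp add: pair_minor_def sorted_list_of_set_insert_remove)

lemma set_pair_list: "set (pair_list ps) = set ps \<union> uminus ` set ps"
  by (induction ps) (auto simp: pair_list_def)

lemma length_pair_list: "length (pair_list ps) = 2 * length ps"
  by (induction ps) (auto simp: pair_list_def)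

lemma distinct_pair_list:
  "distinct ps \<Longrightarrow> (\<And>j. j \<in> set ps \<Longrightarrow> j > 0) \<Longrightarrow> distinct (pair_list ps)"
proof (induction ps)
  case (Cons a ps)
  have "pair_list (a # ps) = a # - a # pair_list ps"
    by (simp add: pair_list_def)
  moreover have "distinct (pair_list ps)"
    using Cons by simp
  moreover have "\<forall>j\<in>set (a # ps). j > 0"
    using Cons.prems(2) by blast
  ultimately show ?case
    using Cons.prems(1) by (auto simp: set_pair_list)
qed (simp add: pair_list_def)

text \<open>A contraction relation in which the summands with \<open>j\<close> in \<open>D\<close>,
  or with \<open>j\<close> or \<open>- j\<close> in \<open>s\<close>, have dropped out because they
  repeat a column.\<close>

lemma pair_relation:
  assumes v: "v \<in> symplectic_frames n" and fin: "finite D" "D \<subseteq> {1..int n}"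
    and len: "2 * Suc (card D) + length s \<le> n"
  shows "(\<Sum>j\<in>{1..int n} - D - abs ` set s. pair_minor s (insert j D) v) = 0"
proof -
  let ?q = "pair_list (sorted_list_of_set D) @ s"
  have "(\<Sum>j\<in>{1..int n} - D - abs ` set s. pair_minor s (insert j D) v) =
      (\<Sum>j\<in>{1..int n} - D - abs ` set s. minor v (j # - j # ?q))"
    using fin by (intro sum.cong refl) (auto simp: pair_minor_insert)
  also have "\<dots> = (\<Sum>j\<in>{1..int n}. minor v (j # - j # ?q))"
  proof (rule sum.mono_neutral_left, simp, blast, rule ballI)
    fix j assume "j \<in> {1..int n} - ({1..int n} - D - abs ` set s)"
    then have "j \<in> D \<or> j \<in> abs ` set s"
      by auto
    then have "j \<in> D \<or> j \<in> set s \<or> - j \<in> set s"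
      by (auto simp: abs_if split: if_splits)
    then have "\<not> distinct (j # - j # ?q)"
      using fin by (auto simp: set_pair_list)
    then show "minor v (j # - j # ?q) = 0"
      by (rule minor_not_distinct)
  qed
  also have "\<dots> = 0"
    using len by (intro symplectic_relation[OF v]) (simp add: length_pair_list)
  finally show ?thesis .
qed

text \<open>The subspace that takes the role of \<open>R\<close> in
  \<open>inclusion_full_rank\<close>: modulo it, light expressions in admissible coordinates count
  as zero.\<close>

definition lower :: "nat \<Rightarrow> nat \<Rightarrow> ((nat \<Rightarrow> int \<Rightarrow> complex) \<Rightarrow> complex) set" where
  "lower n W = {f. \<exists>l\<in>polys (Theta n). (\<forall>m\<in>Poly_Mapping.keys l. wt (tuple_weight n) m < W) \<and>
      (\<forall>v\<in>symplectic_frames n. f v = peval (minor v) l)}"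

lemma lower_0: "0 \<in> lower n W"
  unfolding lower_def by (auto intro!: bexI[of _ 0] polys_closed)

lemma lower_add:
  assumes "f \<in> lower n W" "g \<in> lower n W"
  shows "f + g \<in> lower n W"
proof -
  from assms obtain l l' where
    "l \<in> polys (Theta n)" "\<forall>m\<in>Poly_Mapping.keys l. wt (tuple_weight n) m < W"
    "\<forall>v\<in>symplectic_frames n. f v = peval (minor v) l"
    "l' \<in> polys (Theta n)" "\<forall>m\<in>Poly_Mapping.keys l'. wt (tuple_weight n) m < W"
    "\<forall>v\<in>symplectic_frames n. g v = peval (minor v) l'"
    unfolding lower_def by blast
  then show ?thesis
    using Poly_Mapping.keys_add[of l l'] unfolding lower_def
    by (intro CollectI bexI[of _ "l + l'"]) (auto simp: peval_add polys_closed)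
qed

lemma lower_scale:
  assumes "f \<in> lower n W"
  shows "(\<lambda>v. c * f v) \<in> lower n W"
proof -
  from assms obtain l where
    l: "l \<in> polys (Theta n)" "\<forall>m\<in>Poly_Mapping.keys l. wt (tuple_weight n) m < W"
    "\<forall>v\<in>symplectic_frames n. f v = peval (minor v) l"
    unfolding lower_def by blast
  have "Poly_Mapping.keys (const c * l) \<subseteq> Poly_Mapping.keys l"
    using keys_mult[of "const c" l] by (auto simp: const_def split: if_splits)
  with l show ?thesis
    unfolding lower_def
    by (intro CollectI bexI[of _ "const c * l"]) (auto simp: peval_mult polys_closed)
qed

lemma lower_cong:
  "f \<in> lower n W \<Longrightarrow> (\<And>v. v \<in> symplectic_frames n \<Longrightarrow> g v = f v) \<Longrightarrow> g \<in> lower n W"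
  unfolding lower_def by auto

lemma lower_mono: "W \<le> W' \<Longrightarrow> lower n W \<subseteq> lower n W'"
  unfolding lower_def by fastforce

lemma lower_sum: "(\<And>i. i \<in> I \<Longrightarrow> f i \<in> lower n W) \<Longrightarrow> (\<Sum>i\<in>I. f i) \<in> lower n W"
  by (induction I rule: infinite_finite_induct) (auto simp: lower_0 lower_add)

lemma sum_pow2_less: "(\<Sum>i\<in>{1..int l}. 2 ^ nat i) < (2 :: nat) ^ Suc l"
proof (induction l)
  case (Suc l)
  have "{1..int (Suc l)} = insert (1 + int l) {1..int l}"
    by auto
  then show ?case
    using Suc by (simp add: nat_add_distrib)
qed simp


text \<open>With \<open>A\<close> and the number of pairs fixed, the weight is a constant minus the
  sum of \<open>2 ^ j\<close> over the pairs, so a larger sum means a lighter tuple. The third claim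
  is written additively to avoid truncated subtraction.\<close>

lemma pair_tuple:
  assumes A: "A \<subseteq> index_set n" "\<forall>i\<in>A. - i \<notin> A"
    and P: "P \<subseteq> {1..int n} - abs ` A" and card: "2 * card P + card A \<in> {1..n}"
  defines "T \<equiv> P \<union> uminus ` P \<union> A"
  shows "tuple_of T \<in> tuples n"
    and "\<exists>\<epsilon>\<in>{1, -1}. \<forall>v. pair_minor (sorted_list_of_set A) P v = \<epsilon> * minor v (tuple_of T)"
    and "tuple_weight n (tuple_of T) + (\<Sum>j\<in>P. 2 ^ nat j) =
           card P * 2 ^ Suc n + (\<Sum>i\<in>A. idx_weight n i)"
    and "card T = 2 * card P + card A"
proof -
  have fin: "finite P" "finite A"
    using A(1) P finite_subset finite_index_set by blast+
  have T: "T \<subseteq> index_set n"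
    using A(1) P by (auto simp: T_def index_set_def)
  have pos: "j > 0" "j \<notin> A" "- j \<notin> A" if "j \<in> P" for j
  proof -
    have "j > 0" "j \<notin> abs ` A"
      using that P by auto
    then show "j > 0" "j \<notin> A" "- j \<notin> A"
      using imageI[of j A abs] imageI[of "- j" A abs] by auto
  qed
  have disj: "P \<inter> uminus ` P = {}" "(P \<union> uminus ` P) \<inter> A = {}"
  proof -
    have "j < 0" if "j \<in> uminus ` P" for j
      using that pos(1) by auto
    then show "P \<inter> uminus ` P = {}"
      using pos(1) by fastforce
    show "(P \<union> uminus ` P) \<inter> A = {}"
      using pos(2,3) by auto
  qed
  have inj: "inj_on uminus P"
    by auto
  show cT: "card T = 2 * card P + card A"
    using fin disj by (simp add: T_def card_Un_disjoint card_image[OF inj])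
  with card show "tuple_of T \<in> tuples n"
    by (intro tuple_of_tuples T) auto
  have "set (pair_list (sorted_list_of_set P) @ sorted_list_of_set A) = set (tuple_of T)"
    using fin by (simp add: tuple_of[OF T] set_pair_list) (simp add: T_def)
  moreover have "distinct (pair_list (sorted_list_of_set P))"
    using fin P by (intro distinct_pair_list) auto
  then have "distinct (pair_list (sorted_list_of_set P) @ sorted_list_of_set A)"
    using fin disj by (auto simp: set_pair_list)
  ultimately have "mset (pair_list (sorted_list_of_set P) @ sorted_list_of_set A) = mset (tuple_of T)"
    using tuple_of(2)[OF T] set_eq_iff_mset_eq_distinct by blast
  then show "\<exists>\<epsilon>\<in>{1, -1}. \<forall>v. pair_minor (sorted_list_of_set A) P v = \<epsilon> * minor v (tuple_of T)"
    unfolding pair_minor_def by (rule minor_mset_eq)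
  have "tuple_weight n (tuple_of T) = (\<Sum>i\<in>T. idx_weight n i)"
    by (simp add: tuple_weight_set tuple_of[OF T])
  also have "\<dots> = (\<Sum>i\<in>P. idx_weight n i) + (\<Sum>i\<in>P. idx_weight n (- i)) + (\<Sum>i\<in>A. idx_weight n i)"
    unfolding T_def using fin disj by (subst sum.union_disjoint; (simp add: sum.union_disjoint sum.reindex)?)
  also have "(\<Sum>i\<in>P. idx_weight n (- i)) = 0"
    using P by (intro sum.neutral) (auto simp: idx_weight_def)
  also have "(\<Sum>i\<in>P. idx_weight n i) + 0 + (\<Sum>i\<in>A. idx_weight n i) + (\<Sum>j\<in>P. 2 ^ nat j) =
      (\<Sum>i\<in>P. idx_weight n i + 2 ^ nat i) + (\<Sum>i\<in>A. idx_weight n i)"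
    by (simp add: sum.distrib)
  also have "(\<Sum>i\<in>P. idx_weight n i + 2 ^ nat i) = (\<Sum>i\<in>P. 2 ^ Suc n)"
  proof (rule sum.cong[OF refl])
    fix i assume "i \<in> P"
    then have "i \<in> {1..int n}"
      using P by blast
    then have "i > 0" "nat i \<le> Suc n"
      by auto
    then show "idx_weight n i + 2 ^ nat i = 2 ^ Suc n"
      using power_increasing[of "nat i" "Suc n" "2::nat"] by (simp add: idx_weight_def)
  qed
  finally show "tuple_weight n (tuple_of T) + (\<Sum>j\<in>P. 2 ^ nat j) =
           card P * 2 ^ Suc n + (\<Sum>i\<in>A. idx_weight n i)"
    by simp
qed

text \<open>Let admissibility fail at \<open>l\<close>, and split the pairs of \<open>t\<close> into
  \<open>B\<close> inside 1..l and \<open>C\<close> beyond. For \<open>D\<close> one element smaller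
  than \<open>B\<close> inside the available positions \<open>L\<close>, the relation for
  \<open>D\<close> and \<open>C\<close> says that the sum over the completions of \<open>D\<close>
  inside \<open>L\<close> is minus a sum over completions beyond \<open>l\<close>. The latter are
  lighter than \<open>t\<close>, hence in \<open>lower\<close> by induction, and failure of
  admissibility is the size condition under which \<open>inclusion_full_rank\<close> recovers the
  term of \<open>B\<close>.\<close>

lemma not_admissible_lower:
  assumes "t \<in> tuples n" "t \<notin> Theta n"
  shows "(\<lambda>v. minor v t) \<in> lower n (tuple_weight n t)"
  using assms
proof (induction "tuple_weight n t" arbitrary: t rule: less_induct)
  case less
  define W where "W = tuple_weight n t"
  \<comment> \<open>A lighter admissible coordinate qualifies as a variable by itself; the others
    are covered by the induction hypothesis.\<close>
  have IH: "(\<lambda>v. minor v t') \<in> lower n W" if "t' \<in> tuples n" "tuple_weight n t' < W" for t'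
  proof (cases "t' \<in> Theta n")
    case True
    moreover have "\<forall>m\<in>Poly_Mapping.keys (var t'). wt (tuple_weight n) m < W"
      using that(2) by (simp add: var_def wt_single)
    ultimately show ?thesis
      unfolding lower_def by (intro CollectI bexI[of _ "var t'"] var_polys) auto
  next
    case False
    then show ?thesis
      using less.hyps that lower_mono[of "tuple_weight n t'" W n] by (auto simp: W_def)
  qed
  define T where "T = set t"
  define A where "A = {i \<in> T. - i \<notin> T}"
  define P where "P = {i \<in> T. i > 0 \<and> - i \<in> T}"
  define s where "s = sorted_list_of_set A"
  have TN: "T \<subseteq> index_set n" and lt: "length t \<in> {1..n}" and dist: "distinct t"
    using less.prems(1) tuples_distinct by (auto simp: T_def tuples_def)
  have finT: "finite T"
    by (simp add: T_def)
  have T: "T = P \<union> uminus ` P \<union> A"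
  proof
    show "T \<subseteq> P \<union> uminus ` P \<union> A"
    proof
      fix i assume i: "i \<in> T"
      then have "i \<noteq> 0"
        using TN by (auto simp: index_set_def)
      then show "i \<in> P \<union> uminus ` P \<union> A"
        using i image_eqI[of i uminus "- i" P] by (cases "i > 0") (auto simp: P_def A_def)
    qed
  qed (auto simp: P_def A_def)
  have A: "A \<subseteq> index_set n" "\<forall>i\<in>A. - i \<notin> A"
    using TN by (auto simp: A_def)
  have PA: "P \<subseteq> {1..int n} - abs ` A"
    using TN by (auto simp: P_def A_def index_set_def abs_if split: if_splits)
  have fin: "finite A" "finite P"
    using finT by (auto simp: A_def P_def)
  have absinj: "inj_on abs A"
    using A(2) by (auto simp: inj_on_def abs_if split: if_splits)
  have cT: "2 * card P + card A = length t"
  proof -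
    have "P \<inter> uminus ` P = {}" "(P \<union> uminus ` P) \<inter> A = {}"
      by (auto simp: P_def A_def)
    then have "card T = 2 * card P + card A"
      using fin card_image[of uminus P] by (simp add: T card_Un_disjoint)
    then show ?thesis
      using distinct_card[OF dist] by (simp add: T_def)
  qed
  note pt = pair_tuple[OF A, folded s_def]
  have Tt: "mset (tuple_of T) = mset t"
    using tuple_of[OF TN] dist by (intro set_eq_iff_mset_eq_distinct[THEN iffD1]) (auto simp: T_def)
  have Wt: "tuple_weight n (tuple_of T) = W"
    unfolding W_def tuple_weight_def by (metis Tt mset_map sum_mset_sum_list)
  have Weq: "W + (\<Sum>j\<in>P. 2 ^ nat j) = card P * 2 ^ Suc n + (\<Sum>i\<in>A. idx_weight n i)"
    using pt(3)[OF PA] cT lt T Wt by simp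
  have lowP: "pair_minor s P' \<in> lower n W"
    if "P' \<subseteq> {1..int n} - abs ` A" "card P' = card P" "(\<Sum>j\<in>P. 2 ^ nat j) < (\<Sum>j\<in>P'. (2::nat) ^ nat j)" for P'
  proof -
    let ?T = "P' \<union> uminus ` P' \<union> A"
    have c: "2 * card P' + card A \<in> {1..n}"
      using that(2) cT lt by simp
    have "tuple_weight n (tuple_of ?T) < W"
      using pt(3)[OF that(1) c] Weq that(2,3) by simp
    then have "(\<lambda>v. minor v (tuple_of ?T)) \<in> lower n W"
      by (intro IH pt(1)[OF that(1) c])
    moreover note pt(2)[OF that(1) c]
    then obtain \<epsilon> where "\<And>v. pair_minor s P' v = \<epsilon> * minor v (tuple_of ?T)"
      by blast
    ultimately show ?thesis
      using lower_scale[of "\<lambda>v. minor v (tuple_of ?T)" n W \<epsilon>] by (auto elim: lower_cong)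
  qed
  obtain l where l: "l \<in> {1..n}" "length (filter (\<lambda>i. \<bar>i\<bar> \<le> int l) t) > l"
    using less.prems by (auto simp: Theta_def admissible_def not_le)
  define L where "L = {1..int l} - abs ` A"
  define B where "B = P \<inter> {1..int l}"
  define C where "C = P - {1..int l}"
  have finL: "finite L"
    by (simp add: L_def)
  have BL: "B \<subseteq> L"
    using PA by (auto simp: B_def L_def)
  have PBC: "P = B \<union> C" "B \<inter> C = {}"
    by (auto simp: B_def C_def)
  have finBC: "finite B" "finite C"
    using fin by (auto simp: B_def C_def)
  \<comment> \<open>Let \<open>A'\<close> be the unpaired entries of absolute value at most
    \<open>l\<close>. Failure at \<open>l\<close> gives \<open>l < 2 * card B + card A'\<close>,
    while \<open>L\<close> has \<open>l - card A'\<close> elements, fewer than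
    \<open>2 * card B\<close>.\<close>
  have small: "card (L - B) < card B"
  proof -
    define A' where "A' = {i \<in> A. \<bar>i\<bar> \<le> int l}"
    have finA': "finite A'"
      using fin by (simp add: A'_def)
    have "l < card (set (filter (\<lambda>i. \<bar>i\<bar> \<le> int l) t))"
      using l(2) distinct_card[OF distinct_filter[OF dist]] by simp
    also have "set (filter (\<lambda>i. \<bar>i\<bar> \<le> int l) t) \<subseteq> B \<union> uminus ` B \<union> A'"
    proof
      fix i assume "i \<in> set (filter (\<lambda>i. \<bar>i\<bar> \<le> int l) t)"
      then have i: "i \<in> T" "\<bar>i\<bar> \<le> int l"
        by (auto simp: T_def)
      then have "i \<in> P \<or> - i \<in> P \<or> i \<in> A"
        using T by auto
      then show "i \<in> B \<union> uminus ` B \<union> A'"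
        using i(2) image_eqI[of i uminus "- i" B] by (auto simp: B_def A'_def P_def)
    qed
    then have "card (set (filter (\<lambda>i. \<bar>i\<bar> \<le> int l) t)) \<le> card (B \<union> uminus ` B \<union> A')"
      using finBC finA' by (intro card_mono) auto
    also have "\<dots> \<le> card (B \<union> uminus ` B) + card A'"
      by (rule card_Un_le)
    also have "card (B \<union> uminus ` B) \<le> card B + card (uminus ` B)"
      by (rule card_Un_le)
    also have "card (uminus ` B) = card B"
      by (rule card_image) auto
    finally have 1: "l < 2 * card B + card A'"
      by simp
    have "abs ` A' \<subseteq> {1..int l}"
      using A(1) by (auto simp: A'_def index_set_def)
    moreover have cA': "card (abs ` A') = card A'"
      by (intro card_image inj_on_subset[OF absinj]) (auto simp: A'_def)
    ultimately have "card ({1..int l} - abs ` A') = l - card A'"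
      using finA' by (subst card_Diff_subset) auto
    moreover have "card A' \<le> l"
      using card_mono[OF _ \<open>abs ` A' \<subseteq> {1..int l}\<close>] cA' by auto
    moreover have "L = {1..int l} - abs ` A'"
      by (auto simp: L_def A'_def)
    ultimately have "card L = l - card A'" "card A' \<le> l"
      by auto
    then show ?thesis
      using 1 BL finBC by (simp add: card_Diff_subset)
  qed
  have "pair_minor s (B \<union> C) \<in> lower n W"
  proof (rule inclusion_full_rank[where y = "\<lambda>B. pair_minor s (B \<union> C)" and R = "lower n W" and L = L])
    fix D assume D: "D \<subseteq> L" "Suc (card D) = card B"
    have finD: "finite D"
      using D(1) finL finite_subset by blast
    have DC: "D \<inter> C = {}"
      using D(1) by (auto simp: L_def C_def)
    define H where "H = {int l + 1..int n} - C - abs ` A"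
    have cDC: "Suc (card (D \<union> C)) = card P"
      using D(2) PBC finD finBC DC by (simp add: card_Un_disjoint)
    have DCn: "D \<union> C \<subseteq> {1..int n} - abs ` A"
      using D(1) PA l(1) by (auto simp: L_def C_def)
    have low: "pair_minor s (insert j (D \<union> C)) \<in> lower n W" if j: "j \<in> H" for j
    proof (rule lowP)
      have jDC: "j \<notin> D \<union> C"
        using j D(1) by (auto simp: H_def L_def)
      show "insert j (D \<union> C) \<subseteq> {1..int n} - abs ` A"
        using j DCn by (auto simp: H_def)
      show "card (insert j (D \<union> C)) = card P"
        using jDC cDC finD finBC by simp
      \<comment> \<open>The single power at \<open>j > l\<close> exceeds the sum over all of
        \<open>B\<close>, whatever \<open>D\<close> contributes.\<close>
      have "(\<Sum>j\<in>P. 2 ^ nat j) = (\<Sum>j\<in>B. (2::nat) ^ nat j) + (\<Sum>j\<in>C. 2 ^ nat j)"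
        using PBC finBC by (simp add: sum.union_disjoint)
      also have "(\<Sum>j\<in>B. (2::nat) ^ nat j) \<le> (\<Sum>j\<in>{1..int l}. 2 ^ nat j)"
        by (intro sum_mono2) (auto simp: B_def)
      also have "\<dots> < 2 ^ Suc l"
        by (rule sum_pow2_less)
      also have "\<dots> \<le> 2 ^ nat j"
        using j by (intro power_increasing) (auto simp: H_def)
      also have "2 ^ nat j + (\<Sum>j\<in>C. 2 ^ nat j) \<le> (\<Sum>j\<in>insert j (D \<union> C). (2::nat) ^ nat j)"
        using jDC finD finBC DC by (simp add: sum.union_disjoint)
      finally show "(\<Sum>j\<in>P. 2 ^ nat j) < (\<Sum>j\<in>insert j (D \<union> C). (2::nat) ^ nat j)"
        by simp
    qed
    have "(\<Sum>j\<in>L - D. pair_minor s (insert j D \<union> C) v) = - (\<Sum>j\<in>H. pair_minor s (insert j (D \<union> C)) v)"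
      if v: "v \<in> symplectic_frames n" for v
    proof -
      have "(\<Sum>j\<in>{1..int n} - (D \<union> C) - abs ` set s. pair_minor s (insert j (D \<union> C)) v) = 0"
        using v finD finBC DCn cDC cT lt fin
        by (intro pair_relation) (auto simp: s_def simp del: mult_Suc_right)
      also have "{1..int n} - (D \<union> C) - abs ` set s = (L - D) \<union> H"
        using l(1) D(1) fin unfolding H_def L_def s_def C_def by auto
      also have "(\<Sum>j\<in>(L - D) \<union> H. pair_minor s (insert j (D \<union> C)) v) =
         (\<Sum>j\<in>L - D. pair_minor s (insert j (D \<union> C)) v) + (\<Sum>j\<in>H. pair_minor s (insert j (D \<union> C)) v)"
        using finL by (intro sum.union_disjoint) (auto simp: H_def L_def)
      finally show ?thesis
        by (simp add: eq_neg_iff_add_eq_0)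
    qed
    moreover have "(\<Sum>j\<in>H. pair_minor s (insert j (D \<union> C))) \<in> lower n W"
      by (rule lower_sum) (rule low)
    then have "(\<lambda>v. - 1 * (\<Sum>j\<in>H. pair_minor s (insert j (D \<union> C))) v) \<in> lower n W"
      by (rule lower_scale)
    moreover have "(\<Sum>i\<in>I. f i) v = (\<Sum>i\<in>I. f i v)" for I :: "int set" and f :: "_ \<Rightarrow> (nat \<Rightarrow> int \<Rightarrow> complex) \<Rightarrow> complex" and v
      by (induction I rule: infinite_finite_induct) auto
    ultimately show "(\<Sum>j\<in>L - D. pair_minor s (insert j D \<union> C)) \<in> lower n W"
      by (elim lower_cong) simp
  qed (use lower_0 lower_add lower_scale finL BL small in auto)
  then have "pair_minor s P \<in> lower n W"
    using PBC by simp
  moreover obtain \<epsilon> where \<epsilon>: "\<epsilon> \<in> {1, -1}" "\<And>v. pair_minor s P v = \<epsilon> * minor v (tuple_of T)"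
    using pt(2)[OF PA] cT lt T by (metis (no_types))
  moreover obtain \<delta> where \<delta>: "\<And>v. minor v t = \<delta> * minor v (tuple_of T)"
    using minor_mset_eq[OF Tt[symmetric]] by blast
  ultimately have "(\<lambda>v. \<delta> * \<epsilon> * pair_minor s P v) \<in> lower n W"
    by (intro lower_scale)
  then show ?case
    unfolding W_def[symmetric] by (rule lower_cong) (use \<epsilon> \<delta> in auto)
qed

section \<open>The weight order and lifting from type A\<close>

text \<open>Monomials of equal weight are incomparable, so the initial form is the entire component
  of top weight and the initial ideal need not be monomial.\<close>

definition weight_less :: "nat \<Rightarrow> int list monomial \<Rightarrow> int list monomial \<Rightarrow> bool" where
  "weight_less n m m' \<longleftrightarrow> wt (tuple_weight n) m < wt (tuple_weight n) m'"

lemma monomial_order_weight: "monomial_order A (weight_less n)"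
  unfolding monomial_order_def weight_less_def
  by (auto simp: irreflp_on_def transp_on_def wt_add wt_single equiv_def refl_on_def sym_def trans_def)

lemma initial_form_weight:
  assumes "a \<noteq> 0" "\<And>m. m \<in> Poly_Mapping.keys a \<Longrightarrow> wt (tuple_weight n) m = W"
    and b: "\<And>m. m \<in> Poly_Mapping.keys b \<Longrightarrow> wt (tuple_weight n) m < W"
  shows "initial_form (weight_less n) (a + b) = a"
proof -
  have disj: "m \<notin> Poly_Mapping.keys b" if "m \<in> Poly_Mapping.keys a" for m
    using assms(2)[OF that] b[of m] by auto
  have disj': "m \<notin> Poly_Mapping.keys a" if "m \<in> Poly_Mapping.keys b" for m
    using disj that by blast
  have keys: "Poly_Mapping.keys (a + b) = Poly_Mapping.keys a \<union> Poly_Mapping.keys b"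
    using disj disj' Poly_Mapping.keys_add[of a b] by (auto simp: in_keys_iff lookup_add)
  obtain m0 where m0: "m0 \<in> Poly_Mapping.keys a"
    using assms(1) by (metis keys_eq_empty ex_in_conv)
  have max: "(\<exists>m'\<in>Poly_Mapping.keys (a + b). weight_less n m m') \<longleftrightarrow> m \<notin> Poly_Mapping.keys a"
    if "m \<in> Poly_Mapping.keys (a + b)" for m
    using that m0 assms(2) b disj unfolding keys weight_less_def
    by (auto dest: order_less_asym)
  show ?thesis
  proof (rule poly_mapping_eqI)
    fix m
    show "Poly_Mapping.lookup (initial_form (weight_less n) (a + b)) m = Poly_Mapping.lookup a m"
    proof (cases "m \<in> Poly_Mapping.keys (a + b)")
      case True
      then show ?thesis
        using max[OF True] disj
        by (auto simp: initial_form_eq_restrict lookup_restrict_poly lookup_add in_keys_iff)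
    next
      case False
      then show ?thesis
        using keys by (auto simp: initial_form_eq_restrict lookup_restrict_poly in_keys_iff)
    qed
  qed
qed

lemma minor_scale_columns:
  "minor (\<lambda>a i. t ^ idx_weight n i * v a i) = (\<lambda>is. t ^ tuple_weight n is * minor v is)"
proof
  fix "is" :: "int list"
  have "(\<Prod>i=0..<length is. t ^ idx_weight n (is ! i)) = t ^ tuple_weight n is"
    by (simp add: tuple_weight_def sum_list_sum_nth power_sum)
  then show "minor (\<lambda>a i. t ^ idx_weight n i * v a i) is = t ^ tuple_weight n is * minor v is"
    by (simp add: minor_Leibniz prod.distrib sum_distrib_left algebra_simps)
qed

lemma scale_columns_frames:
  assumes "v \<in> frames n" "t \<noteq> 0"
  shows "(\<lambda>a i. t ^ idx_weight n i * v a i) \<in> frames n"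
proof -
  have "lin_indep n (\<lambda>a i. t ^ idx_weight n i * v a i)"
    unfolding lin_indep_def
  proof (intro allI impI)
    fix c a assume c: "\<forall>i. (\<Sum>a<n. c a * (t ^ idx_weight n i * v a i)) = 0" and "a < n"
    have "t ^ idx_weight n i * (\<Sum>a<n. c a * v a i) = 0" for i
      using c by (simp add: sum_distrib_left algebra_simps)
    then show "c a = 0"
      using assms \<open>a < n\<close> by (intro lin_indepD[of n v c]) (auto simp: frames_def)
  qed
  then show ?thesis
    using assms by (auto simp: frames_def CN_def)
qed

text \<open>Arbitrary frames are stable under scaling of columns, so the type A ideal is homogeneous
  for the weight. This fails for symplectic frames, whence the degeneration.\<close>

lemma typeA_component:
  assumes "p \<in> typeA_plucker_ideal n"
  shows "restrict_poly (\<lambda>m. wt (tuple_weight n) m = d) p \<in> typeA_plucker_ideal n"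
proof -
  have p: "p \<in> polys (tuples n)" "\<And>v. v \<in> frames n \<Longrightarrow> peval (minor v) p = 0"
    using assms by (auto simp: typeA_plucker_ideal_eq vanishing_def)
  have "peval (minor v) (restrict_poly (\<lambda>m. wt (tuple_weight n) m = d) p) = 0" if "v \<in> frames n" for v
  proof (rule component_vanishes)
    fix t :: complex assume "t \<noteq> 0"
    from p(2)[OF scale_columns_frames[OF that this]]
    show "peval (\<lambda>a. t ^ tuple_weight n a * minor v a) p = 0"
      by (simp add: minor_scale_columns)
  qed
  then show ?thesis
    using p(1) by (auto simp: typeA_plucker_ideal_eq vanishing_def restrict_poly_polys)
qed

section \<open>Weight bounds under substitution\<close>

definition wt_le :: "('x \<Rightarrow> nat) \<Rightarrow> nat \<Rightarrow> 'x mpoly set" where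
  "wt_le w W = {p. \<forall>m\<in>Poly_Mapping.keys p. wt w m \<le> W}"

definition wt_lt :: "('x \<Rightarrow> nat) \<Rightarrow> nat \<Rightarrow> 'x mpoly set" where
  "wt_lt w W = {p. \<forall>m\<in>Poly_Mapping.keys p. wt w m < W}"

lemma wt_le_mult: "p \<in> wt_le w W \<Longrightarrow> q \<in> wt_le w W' \<Longrightarrow> p * q \<in> wt_le w (W + W')"
  using keys_mult[of p q] by (fastforce simp: wt_le_def wt_add intro: add_mono)

lemma wt_lt_mult: "p \<in> wt_lt w W \<Longrightarrow> q \<in> wt_le w W' \<Longrightarrow> p * q \<in> wt_lt w (W + W')"
  using keys_mult[of p q] by (fastforce simp: wt_le_def wt_lt_def wt_add intro: add_less_le_mono)

lemma wt_lt_add: "p \<in> wt_lt w W \<Longrightarrow> q \<in> wt_lt w W \<Longrightarrow> p + q \<in> wt_lt w W"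
  using Poly_Mapping.keys_add[of p q] by (auto simp: wt_lt_def)

lemma wt_lt_sum: "(\<And>i. i \<in> I \<Longrightarrow> p i \<in> wt_lt w W) \<Longrightarrow> (\<Sum>i\<in>I. p i) \<in> wt_lt w W"
proof (induction I rule: infinite_finite_induct)
  case (insert i I)
  then show ?case
    by (simp add: wt_lt_add)
qed (auto simp: wt_lt_def)

lemma wt_lt_le: "p \<in> wt_lt w W \<Longrightarrow> p \<in> wt_le w W"
  by (auto simp: wt_lt_def wt_le_def)

lemma wt_le_1: "1 \<in> wt_le w 0"
  by (auto simp: wt_le_def)

lemma wt_le_power: "p \<in> wt_le w W \<Longrightarrow> p ^ k \<in> wt_le w (k * W)"
  by (induction k) (auto simp: wt_le_1 wt_le_mult)

lemma wt_le_prod: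
  "(\<And>i. i \<in> I \<Longrightarrow> p i \<in> wt_le w (W i)) \<Longrightarrow> (\<Prod>i\<in>I. p i) \<in> wt_le w (\<Sum>i\<in>I. W i)"
  by (induction I rule: infinite_finite_induct) (auto simp: wt_le_1 wt_le_mult)

lemma wt_le_mon_eval:
  assumes "\<And>a. a \<in> Poly_Mapping.keys m \<Longrightarrow> g a \<in> wt_le w (w a)"
  shows "mon_eval g m \<in> wt_le w (wt w m)"
  unfolding mon_eval_def wt_def using assms by (intro wt_le_prod wt_le_power)

lemma monomial_split:
  fixes m :: "'x monomial"
  assumes "a \<in> Poly_Mapping.keys m"
  shows "\<exists>m'. m = Poly_Mapping.single a 1 + m' \<and> Poly_Mapping.keys m' \<subseteq> Poly_Mapping.keys m"
proof (intro exI conjI)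
  show "m = Poly_Mapping.single a 1 + (m - Poly_Mapping.single a 1)"
    using assms by (intro poly_mapping_eqI) (auto simp: lookup_add lookup_minus lookup_single when_def in_keys_iff)
  show "Poly_Mapping.keys (m - Poly_Mapping.single a 1) \<subseteq> Poly_Mapping.keys m"
    by (auto simp: in_keys_iff lookup_minus)
qed

lemma wt_lt_mon_eval:
  assumes "\<And>a. a \<in> Poly_Mapping.keys m \<Longrightarrow> g a \<in> wt_le w (w a)"
    and "a \<in> Poly_Mapping.keys m" "g a \<in> wt_lt w (w a)"
  shows "mon_eval g m \<in> wt_lt w (wt w m)"
proof -
  obtain m' where m': "m = Poly_Mapping.single a 1 + m'" "Poly_Mapping.keys m' \<subseteq> Poly_Mapping.keys m"
    using monomial_split[OF assms(2)] by blast
  have "g a * mon_eval g m' \<in> wt_lt w (w a + wt w m')"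
    using assms m'(2) by (intro wt_lt_mult wt_le_mon_eval) auto
  then show ?thesis
    using m'(1) by (simp add: mon_eval_add mon_eval_single wt_add wt_single)
qed

interpretation P: vector_space poly_scale
  by (rule vector_space_poly_scale)

lemma proj_subset_initial:
  assumes p: "p \<in> typeA_plucker_ideal n"
  shows "proj_Theta n p \<in> initial_ideal (weight_less n) (symplectic_plucker_ideal n)"
proof -
  let ?w = "tuple_weight n"
  have "\<exists>l\<in>polys (Theta n). l \<in> wt_lt ?w (?w t) \<and> (\<forall>v\<in>symplectic_frames n. minor v t = peval (minor v) l)"
    if "t \<in> tuples n - Theta n" for t
    using not_admissible_lower[of t n] that by (auto simp: lower_def wt_lt_def)
  then obtain l where l: "\<And>t. t \<in> tuples n - Theta n \<Longrightarrow> l t \<in> polys (Theta n)"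
    "\<And>t. t \<in> tuples n - Theta n \<Longrightarrow> l t \<in> wt_lt ?w (?w t)"
    "\<And>t v. t \<in> tuples n - Theta n \<Longrightarrow> v \<in> symplectic_frames n \<Longrightarrow> minor v t = peval (minor v) (l t)"
    by metis
  define g where "g = (\<lambda>t. if t \<in> Theta n then var t else l t)"
  have g1: "g t \<in> polys (Theta n)" if "t \<in> tuples n" for t
    using that l(1) by (auto simp: g_def var_polys)
  have g2: "g t \<in> wt_le ?w (?w t)" if "t \<in> tuples n" for t
    using that l(2)[of t] wt_lt_le[of "l t"] by (auto simp: g_def) (auto simp: wt_le_def var_def wt_single)
  have comp: "proj_Theta n q \<in> initial_ideal (weight_less n) (symplectic_plucker_ideal n)"
    if q: "q \<in> typeA_plucker_ideal n" "\<And>m. m \<in> Poly_Mapping.keys q \<Longrightarrow> wt ?w m = d" for q d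
  \<comment> \<open>If the projection is zero, it cannot be the initial form of a nonzero
    \<open>r\<close>, but it lies in the span anyway.\<close>
  proof (cases "proj_Theta n q = 0")
    case True
    then show ?thesis
      unfolding initial_ideal_def using P.span_zero by simp
  next
    case False
    have qA: "q \<in> polys (tuples n)" "\<And>v. v \<in> frames n \<Longrightarrow> peval (minor v) q = 0"
      using q by (auto simp: typeA_plucker_ideal_eq vanishing_def)
    have keysA: "Poly_Mapping.keys m \<subseteq> tuples n" if "m \<in> Poly_Mapping.keys q" for m
      using that qA(1) by (auto simp: polys_def monomials_def)
    define r where "r = poly_hom const g q"
    let ?B = "{m \<in> Poly_Mapping.keys q. \<not> Poly_Mapping.keys m \<subseteq> Theta n}"
    \<comment> \<open>The monomials with a non-admissible variable: substitution strictly lowers at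
      least one factor and raises none, so all of \<open>b\<close> lies below weight
      \<open>d\<close>.\<close>
    define b where "b = (\<Sum>m\<in>?B. const (Poly_Mapping.lookup q m) * mon_eval g m)"
    have const_le: "const c \<in> wt_le ?w 0" for c
      by (auto simp: const_def wt_le_def)
    have "b \<in> wt_lt ?w d"
      unfolding b_def
    proof (rule wt_lt_sum)
      fix m assume m: "m \<in> ?B"
      then obtain a where a: "a \<in> Poly_Mapping.keys m" "a \<notin> Theta n"
        by blast
      have "mon_eval g m \<in> wt_lt ?w (wt ?w m)"
        using m a keysA[of m] l(2)[of a] by (intro wt_lt_mon_eval[of m g ?w a] g2) (auto simp: g_def)
      from wt_lt_mult[OF this const_le] show "const (Poly_Mapping.lookup q m) * mon_eval g m \<in> wt_lt ?w d"
        using q(2) m by (simp add: mult.commute[of "mon_eval g m"])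
    qed
    have "r = (\<Sum>m\<in>{m \<in> Poly_Mapping.keys q. Poly_Mapping.keys m \<subseteq> Theta n}.
        const (Poly_Mapping.lookup q m) * mon_eval g m) + b"
      unfolding r_def poly_hom_alt b_def
      by (subst sum.union_disjoint[symmetric]) (auto intro!: sum.cong)
    also have "(\<Sum>m\<in>{m \<in> Poly_Mapping.keys q. Poly_Mapping.keys m \<subseteq> Theta n}.
        const (Poly_Mapping.lookup q m) * mon_eval g m) = proj_Theta n q"
      unfolding proj_Theta_eq_restrict restrict_poly_def
    proof (rule sum.cong[OF refl])
      fix m assume "m \<in> {m \<in> Poly_Mapping.keys q. Poly_Mapping.keys m \<subseteq> Theta n}"
      then have "mon_eval g m = mon_eval var m"
        by (intro mon_eval_cong) (auto simp: g_def)
      then show "const (Poly_Mapping.lookup q m) * mon_eval g m = Poly_Mapping.single m (Poly_Mapping.lookup q m)"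
        by (simp add: single_conv_var)
    qed
    finally have r: "r = proj_Theta n q + b" .
    have "initial_form (weight_less n) r = proj_Theta n q"
      unfolding r using False q(2) \<open>b \<in> wt_lt ?w d\<close>
      by (intro initial_form_weight) (auto simp: wt_lt_def proj_Theta_eq_restrict keys_restrict_poly)
    moreover have "r \<in> symplectic_plucker_ideal n"
    proof -
      have "r \<in> polys (Theta n)"
        unfolding r_def poly_hom_alt mon_eval_def
        using keysA g1 by (intro polys_sum polys_closed(4) const_polys polys_prod polys_power) auto
      moreover have "peval (minor v) r = 0" if v: "v \<in> symplectic_frames n" for v
      proof -
        have "peval (minor v) r = peval (\<lambda>a. peval (minor v) (g a)) q"
          by (simp add: r_def peval_poly_hom)
        also have "\<dots> = peval (minor v) q"
          by (rule peval_cong[OF qA(1)]) (use l(3)[OF _ v] in \<open>auto simp: g_def\<close>)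
        also have "\<dots> = 0"
          using qA(2) v by (simp add: symplectic_frames_def)
        finally show ?thesis .
      qed
      ultimately show ?thesis
        by (simp add: symplectic_plucker_ideal_eq vanishing_def)
    qed
    ultimately show ?thesis
      unfolding initial_ideal_def using P.span_base by (metis imageI)
  qed
  \<comment> \<open>Each weight component is handled separately; the linear span in
    \<open>initial_ideal\<close> allows their projections to be added.\<close>
  have "p = (\<Sum>d\<in>wt ?w ` Poly_Mapping.keys p. restrict_poly (\<lambda>m. wt ?w m = d) p)"
    by (rule sum_components) auto
  then have "proj_Theta n p =
      (\<Sum>d\<in>wt ?w ` Poly_Mapping.keys p. proj_Theta n (restrict_poly (\<lambda>m. wt ?w m = d) p))"
    unfolding proj_Theta_eq_restrict by (metis restrict_poly_sum)
  also have "\<dots> \<in> initial_ideal (weight_less n) (symplectic_plucker_ideal n)"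
    using comp[OF typeA_component[OF p]] unfolding initial_ideal_def
    by (intro P.span_sum) (auto simp: keys_restrict_poly)
  finally show ?thesis .
qed

section \<open>Degenerating the Schubert variety of echelon frames to symplectic flags\<close>

text \<open>The nonvanishing of the entry at \<open>int a + 1\<close>, the first index allowed in
  row \<open>a\<close>, selects an open part of the Schubert variety. It is the denominator when
  isotropy is solved for, and it makes the rows independent.\<close>

definition echelon_frames :: "nat \<Rightarrow> (nat \<Rightarrow> int \<Rightarrow> complex) set" where
  "echelon_frames n = {z. \<forall>a<n. z a \<in> CN n \<and> (\<forall>i. \<bar>i\<bar> \<le> int a \<longrightarrow> z a i = 0) \<and> z a (int a + 1) \<noteq> 0}"

lemma lin_indep_triangular:
  assumes "\<And>a. a < n \<Longrightarrow> v a (int a + 1) \<noteq> 0" "\<And>a b. b < a \<Longrightarrow> a < n \<Longrightarrow> v a (int b + 1) = 0"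
  shows "lin_indep n v"
  unfolding lin_indep_def
proof (intro allI impI)
  fix c b assume c: "\<forall>i. (\<Sum>a<n. c a * v a i) = 0" and "b < n"
  show "c b = 0"
    using \<open>b < n\<close>
  proof (induction b rule: less_induct)
    case (less b)
    have "0 = (\<Sum>a<n. c a * v a (int b + 1))"
      using c by simp
    also have "\<dots> = (\<Sum>a\<in>{b}. c a * v a (int b + 1))"
      using less assms(2) by (intro sum.mono_neutral_right) (auto simp: nat_neq_iff)
    finally show ?case
      using assms(1)[OF less.prems] by simp
  qed
qed

text \<open>Solving the isotropy conditions for the entries at \<open>-1, \<dots>, -a\<close> of the row \<open>a\<close>, for the symplectic
  form rescaled by \<open>t\<close>; the entry at \<open>-s\<close> is read off from the pairing with the row \<open>s - 1\<close>.\<close>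

function isotropic_entry :: "nat \<Rightarrow> complex \<Rightarrow> (nat \<Rightarrow> int \<Rightarrow> complex) \<Rightarrow> nat \<Rightarrow> nat \<Rightarrow> complex" where
  "isotropic_entry n t z a s =
     (if s \<le> a
      then - (\<Sum>j\<in>{s<..n}. t ^ (2 ^ j - 2 ^ s) *
                (z (s - 1) (int j) * isotropic_entry n t z a j - z (s - 1) (- int j) * z a (int j))) /
             z (s - 1) (int s)
      else z a (- int s))"
  by auto
termination
  by (relation "measure (\<lambda>(n, t, z, a, s). n - s)") auto

declare isotropic_entry.simps [simp del]

definition isotropic_rows :: "nat \<Rightarrow> complex \<Rightarrow> (nat \<Rightarrow> int \<Rightarrow> complex) \<Rightarrow> nat \<Rightarrow> int \<Rightarrow> complex" where
  "isotropic_rows n t z a i = (if i < 0 then isotropic_entry n t z a (nat (- i)) else z a i)"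

text \<open>Every summand in the solved entries carries a positive power of \<open>t\<close>, so
  these entries tend to 0, the value of an echelon row at \<open>- s\<close> for
  \<open>s \<le> a\<close>. At \<open>s = 0\<close> the formula divides by \<open>z 0 0 = 0\<close>
  and both sides are 0.\<close>

lemma tendsto_isotropic_entry:
  assumes z: "z \<in> echelon_frames n" "a < n"
  shows "((\<lambda>t. isotropic_entry n t z a s) \<longlongrightarrow> z a (- int s)) (at 0)"
proof (induction "n - s" arbitrary: s rule: less_induct)
  case less
  show ?case
  proof (cases "s \<le> a")
    case True
    have IH: "((\<lambda>t. isotropic_entry n t z a j) \<longlongrightarrow> z a (- int j)) (at 0)" if "j \<in> {s<..n}" for j
      using that by (intro less) auto
    have "((\<lambda>t::complex. t ^ (2 ^ j - 2 ^ s)) \<longlongrightarrow> 0 ^ (2 ^ j - 2 ^ s)) (at 0)" if "j \<in> {s<..n}" for j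
      by (intro tendsto_intros)
    then have pow: "((\<lambda>t::complex. t ^ (2 ^ j - 2 ^ s)) \<longlongrightarrow> 0) (at 0)" if "j \<in> {s<..n}" for j
      using that by (simp add: zero_power_eq power_strict_increasing_iff)
    have "((\<lambda>t. - (\<Sum>j\<in>{s<..n}. t ^ (2 ^ j - 2 ^ s) *
                (z (s - 1) (int j) * isotropic_entry n t z a j - z (s - 1) (- int j) * z a (int j)))
          * inverse (z (s - 1) (int s))) \<longlongrightarrow>
       - (\<Sum>j\<in>{s<..n}. 0 * (z (s - 1) (int j) * z a (- int j) - z (s - 1) (- int j) * z a (int j)))
          * inverse (z (s - 1) (int s))) (at 0)"
      by (intro tendsto_intros IH pow)
    moreover have "z a (- int s) = 0"
      using z True by (auto simp: echelon_frames_def)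
    ultimately show ?thesis
      using True by (subst isotropic_entry.simps) (simp add: field_simps)
  next
    case False
    then show ?thesis
      by (subst isotropic_entry.simps) simp
  qed
qed

lemma tendsto_isotropic_rows:
  assumes z: "z \<in> echelon_frames n" "a < n"
  shows "((\<lambda>t. isotropic_rows n t z a i) \<longlongrightarrow> z a i) (at 0)"
  using tendsto_isotropic_entry[OF assms, of "nat (- i)"]
  by (cases "i < 0") (simp_all add: isotropic_rows_def[abs_def])

lemma tendsto_minor:
  assumes "\<And>a i. a < length is \<Longrightarrow> ((\<lambda>t. y t a i) \<longlongrightarrow> z a i) F"
  shows "((\<lambda>t. minor (y t) is) \<longlongrightarrow> minor z is) F"
  unfolding minor_Leibniz
  by (intro tendsto_intros assms) (auto dest: permutes_in_image)

text \<open>The inverse torus action applied to the solved rows: these frames are isotropic for the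
  original form, while their torus translates \<open>isotropic_rows\<close> converge to
  \<open>z\<close>.\<close>

definition isotropic_frame :: "nat \<Rightarrow> complex \<Rightarrow> (nat \<Rightarrow> int \<Rightarrow> complex) \<Rightarrow> nat \<Rightarrow> int \<Rightarrow> complex" where
  "isotropic_frame n t z a i = isotropic_rows n t z a i / t ^ idx_weight n i"

text \<open>Row \<open>b\<close> starts at \<open>s = b + 1\<close>. After the power of
  \<open>t\<close> at \<open>s\<close> is factored out, the term at \<open>s\<close> reduces to the
  entry of row \<open>a\<close> at \<open>- s\<close> times a nonzero factor, and this entry was
  defined to cancel the remaining terms.\<close>

lemma isotropic_frame_pairing:
  assumes z: "z \<in> echelon_frames n" and "t \<noteq> 0" "b < a" "a < n"
  shows "symp_form n (isotropic_frame n t z b) (isotropic_frame n t z a) = 0"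
proof -
  let ?s = "Suc b" and ?N = "2 ^ Suc n :: nat"
  let ?e = "isotropic_entry n t z"
  define h where "h = (\<lambda>j. z b (int j) * ?e a j - ?e b j * z a (int j))"
  have zb: "z b (int j) = 0" if "j \<le> b" for j
    using z that assms(3,4) by (auto simp: echelon_frames_def)
  have za: "z a (int j) = 0" if "j \<le> a" for j
    using z that assms(3,4) by (auto simp: echelon_frames_def)
  have zbb: "z b (int ?s) \<noteq> 0"
    using z assms(3,4) by (auto simp: echelon_frames_def algebra_simps)
  have bij: "bij_betw int {1..n} {1..int n}"
    by (rule bij_betwI[of _ _ _ nat]) auto
  have "symp_form n (isotropic_frame n t z b) (isotropic_frame n t z a) =
     (\<Sum>j\<in>{1..n}. h j / t ^ (?N - 2 ^ j))"
    unfolding symp_form_def sum.reindex_bij_betw[OF bij, symmetric]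
    by (intro sum.cong refl)
       (auto simp: isotropic_frame_def isotropic_rows_def idx_weight_def h_def diff_divide_distrib)
  also have "\<dots> = (\<Sum>j\<in>{?s..n}. h j / t ^ (?N - 2 ^ j))"
    using assms(3) by (intro sum.mono_neutral_right) (auto simp: h_def zb za)
  also have "\<dots> = (\<Sum>j\<in>{?s..n}. t ^ (2 ^ j - 2 ^ ?s) * h j) / t ^ (?N - 2 ^ ?s)"
    unfolding sum_divide_distrib
  proof (rule sum.cong[OF refl])
    fix j assume j: "j \<in> {?s..n}"
    have "(2::nat) ^ ?s \<le> 2 ^ j" "(2::nat) ^ j \<le> ?N"
      using j by (auto intro!: power_increasing simp del: power_Suc)
    then have "t ^ (?N - 2 ^ ?s) = t ^ (?N - 2 ^ j) * t ^ (2 ^ j - 2 ^ ?s)"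
      by (simp flip: power_add)
    then show "h j / t ^ (?N - 2 ^ j) = t ^ (2 ^ j - 2 ^ ?s) * h j / t ^ (?N - 2 ^ ?s)"
      using assms(2) by simp
  qed
  also have "(\<Sum>j\<in>{?s..n}. t ^ (2 ^ j - 2 ^ ?s) * h j) = h ?s + (\<Sum>j\<in>{?s<..n}. t ^ (2 ^ j - 2 ^ ?s) * h j)"
    using assms(3,4) by (simp add: sum.head)
  \<comment> \<open>For \<open>j > b + 1\<close> the entry of row \<open>b\<close> at
    \<open>- j\<close> is one of the unsolved ones, so it is still \<open>z b (- int j)\<close> as
    in the recursion.\<close>
  also have "(\<Sum>j\<in>{?s<..n}. t ^ (2 ^ j - 2 ^ ?s) * h j) =
     (\<Sum>j\<in>{?s<..n}. t ^ (2 ^ j - 2 ^ ?s) * (z b (int j) * ?e a j - z b (- int j) * z a (int j)))"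
    by (intro sum.cong refl) (simp add: h_def isotropic_entry.simps[of n t z b])
  also have "h ?s = - (\<Sum>j\<in>{?s<..n}. t ^ (2 ^ j - 2 ^ ?s) * (z b (int j) * ?e a j - z b (- int j) * z a (int j)))"
    using assms(3) za[of ?s] zbb unfolding h_def
    by (subst isotropic_entry.simps[of n t z a ?s]) simp
  finally show ?thesis
    by simp
qed

lemma isotropic_frame_symplectic:
  assumes z: "z \<in> echelon_frames n" and t: "t \<noteq> 0"
  shows "isotropic_frame n t z \<in> symplectic_frames n"
proof -
  have "lin_indep n (isotropic_frame n t z)"
    using z t by (intro lin_indep_triangular)
      (auto simp: isotropic_frame_def isotropic_rows_def echelon_frames_def)
  moreover have "isotropic_frame n t z a \<in> CN n" if "a < n" for a
  proof -
    have "isotropic_rows n t z a i = 0" if "i \<notin> index_set n" for i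
      using z that \<open>a < n\<close>
      by (auto simp: isotropic_rows_def echelon_frames_def CN_def isotropic_entry.simps[of n t z a] index_set_def)
    then show ?thesis
      by (simp add: CN_def isotropic_frame_def)
  qed
  moreover have "symp_form n (isotropic_frame n t z a) (isotropic_frame n t z b) = 0" if "a < n" "b < n" for a b
    using isotropic_frame_pairing[OF z t, of a b] isotropic_frame_pairing[OF z t, of b a] that
      symp_form_swap[of n "isotropic_frame n t z a" "isotropic_frame n t z b"]
    by (cases a b rule: linorder_cases) auto
  ultimately show ?thesis
    by (simp add: symplectic_frames_def frames_def)
qed

text \<open>On the isotropic frames \<open>q\<close> vanishes. Multiplied by \<open>t ^ W\<close>
  and written in the convergent minors \<open>Y t\<close>, a monomial of weight \<open>d\<close>
  acquires the factor \<open>t ^ (W - d)\<close>; at the limit only the top weight survives,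
  evaluated at \<open>z\<close>.\<close>

lemma initial_form_vanishes:
  assumes q: "q \<in> symplectic_plucker_ideal n" and z: "z \<in> echelon_frames n"
  shows "peval (minor z) (initial_form (weight_less n) q) = 0"
proof -
  let ?w = "tuple_weight n"
  have qI: "q \<in> polys (Theta n)" "\<And>v. v \<in> symplectic_frames n \<Longrightarrow> peval (minor v) q = 0"
    using q by (auto simp: symplectic_plucker_ideal_eq vanishing_def)
  \<comment> \<open>Inserting 0 keeps \<open>Max\<close> defined for \<open>q = 0\<close>.\<close>
  define W where "W = Max (insert 0 (wt ?w ` Poly_Mapping.keys q))"
  have W: "wt ?w m \<le> W" if "m \<in> Poly_Mapping.keys q" for m
    using that by (auto simp: W_def)
  have top: "(\<exists>m'\<in>Poly_Mapping.keys q. weight_less n m m') \<longleftrightarrow> wt ?w m < W"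
    if "m \<in> Poly_Mapping.keys q" for m
  proof -
    have "W \<in> insert 0 (wt ?w ` Poly_Mapping.keys q)"
      unfolding W_def by (rule Max_in) auto
    then show ?thesis
      using W that unfolding weight_less_def by (auto dest: less_le_trans)
  qed
  define Y where "Y = (\<lambda>t. minor (isotropic_rows n t z))"
  have Y: "Y t = (\<lambda>is. t ^ ?w is * minor (isotropic_frame n t z) is)" if "t \<noteq> 0" for t
  proof -
    have "isotropic_rows n t z = (\<lambda>a i. t ^ idx_weight n i * isotropic_frame n t z a i)"
      using that by (simp add: isotropic_frame_def)
    then show ?thesis
      by (simp only: Y_def minor_scale_columns)
  qed
  define S where "S = (\<lambda>t. \<Sum>m\<in>Poly_Mapping.keys q. Poly_Mapping.lookup q m * (t ^ (W - wt ?w m) * mon_eval (Y t) m))"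
  have S0: "S t = 0" if t: "t \<noteq> 0" for t
  proof -
    have "S t = t ^ W * peval (minor (isotropic_frame n t z)) q"
      unfolding S_def peval_alt sum_distrib_left
    proof (rule sum.cong[OF refl])
      fix m assume "m \<in> Poly_Mapping.keys q"
      then have "t ^ W = t ^ (W - wt ?w m) * t ^ wt ?w m"
        using W by (simp flip: power_add)
      then show "Poly_Mapping.lookup q m * (t ^ (W - wt ?w m) * mon_eval (Y t) m) =
         t ^ W * (Poly_Mapping.lookup q m * mon_eval (minor (isotropic_frame n t z)) m)"
        by (simp add: Y[OF t] mon_eval_rescale)
    qed
    then show ?thesis
      using qI(2) isotropic_frame_symplectic[OF z t] by simp
  qed
  have lim: "(S \<longlongrightarrow> (\<Sum>m\<in>Poly_Mapping.keys q.
       Poly_Mapping.lookup q m * (0 ^ (W - wt ?w m) * mon_eval (minor z) m))) (at 0)"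
    unfolding S_def
  proof (intro tendsto_intros)
    fix m assume "m \<in> Poly_Mapping.keys q"
    then have "length is \<le> n" if "is \<in> Poly_Mapping.keys m" for "is"
      using that qI(1) Theta_subset[of n] by (force simp: polys_def monomials_def tuples_def)
    then show "((\<lambda>t. mon_eval (Y t) m) \<longlongrightarrow> mon_eval (minor z) m) (at 0)"
      unfolding mon_eval_def Y_def
      by (intro tendsto_intros tendsto_minor tendsto_isotropic_rows[OF z]) (auto dest: less_le_trans)
  qed
  have "(S \<longlongrightarrow> 0) (at 0)"
    by (rule tendsto_eventually) (auto simp: eventually_at_filter S0)
  from tendsto_unique[OF _ this lim] have "0 = (\<Sum>m\<in>Poly_Mapping.keys q.
       Poly_Mapping.lookup q m * (0 ^ (W - wt ?w m) * mon_eval (minor z) m))"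
    by simp
  also have "\<dots> = (\<Sum>m\<in>{m \<in> Poly_Mapping.keys q. \<not> wt ?w m < W}. Poly_Mapping.lookup q m * mon_eval (minor z) m)"
    by (intro sum.mono_neutral_cong_right) (auto simp: zero_power_eq)
  also have "\<dots> = peval (minor z) (initial_form (weight_less n) q)"
    unfolding peval_alt initial_form_eq_restrict keys_restrict_poly lookup_restrict_poly
    using top by (intro sum.cong) (simp_all add: set_eq_iff cong: conj_cong)
  finally show ?thesis
    by simp
qed

lemma initial_ideal_vanishing:
  "initial_ideal (weight_less n) (symplectic_plucker_ideal n) \<subseteq> vanishing (Theta n) (echelon_frames n)"
  unfolding initial_ideal_def
proof (rule P.span_minimal)
  show "initial_form (weight_less n) ` symplectic_plucker_ideal n \<subseteq> vanishing (Theta n) (echelon_frames n)"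
  proof
    fix p assume "p \<in> initial_form (weight_less n) ` symplectic_plucker_ideal n"
    then obtain q where q: "q \<in> symplectic_plucker_ideal n" "p = initial_form (weight_less n) q"
      by blast
    then show "p \<in> vanishing (Theta n) (echelon_frames n)"
      using initial_form_vanishes[OF q(1)]
      by (auto simp: vanishing_def symplectic_plucker_ideal_eq initial_form_eq_restrict restrict_poly_polys)
  qed
  show "P.subspace (vanishing (Theta n) (echelon_frames n))"
    by (auto simp: P.subspace_def vanishing_def polys_closed peval_add poly_scale_def peval_mult)
qed

section \<open>Straightening in type A\<close>

text \<open>Position in the order \<open>1 < -1 < 2 < -2 < \<dots>\<close>. For tuples sorted this way, admissibility is King's
  condition that the \<open>r\<close>-th entry has absolute value at least \<open>r\<close>.\<close>

definition pos :: "int \<Rightarrow> nat" where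
  "pos i = (if i > 0 then 2 * nat i - 1 else 2 * nat (- i))"

definition king_sort :: "int list \<Rightarrow> int list" where
  "king_sort is = sort_key pos is"

text \<open>Semistandardness of a tableau with left column \<open>is\<close> and right column
  \<open>js\<close>: lengths weakly decrease and rows weakly increase.\<close>

definition king_le :: "int list \<Rightarrow> int list \<Rightarrow> bool" where
  "king_le is js \<longleftrightarrow> length js \<le> length is \<and>
     (\<forall>r<length js. pos (king_sort is ! r) \<le> pos (king_sort js ! r))"

lemma pos_inj: "pos i = pos j \<Longrightarrow> i = j"
proof -
  assume eq: "pos i = pos j"
  have "even (pos i) \<longleftrightarrow> i \<le> 0" for i
    by (auto simp: pos_def)
  with eq have "i \<le> 0 \<longleftrightarrow> j \<le> 0"
    by metis
  with eq show "i = j"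
    by (auto simp: pos_def split: if_splits)
qed

lemma length_king_sort [simp]: "length (king_sort is) = length is"
  and mset_king_sort [simp]: "mset (king_sort is) = mset is"
  and set_king_sort [simp]: "set (king_sort is) = set is"
  by (auto simp: king_sort_def)

lemma king_sort_mono:
  "r \<le> r' \<Longrightarrow> r' < length is \<Longrightarrow> pos (king_sort is ! r) \<le> pos (king_sort is ! r')"
  using sorted_nth_mono[of "map pos (king_sort is)" r r'] by (simp add: king_sort_def)

text \<open>The sum is a determinant with two equal rows; \<open>rw\<close> tells which row of
  \<open>v\<close> sits at which position.\<close>

lemma garnir_zero:
  assumes "rw a = rw b" "a < m" "b < m" "a \<noteq> b" "length E = m"
  shows "(\<Sum>p | p permutes {0..<m}. signof p * (\<Prod>j=0..<m. v (rw j) (E ! p j))) = (0::complex)"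
proof -
  let ?M = "mat m m (\<lambda>(j, c). v (rw j) (E ! c))"
  have "Determinant.det ?M = 0"
    using assms by (intro det_identical_rows[of _ m a b]) (auto intro!: eq_vecI)
  then show ?thesis
    by (subst (asm) det_def'[of _ m])
       (auto dest: permutes_in_image[THEN iffD2] intro!: sum.cong prod.cong elim!: trans[rotated])
qed

lemma minor_append_Leibniz:
  assumes "k = r + m" "length xs = r"
  shows "minor v (xs @ map e [c..<c + m]) = (\<Sum>p | p permutes {0..<k}. signof p *
     ((\<Prod>i=0..<r. v (p i) (xs ! i)) * (\<Prod>j=0..<m. v (p (r + j)) (e (c + j)))))"
proof -
  have "(\<Prod>i=0..<r + m. v (p i) ((xs @ map e [c..<c + m]) ! i)) =
     (\<Prod>i=0..<r. v (p i) (xs ! i)) * (\<Prod>j=0..<m. v (p (r + j)) (e (c + j)))" for p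
  proof -
    have "(\<Prod>i=0..<r + m. v (p i) ((xs @ map e [c..<c + m]) ! i)) =
      (\<Prod>i=0..<r. v (p i) ((xs @ map e [c..<c + m]) ! i)) *
      (\<Prod>i=r..<r + m. v (p i) ((xs @ map e [c..<c + m]) ! i))"
      by (rule prod.atLeastLessThan_concat[symmetric]) auto
    also have "(\<Prod>i=r..<r + m. v (p i) ((xs @ map e [c..<c + m]) ! i)) =
      (\<Prod>j=0..<m. v (p (r + j)) (e (c + j)))"
      using prod.shift_bounds_nat_ivl[of "\<lambda>i. v (p i) ((xs @ map e [c..<c + m]) ! i)" 0 r m] assms(2)
      by (simp add: nth_append add.commute)
    finally show ?thesis
      using assms(2) by (simp add: nth_append)
  qed
  then show ?thesis
    using assms by (simp add: minor_Leibniz)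
qed

lemma minor_append_Leibniz':
  assumes "k = m + length xs"
  shows "minor v (map e [c..<c + m] @ xs) = (\<Sum>p | p permutes {0..<k}. signof p *
     ((\<Prod>j=0..<m. v (p j) (e (c + j))) * (\<Prod>i=0..<length xs. v (p (m + i)) (xs ! i))))"
proof -
  have "(\<Prod>i=0..<m + length xs. v (p i) ((map e [c..<c + m] @ xs) ! i)) =
     (\<Prod>j=0..<m. v (p j) (e (c + j))) * (\<Prod>i=0..<length xs. v (p (m + i)) (xs ! i))" for p
  proof -
    have "(\<Prod>i=0..<m + length xs. v (p i) ((map e [c..<c + m] @ xs) ! i)) =
      (\<Prod>i=0..<m. v (p i) ((map e [c..<c + m] @ xs) ! i)) *
      (\<Prod>i=m..<m + length xs. v (p i) ((map e [c..<c + m] @ xs) ! i))"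
      by (rule prod.atLeastLessThan_concat[symmetric]) auto
    also have "(\<Prod>i=m..<m + length xs. v (p i) ((map e [c..<c + m] @ xs) ! i)) =
      (\<Prod>i=0..<length xs. v (p (m + i)) (xs ! i))"
      using prod.shift_bounds_nat_ivl[of "\<lambda>i. v (p i) ((map e [c..<c + m] @ xs) ! i)" 0 m "length xs"]
      by (simp add: nth_append add.commute)
    finally show ?thesis
      by (simp add: nth_append)
  qed
  then show ?thesis
    using assms by (simp add: minor_Leibniz)
qed

text \<open>The left-hand side is alternating in \<open>k + 1\<close> columns, which have only \<open>k\<close> entries each.\<close>

lemma garnir_relation:
  assumes S: "length S = k" and T: "length T \<le> k" and r: "r < length T"
  defines "E \<equiv> drop r S @ take (Suc r) T"
  shows "(\<Sum>\<pi> | \<pi> permutes {0..<Suc k}. signof \<pi> *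
      (minor v (take r S @ map (\<lambda>i. E ! \<pi> i) [0..<k - r]) *
       minor v (map (\<lambda>i. E ! \<pi> i) [k - r..<Suc k] @ drop (Suc r) T))) = 0"
proof -
  let ?l = "length T"
  have rk: "r < k"
    using r T by simp
  define a where "a = (\<lambda>p :: nat \<Rightarrow> nat. signof p * (\<Prod>i=0..<r. v (p i) (take r S ! i)))"
  define b where "b = (\<lambda>q :: nat \<Rightarrow> nat. signof q * (\<Prod>i=0..<?l - Suc r. v (q (Suc r + i)) (drop (Suc r) T ! i)))"
  \<comment> \<open>The row of \<open>v\<close> paired with the \<open>j\<close>-th exchanged
    column: positions below \<open>k - r\<close> belong to the first minor, the others to the
    second.\<close>
  define rw where "rw = (\<lambda>p q j. if j < k - r then p (r + j) else q (j - (k - r)) :: nat)"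
  have 1: "minor v (take r S @ map (\<lambda>i. E ! \<pi> i) [0..<k - r]) =
     (\<Sum>p | p permutes {0..<k}. a p * (\<Prod>j=0..<k - r. v (p (r + j)) (E ! \<pi> j)))" for \<pi>
    using minor_append_Leibniz[of k r "k - r" "take r S" v "\<lambda>i. E ! \<pi> i" 0] rk S
    by (simp add: a_def mult.assoc)
  have 2: "minor v (map (\<lambda>i. E ! \<pi> i) [k - r..<Suc k] @ drop (Suc r) T) =
     (\<Sum>q | q permutes {0..<?l}. b q * (\<Prod>j=0..<Suc r. v (q j) (E ! \<pi> (k - r + j))))" for \<pi>
  proof -
    have "k - r + Suc r = Suc k"
      using rk by simp
    then show ?thesis
      using minor_append_Leibniz'[of ?l "Suc r" "drop (Suc r) T" v "\<lambda>i. E ! \<pi> i" "k - r"] r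
      by (simp add: b_def mult.assoc mult.left_commute mult.commute del: prod.op_ivl_Suc)
  qed
  have prod: "(\<Prod>j=0..<k - r. v (p (r + j)) (E ! \<pi> j)) * (\<Prod>j=0..<Suc r. v (q j) (E ! \<pi> (k - r + j))) =
     (\<Prod>j=0..<Suc k. v (rw p q j) (E ! \<pi> j))" for p q \<pi>
  proof -
    have e: "k - r + Suc r = Suc k"
      using rk by simp
    have "(\<Prod>j=0..<Suc k. v (rw p q j) (E ! \<pi> j)) =
      (\<Prod>j=0..<k - r. v (rw p q j) (E ! \<pi> j)) * (\<Prod>j=k - r..<Suc k. v (rw p q j) (E ! \<pi> j))"
      by (rule prod.atLeastLessThan_concat[symmetric]) auto
    also have "(\<Prod>j=k - r..<Suc k. v (rw p q j) (E ! \<pi> j)) =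
       (\<Prod>j=0..<Suc r. v (rw p q (k - r + j)) (E ! \<pi> (k - r + j)))"
      using prod.shift_bounds_nat_ivl[of "\<lambda>j. v (rw p q j) (E ! \<pi> j)" 0 "k - r" "Suc r"]
      unfolding add_0 add.commute[of "Suc r"] e by (simp only: add.commute)
    finally show ?thesis
      by (simp add: rw_def del: prod.op_ivl_Suc)
  qed
  have "(\<Sum>\<pi> | \<pi> permutes {0..<Suc k}. signof \<pi> *
      (minor v (take r S @ map (\<lambda>i. E ! \<pi> i) [0..<k - r]) *
       minor v (map (\<lambda>i. E ! \<pi> i) [k - r..<Suc k] @ drop (Suc r) T))) =
     (\<Sum>\<pi> | \<pi> permutes {0..<Suc k}. \<Sum>p | p permutes {0..<k}. \<Sum>q | q permutes {0..<?l}.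
        a p * b q * (signof \<pi> * (\<Prod>j=0..<Suc k. v (rw p q j) (E ! \<pi> j))))"
    unfolding 1 2 sum_product
    unfolding sum_distrib_left prod[symmetric]
    by (intro sum.cong refl) (simp only: mult_ac)
  also have "\<dots> = (\<Sum>p | p permutes {0..<k}. \<Sum>q | q permutes {0..<?l}.
      \<Sum>\<pi> | \<pi> permutes {0..<Suc k}. a p * b q * (signof \<pi> * (\<Prod>j=0..<Suc k. v (rw p q j) (E ! \<pi> j))))"
    by (subst sum.swap, rule sum.cong[OF refl], rule sum.swap)
  also have "\<dots> = 0"
  proof (rule sum.neutral, rule ballI, rule sum.neutral, rule ballI)
    fix p q assume "p \<in> {p. p permutes {0..<k}}" "q \<in> {q. q permutes {0..<?l}}"
    then have p: "p permutes {0..<k}" and q: "q permutes {0..<?l}"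
      by auto
    \<comment> \<open>There are \<open>k + 1\<close> exchanged columns but only \<open>k\<close>
      rows, so two of them share a row and the determinant is zero.\<close>
    have "rw p q ` {0..<Suc k} \<subseteq> {0..<k}"
    proof
      fix x assume "x \<in> rw p q ` {0..<Suc k}"
      then obtain j where j: "j < Suc k" "x = rw p q j"
        by auto
      show "x \<in> {0..<k}"
        using j permutes_in_image[OF p, of "r + j"] permutes_in_image[OF q, of "j - (k - r)"] r T
        by (auto simp: rw_def)
    qed
    then have "card (rw p q ` {0..<Suc k}) < card {0..<Suc k}"
      using card_mono[of "{0..<k}"] by (simp add: less_Suc_eq_le)
    then have "\<not> inj_on (rw p q) {0..<Suc k}"
      by (rule pigeonhole)
    then obtain x y where "rw p q x = rw p q y" "x < Suc k" "y < Suc k" "x \<noteq> y"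
      by (auto simp: inj_on_def)
    from garnir_zero[OF this, of E v] show "(\<Sum>\<pi> | \<pi> permutes {0..<Suc k}. a p * b q *
        (signof \<pi> * (\<Prod>j=0..<Suc k. v (rw p q j) (E ! \<pi> j)))) = 0"
      using S r rk by (simp add: E_def sum_distrib_left[symmetric] del: prod.op_ivl_Suc)
  qed
  finally show ?thesis .
qed

lemma minor_permute_block:
  assumes "p permutes set js" "distinct js"
  shows "minor v (xs @ map (\<lambda>i. e (p i)) js @ ys) = signof p * minor v (xs @ map e js @ ys)"
  using assms(1) finite_set[of js]
proof (induction p arbitrary: e rule: permutes_induct)
  case id
  then show ?case by (simp add: sign_id)
next
  case (swap a b p)
  obtain x y where xy: "x < length js" "y < length js" "a = js ! x" "b = js ! y"
    using swap.hyps by (auto simp: in_set_conv_nth)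
  with swap.hyps have "x \<noteq> y"
    by auto
  let ?l = "xs @ map e js @ ys" and ?t = "transpose (length xs + x) (length xs + y)"
  have t: "?t permutes {..<length ?l}"
    by (rule permutes_swap_id) (use xy in auto)
  have sw: "minor v (xs @ map (\<lambda>i. e (transpose a b i)) js @ ys) = - minor v ?l"
  proof -
    have "permute_list ?t ?l = xs @ map (\<lambda>i. e (transpose a b i)) js @ ys"
    proof (rule nth_equalityI)
      fix i assume "i < length (permute_list ?t ?l)"
      then have i: "i < length ?l"
        by simp
      have "js ! j = js ! x \<longleftrightarrow> j = x" "js ! j = js ! y \<longleftrightarrow> j = y" if "j < length js" for j
        using that xy assms(2) by (auto simp: nth_eq_iff_index_eq)
      then show "permute_list ?t ?l ! i = (xs @ map (\<lambda>i. e (transpose a b i)) js @ ys) ! i"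
        using i xy by (auto simp: permute_list_nth[OF t] transpose_def nth_append)
    qed simp
    then show ?thesis
      using minor_permute[OF t, of v] \<open>x \<noteq> y\<close> by (simp add: sign_swap_id)
  qed
  have "sign (transpose a b \<circ> p) = sign (transpose a b) * sign p"
    using swap.hyps by (intro sign_compose permutation_swap_id permutation_permutes[THEN iffD2]) auto
  then show ?case
    using swap.IH[of "\<lambda>i. e (transpose a b i)"] sw swap.hyps by (simp add: sign_swap_id o_def)
qed

text \<open>Such a permutation is a product of one on each block. Each minor produces the sign of
  its own block, and together they cancel the sign of \<open>\<pi>\<close>.\<close>

lemma block_preserving_term:
  assumes "length S = k" "r < k" "r < length T"
    and \<pi>: "\<pi> permutes {0..<Suc k}" "\<pi> ` {0..<k - r} = {0..<k - r}"
  defines "E \<equiv> drop r S @ take (Suc r) T"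
  shows "signof \<pi> *
      (minor v (take r S @ map (\<lambda>i. E ! \<pi> i) [0..<k - r]) *
       minor v (map (\<lambda>i. E ! \<pi> i) [k - r..<Suc k] @ drop (Suc r) T)) = minor v S * minor v T"
proof -
  define A where "A = {0..<k - r}"
  define B where "B = {k - r..<Suc k}"
  have AB: "A \<inter> B = {}" "A \<union> B = {0..<Suc k}"
    by (auto simp: A_def B_def)
  define p where "p = (\<lambda>x. if x \<in> A then \<pi> x else x)"
  define q where "q = (\<lambda>x. if x \<in> B then \<pi> x else x)"
  have inj: "inj \<pi>"
    using \<pi>(1) by (rule permutes_inj)
  have \<pi>A: "\<pi> ` A = A"
    using \<pi>(2) by (simp add: A_def)
  have "\<pi> ` (A \<union> B) = A \<union> B"
    unfolding AB using \<pi>(1) by (rule permutes_image)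
  moreover have "\<pi> ` A \<inter> \<pi> ` B = {}"
    using AB(1) inj by (auto simp: inj_def)
  ultimately have \<pi>B: "\<pi> ` B = B"
    using \<pi>A AB(1) by (auto simp: image_Un)
  have pA: "p permutes A"
    using inj \<pi>A by (intro bij_imp_permutes) (auto simp: p_def bij_betw_def inj_def inj_on_def)
  have qB: "q permutes B"
    using inj \<pi>B by (intro bij_imp_permutes) (auto simp: q_def bij_betw_def inj_def inj_on_def)
  have "\<pi> = p \<circ> q"
  proof
    fix x
    have "q x \<in> B" if "x \<in> B"
      using that \<pi>B by (auto simp: q_def)
    moreover have "\<pi> x = x" if "x \<notin> A" "x \<notin> B"
      using \<pi>(1) that AB by (auto simp: permutes_def)
    ultimately show "\<pi> x = (p \<circ> q) x"
      using AB by (auto simp: p_def q_def)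
  qed
  moreover have "permutation p" "permutation q"
    using pA qB by (auto simp: permutation_permutes A_def B_def)
  ultimately have sgn: "sign \<pi> = sign p * sign q"
    by (simp add: sign_compose)
  have 1: "map (\<lambda>i. E ! \<pi> i) [0..<k - r] = map (\<lambda>i. E ! p i) [0..<k - r]"
    by (auto simp: p_def A_def)
  have 2: "map (\<lambda>i. E ! \<pi> i) [k - r..<Suc k] = map (\<lambda>i. E ! q i) [k - r..<Suc k]"
    by (auto simp: q_def B_def)
  have E1: "map ((!) E) [0..<k - r] = drop r S"
    using assms by (intro nth_equalityI) (auto simp: E_def nth_append)
  have E2: "map ((!) E) [k - r..<Suc k] = take (Suc r) T"
  proof (rule nth_equalityI)
    fix i assume i: "i < length (map ((!) E) [k - r..<Suc k])"
    then have "map ((!) E) [k - r..<Suc k] ! i = E ! (k - r + i)"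
      by (subst nth_map) (auto simp del: upt_Suc)
    also have "\<dots> = (drop r S @ take (Suc r) T) ! (length (drop r S) + i)"
      using assms(1) by (simp add: E_def)
    also have "\<dots> = take (Suc r) T ! i"
      by (rule nth_append_length_plus)
    finally show "map ((!) E) [k - r..<Suc k] ! i = take (Suc r) T ! i" .
  qed (use assms in auto)
  have "minor v (take r S @ map (\<lambda>i. E ! \<pi> i) [0..<k - r]) = signof p * minor v S"
    using minor_permute_block[of p "[0..<k - r]" v "take r S" "\<lambda>i. E ! i" "[]"] pA
    unfolding 1 by (simp add: A_def E1)
  moreover have "minor v (map (\<lambda>i. E ! \<pi> i) [k - r..<Suc k] @ drop (Suc r) T) = signof q * minor v T"
    using minor_permute_block[of q "[k - r..<Suc k]" v "[]" "\<lambda>i. E ! i" "drop (Suc r) T"] qB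
    unfolding 2 by (simp add: B_def E2 del: upt_Suc)
  moreover have "sign p * sign p = 1" "sign q * sign q = 1"
    by (auto simp: sign_def)
  then have "signof p * signof p = (1::complex)" "signof q * signof q = (1::complex)"
    by (auto simp flip: of_int_mult)
  moreover have "signof \<pi> * (signof p * x * (signof q * y)) =
      (signof p * signof p) * (signof q * signof q) * (x * y)" for x y :: complex
    by (simp add: sgn)
  ultimately show ?thesis
    by (simp del: upt_Suc)
qed

text \<open>The block-preserving permutations all contribute the same product, and the identity is
  among them. Dividing the Garnir relation by their number solves it for this product, with
  \<open>c\<close> minus the inverse of that number.\<close>

lemma garnir_straightening:
  assumes S: "length S = k" and T: "length T \<le> k" and r: "r < length T"
  defines "E \<equiv> drop r S @ take (Suc r) T"
  shows "\<exists>c. \<forall>v. minor v S * minor v T =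
     (\<Sum>\<pi> | \<pi> permutes {0..<Suc k} \<and> \<pi> ` {0..<k - r} \<noteq> {0..<k - r}. c * signof \<pi> *
      (minor v (take r S @ map (\<lambda>i. E ! \<pi> i) [0..<k - r]) *
       minor v (map (\<lambda>i. E ! \<pi> i) [k - r..<Suc k] @ drop (Suc r) T)))"
proof -
  let ?all = "{\<pi>. \<pi> permutes {0..<Suc k}}"
  let ?P = "{\<pi>. \<pi> permutes {0..<Suc k} \<and> \<pi> ` {0..<k - r} = {0..<k - r}}"
  let ?Q = "{\<pi>. \<pi> permutes {0..<Suc k} \<and> \<pi> ` {0..<k - r} \<noteq> {0..<k - r}}"
  define g where "g = (\<lambda>v \<pi>. signof \<pi> *
      (minor v (take r S @ map (\<lambda>i. E ! \<pi> i) [0..<k - r]) *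
       minor v (map (\<lambda>i. E ! \<pi> i) [k - r..<Suc k] @ drop (Suc r) T)))"
  have fin: "finite ?all"
    by (rule finite_permutations) simp
  then have finP: "finite ?P"
    by (rule rev_finite_subset) auto
  have id: "id \<in> ?P"
    by (auto simp: permutes_id)
  then have c0: "card ?P \<noteq> 0"
    using finP by (metis card_0_eq empty_iff)
  have rk: "r < k"
    using r T by simp
  have "minor v S * minor v T = (\<Sum>\<pi>\<in>?Q. - inverse (of_nat (card ?P)) * g v \<pi>)" for v
  proof -
    have "0 = (\<Sum>\<pi>\<in>?all. g v \<pi>)"
      using garnir_relation[OF S T r, of v] by (simp add: g_def E_def del: upt_Suc)
    also have "?all = ?P \<union> ?Q"
      by auto
    also have "(\<Sum>\<pi>\<in>?P \<union> ?Q. g v \<pi>) = (\<Sum>\<pi>\<in>?P. g v \<pi>) + (\<Sum>\<pi>\<in>?Q. g v \<pi>)"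
      by (rule sum.union_disjoint) (auto intro: finite_subset[OF _ fin])
    also have "(\<Sum>\<pi>\<in>?P. g v \<pi>) = (\<Sum>\<pi>\<in>?P. minor v S * minor v T)"
      unfolding g_def E_def
      by (intro sum.cong refl block_preserving_term) (use S rk r in auto)
    finally have "of_nat (card ?P) * (minor v S * minor v T) = - (\<Sum>\<pi>\<in>?Q. g v \<pi>)"
      by (simp add: eq_neg_iff_add_eq_0)
    then have "minor v S * minor v T = inverse (of_nat (card ?P)) * (- (\<Sum>\<pi>\<in>?Q. g v \<pi>))"
      using c0 by (simp add: field_simps del: card_eq_0_iff)
    then show ?thesis
      by (simp add: sum_distrib_left sum_negf)
  qed
  then show ?thesis
    unfolding g_def mult.assoc by blast
qed


section \<open>Straightening terminates in semistandard monomials\<close>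

definition pos_sum :: "int list \<Rightarrow> nat" where
  "pos_sum is = (\<Sum>i\<leftarrow>is. pos i)"

text \<open>Orders columns by decreasing length and then by \<open>pos_sum\<close>. A column has at
  most \<open>n\<close> entries of position at most \<open>2 * n\<close>, so the factor
  \<open>2 * n * n + 1\<close> prevents the second criterion from overriding the first.\<close>

definition king_key :: "nat \<Rightarrow> int list \<Rightarrow> nat" where
  "king_key n is = (2 * n * n + 1) * (n - length is) + pos_sum is"

lemma pos_sum_mset: "mset is = mset js \<Longrightarrow> pos_sum is = pos_sum js"
  unfolding pos_sum_def by (metis mset_map sum_mset_sum_list)

lemma pos_sum_map_upt: "pos_sum (map h [0..<m]) = (\<Sum>i\<in>{0..<m}. pos (h i))"
  by (simp add: pos_sum_def o_def interv_sum_list_conv_sum_set_nat)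

lemma pos_le: "i \<in> index_set n \<Longrightarrow> pos i \<le> 2 * n"
  by (auto simp: pos_def index_set_def)

lemma pos_sum_le:
  assumes "is \<in> tuples n"
  shows "pos_sum is \<le> 2 * n * n"
proof -
  have "pos_sum is \<le> (\<Sum>i\<leftarrow>is. 2 * n)"
    unfolding pos_sum_def using assms by (intro sum_list_mono pos_le) (auto simp: tuples_def)
  also have "\<dots> \<le> 2 * n * n"
    using assms by (auto simp: sum_list_triv tuples_def)
  finally show ?thesis .
qed

lemma king_key_le:
  assumes "is \<in> tuples n"
  shows "king_key n is \<le> (2 * n * n + 1) * n + 2 * n * n"
  unfolding king_key_def by (intro add_mono mult_left_mono pos_sum_le assms) auto

lemma king_key_length:
  assumes "is \<in> tuples n" "js \<in> tuples n" "king_key n is \<le> king_key n js"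
  shows "length js \<le> length is"
proof (rule ccontr)
  assume "\<not> length js \<le> length is"
  moreover have "length js \<le> n"
    using assms(2) by (auto simp: tuples_def)
  ultimately have "n - length is \<ge> Suc (n - length js)"
    by auto
  then have "(2 * n * n + 1) * Suc (n - length js) \<le> (2 * n * n + 1) * (n - length is)"
    by (rule mult_le_mono2)
  with assms(3) pos_sum_le[OF assms(2)] show False
    by (simp add: king_key_def)
qed

text \<open>Columns that are pairwise comparable form a chain, so these monomials are the
  semistandard tableaux.\<close>

definition standard :: "nat \<Rightarrow> int list monomial set" where
  "standard n = {m \<in> monomials (tuples n). \<forall>is\<in>Poly_Mapping.keys m. \<forall>js\<in>Poly_Mapping.keys m.
      king_le is js \<or> king_le js is}"

definition standard_span :: "nat \<Rightarrow> ((nat \<Rightarrow> int \<Rightarrow> complex) \<Rightarrow> complex) set" where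
  "standard_span n = {f. \<exists>s. Poly_Mapping.keys s \<subseteq> standard n \<and> (\<forall>v. f v = peval (minor v) s)}"

lemma standard_span_0: "(\<lambda>v. 0) \<in> standard_span n"
  unfolding standard_span_def by (auto intro!: exI[of _ 0])

lemma standard_span_add:
  assumes "f \<in> standard_span n" "g \<in> standard_span n"
  shows "(\<lambda>v. f v + g v) \<in> standard_span n"
proof -
  from assms obtain s s' where
    "Poly_Mapping.keys s \<subseteq> standard n" "\<forall>v. f v = peval (minor v) s"
    "Poly_Mapping.keys s' \<subseteq> standard n" "\<forall>v. g v = peval (minor v) s'"
    unfolding standard_span_def by blast
  then show ?thesis
    using Poly_Mapping.keys_add[of s s'] unfolding standard_span_def
    by (intro CollectI exI[of _ "s + s'"]) (auto simp: peval_add)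
qed

lemma standard_span_scale:
  assumes "f \<in> standard_span n"
  shows "(\<lambda>v. c * f v) \<in> standard_span n"
proof -
  from assms obtain s where
    s: "Poly_Mapping.keys s \<subseteq> standard n" "\<forall>v. f v = peval (minor v) s"
    unfolding standard_span_def by blast
  have "Poly_Mapping.keys (const c * s) \<subseteq> Poly_Mapping.keys s"
    using keys_mult[of "const c" s] by (auto simp: const_def split: if_splits)
  with s show ?thesis
    unfolding standard_span_def by (intro CollectI exI[of _ "const c * s"]) (auto simp: peval_mult)
qed

lemma standard_span_sum:
  "(\<And>i. i \<in> I \<Longrightarrow> f i \<in> standard_span n) \<Longrightarrow> (\<lambda>v. \<Sum>i\<in>I. f i v) \<in> standard_span n"
  by (induction I rule: infinite_finite_induct) (auto simp: standard_span_0 standard_span_add)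

text \<open>The common part cancels; equally many elements enter and leave, the entering ones below
  the threshold and the leaving ones not.\<close>

lemma sum_exchange_less:
  fixes x :: "nat \<Rightarrow> nat"
  assumes "finite A" "card B = card A" "B \<noteq> A" "finite B"
    and "\<And>a. a \<in> A \<Longrightarrow> \<theta> \<le> x a" "\<And>b. b \<in> B - A \<Longrightarrow> x b < \<theta>"
  shows "(\<Sum>b\<in>B. x b) < (\<Sum>a\<in>A. x a)"
proof -
  have c: "card (B - A) = card (A - B)"
    using assms card_Diff_subset_Int[of B A] card_Diff_subset_Int[of A B]
    by (simp add: Int_commute)
  have ne: "B - A \<noteq> {}"
    using assms card_subset_eq[of A B] by auto
  have "(\<Sum>b\<in>B - A. x b) < (\<Sum>b\<in>B - A. \<theta>)"
    using assms ne by (intro sum_strict_mono) auto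
  also have "\<dots> = (\<Sum>a\<in>A - B. \<theta>)"
    using c by simp
  also have "\<dots> \<le> (\<Sum>a\<in>A - B. x a)"
    using assms by (intro sum_mono) auto
  finally have "(\<Sum>b\<in>B - A. x b) < (\<Sum>a\<in>A - B. x a)" .
  moreover have "(\<Sum>b\<in>B. x b) = (\<Sum>b\<in>B \<inter> A. x b) + (\<Sum>b\<in>B - A. x b)"
    using assms(4) by (rule sum.Int_Diff)
  moreover have "(\<Sum>a\<in>A. x a) = (\<Sum>a\<in>A \<inter> B. x a) + (\<Sum>a\<in>A - B. x a)"
    using assms(1) by (rule sum.Int_Diff)
  ultimately show ?thesis
    by (simp add: Int_commute)
qed

text \<open>At a violation in row \<open>r\<close>, all exchanged entries of \<open>t\<close>
  precede all exchanged entries of \<open>s\<close>. Hence any proper exchange brings smaller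
  entries into the first column, while the total content is preserved.\<close>

lemma garnir_term:
  assumes S: "s \<in> tuples n" and T: "t \<in> tuples n" and len: "length t \<le> length s" and r: "r < length t"
    and gt: "pos (king_sort t ! r) < pos (king_sort s ! r)"
    and \<pi>: "\<pi> permutes {0..<Suc (length s)}" "\<pi> ` {0..<length s - r} \<noteq> {0..<length s - r}"
  defines "E \<equiv> drop r (king_sort s) @ take (Suc r) (king_sort t)"
  defines "s' \<equiv> take r (king_sort s) @ map (\<lambda>i. E ! \<pi> i) [0..<length s - r]"
    and "t' \<equiv> map (\<lambda>i. E ! \<pi> i) [length s - r..<Suc (length s)] @ drop (Suc r) (king_sort t)"
  shows "length s' = length s" "length t' = length t" "set s' \<subseteq> index_set n" "set t' \<subseteq> index_set n"
    "pos_sum s' < pos_sum s" "pos_sum s' + pos_sum t' = pos_sum s + pos_sum t"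
proof -
  let ?k = "length s" and ?A = "{0..<length s - r}"
  have rk: "r < ?k"
    using r len by simp
  have lenE: "length E = Suc ?k"
    using rk r by (simp add: E_def)
  show "length s' = length s" "length t' = length t"
    using rk r by (auto simp: s'_def t'_def simp del: upt_Suc)
  have up: "[0..<?k - r] @ [?k - r..<Suc ?k] = [0..<Suc ?k]"
    using upt_add_eq_append[of 0 "?k - r" "Suc r"] rk by (simp del: upt_Suc)
  have "mset (map (\<lambda>i. E ! \<pi> i) [0..<Suc ?k]) = mset E"
    using mset_permute_list[of \<pi> E] \<pi>(1) lenE by (simp add: permute_list_def atLeast0LessThan del: upt_Suc)
  then have "mset (map (\<lambda>i. E ! \<pi> i) [0..<?k - r]) + mset (map (\<lambda>i. E ! \<pi> i) [?k - r..<Suc ?k]) = mset E"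
    unfolding up[symmetric] by (simp del: upt_Suc)
  then have "mset s' + mset t' = mset (take r (king_sort s)) + mset E + mset (drop (Suc r) (king_sort t))"
    by (simp add: s'_def t'_def del: upt_Suc)
  also have "\<dots> = mset (take r (king_sort s) @ drop r (king_sort s)) +
      mset (take (Suc r) (king_sort t) @ drop (Suc r) (king_sort t))"
    unfolding E_def mset_append by simp
  also have "\<dots> = mset s + mset t"
    unfolding append_take_drop_id by simp
  finally have ms: "mset (s' @ t') = mset (s @ t)"
    by simp
  from pos_sum_mset[OF this] show "pos_sum s' + pos_sum t' = pos_sum s + pos_sum t"
    by (simp add: pos_sum_def)
  from ms have "set (s' @ t') = set (s @ t)"
    by (rule mset_eq_setD)
  then show "set s' \<subseteq> index_set n" "set t' \<subseteq> index_set n"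
    using S T by (auto simp: tuples_def)
  define x where "x = (\<lambda>i. pos (E ! i))"
  have inj: "inj_on \<pi> ?A"
    using permutes_inj[OF \<pi>(1)] by (rule inj_on_subset) simp
  have "(\<Sum>b\<in>\<pi> ` ?A. x b) < (\<Sum>a\<in>?A. x a)"
  proof (rule sum_exchange_less[where \<theta> = "pos (king_sort s ! r)"])
    show "card (\<pi> ` ?A) = card ?A"
      by (rule card_image[OF inj])
    show "pos (king_sort s ! r) \<le> x a" if "a \<in> ?A" for a
      using that rk unfolding x_def E_def
      by (auto simp: nth_append intro!: king_sort_mono)
    show "x b < pos (king_sort s ! r)" if b: "b \<in> \<pi> ` ?A - ?A" for b
    proof -
      have "b \<in> \<pi> ` {0..<Suc ?k}"
        using b by auto
      then have "b < Suc ?k"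
        using permutes_image[OF \<pi>(1)] by auto
      then have b': "\<not> b < ?k - r" "b - (?k - r) \<le> r"
        using b rk by auto
      then have "x b = pos (king_sort t ! (b - (?k - r)))"
        using rk by (simp add: x_def E_def nth_append)
      also have "\<dots> \<le> pos (king_sort t ! r)"
        using b' r by (intro king_sort_mono)
      finally show ?thesis
        using gt by simp
    qed
  qed (use \<pi>(2) in auto)
  also have "(\<Sum>b\<in>\<pi> ` ?A. x b) = (\<Sum>i\<in>?A. x (\<pi> i))"
    using inj by (simp add: sum.reindex)
  finally have less: "(\<Sum>i\<in>?A. x (\<pi> i)) < (\<Sum>a\<in>?A. x a)" .
  have "map ((!) E) [0..<?k - r] = drop r (king_sort s)"
    using rk by (intro nth_equalityI) (auto simp: E_def nth_append)
  then have "(\<Sum>a\<in>?A. x a) = pos_sum (drop r (king_sort s))"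
    using pos_sum_map_upt[of "(!) E" "?k - r"] by (simp add: x_def)
  moreover have "(\<Sum>i\<in>?A. x (\<pi> i)) = pos_sum (map (\<lambda>i. E ! \<pi> i) [0..<?k - r])"
    by (simp add: pos_sum_map_upt x_def)
  moreover have "pos_sum s = pos_sum (take r (king_sort s)) + pos_sum (drop r (king_sort s))"
  proof -
    have "pos_sum s = pos_sum (take r (king_sort s) @ drop r (king_sort s))"
      unfolding append_take_drop_id by (intro pos_sum_mset) simp
    then show ?thesis
      by (simp add: pos_sum_def del: append_take_drop_id)
  qed
  ultimately show "pos_sum s' < pos_sum s"
    using less by (simp add: s'_def pos_sum_def)
qed

lemma king_le_refl: "king_le is is"
  by (simp add: king_le_def)

text \<open>An exchange preserves the lengths of both columns and the sum of their keys, lowering by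
  \<open>d\<close> the key that was not the larger one. This spreads the keys and raises the sum of
  their squares. The number of factors is constant and \<open>M\<close> bounds every square, so the
  sum of \<open>M - key\<^sup>2\<close> decreases.\<close>

lemma monomial_in_standard_span:
  assumes "m \<in> monomials (tuples n)"
  shows "(\<lambda>v. mon_eval (minor v) m) \<in> standard_span n"
proof -
  define M where "M = ((2 * n * n + 1) * n + 2 * n * n)\<^sup>2"
  define \<mu> where "\<mu> = wt (\<lambda>is. M - (king_key n is)\<^sup>2)"
  have keyM: "(king_key n is)\<^sup>2 \<le> M" if "is \<in> tuples n" for "is"
    unfolding M_def using king_key_le[OF that] by (rule power_mono) simp
  show ?thesis
    using assms
  proof (induction "\<mu> m" arbitrary: m rule: less_induct)
    case less
    show ?case
    proof (cases "m \<in> standard n")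
      case True
      then show ?thesis
        unfolding standard_span_def
        by (intro CollectI exI[of _ "Poly_Mapping.single m 1"]) (auto simp: peval_single)
    next
      case False
      \<comment> \<open>Naming the incomparable columns by increasing key makes \<open>s\<close> at
        least as long as \<open>t\<close>, so the failure of \<open>king_le s t\<close> must come
        from a row.\<close>
      have "\<exists>s\<in>Poly_Mapping.keys m. \<exists>t\<in>Poly_Mapping.keys m. king_key n s \<le> king_key n t \<and> \<not> king_le s t"
        using False less.prems unfolding standard_def by (smt (verit) linear mem_Collect_eq)
      then obtain s t where st: "s \<in> Poly_Mapping.keys m" "t \<in> Poly_Mapping.keys m"
        "king_key n s \<le> king_key n t" "\<not> king_le s t"
        by blast
      then have "s \<noteq> t"
        using king_le_refl by blast
      have tup: "s \<in> tuples n" "t \<in> tuples n"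
        using st less.prems by (auto simp: monomials_def)
      have len: "length t \<le> length s"
        using king_key_length tup st(3) by blast
      then obtain r where r: "r < length t" "pos (king_sort t ! r) < pos (king_sort s ! r)"
        using st(4) by (auto simp: king_le_def not_le)
      obtain m1 where m1: "m = Poly_Mapping.single s 1 + m1" "Poly_Mapping.keys m1 \<subseteq> Poly_Mapping.keys m"
        using monomial_split[OF st(1)] by blast
      have "Poly_Mapping.lookup m t = Poly_Mapping.lookup m1 t"
        using \<open>s \<noteq> t\<close> by (subst m1(1)) (simp add: lookup_add lookup_single_not_eq)
      then have "t \<in> Poly_Mapping.keys m1"
        using st(2) by (simp add: in_keys_iff)
      from monomial_split[OF this] obtain m2 where
        m2: "m1 = Poly_Mapping.single t 1 + m2" "Poly_Mapping.keys m2 \<subseteq> Poly_Mapping.keys m1"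
        by blast
      have m2mon: "m2 \<in> monomials (tuples n)"
        using m1(2) m2(2) less.prems unfolding monomials_def by blast
      let ?k = "length s" and ?S = "king_sort s" and ?T = "king_sort t"
      define E where "E = drop r ?S @ take (Suc r) ?T"
      define s' where "s' = (\<lambda>\<pi>. take r ?S @ map (\<lambda>i. E ! \<pi> i) [0..<?k - r])"
      define t' where "t' = (\<lambda>\<pi>. map (\<lambda>i. E ! \<pi> i) [?k - r..<Suc ?k] @ drop (Suc r) ?T)"
      let ?Q = "{\<pi>. \<pi> permutes {0..<Suc ?k} \<and> \<pi> ` {0..<?k - r} \<noteq> {0..<?k - r}}"
      have "length ?T \<le> ?k" "r < length ?T" "length ?S = ?k"
        using len r by auto
      from garnir_straightening[OF this(3,1,2)] obtain c where
        c: "\<And>v. minor v ?S * minor v ?T = (\<Sum>\<pi>\<in>?Q. c * signof \<pi> * (minor v (s' \<pi>) * minor v (t' \<pi>)))"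
        unfolding s'_def t'_def E_def by blast
      obtain \<epsilon>s \<epsilon>t where \<epsilon>: "\<And>v. minor v s = \<epsilon>s * minor v ?S" "\<And>v. minor v t = \<epsilon>t * minor v ?T"
        using minor_mset_eq[OF mset_king_sort[symmetric]] by metis
      have split: "mon_eval (minor v) (Poly_Mapping.single a 1 + (Poly_Mapping.single b 1 + m2)) =
          minor v a * minor v b * mon_eval (minor v) m2" for a b v
        by (simp add: mon_eval_add mon_eval_single)
      have "(\<lambda>v. minor v (s' \<pi>) * minor v (t' \<pi>) * mon_eval (minor v) m2) \<in> standard_span n"
        if \<pi>: "\<pi> \<in> ?Q" for \<pi>
      proof (cases "distinct (s' \<pi>) \<and> distinct (t' \<pi>)")
        case False
        then have "minor v (s' \<pi>) * minor v (t' \<pi>) = 0" for v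
          using minor_not_distinct by auto
        then have "(\<lambda>v. minor v (s' \<pi>) * minor v (t' \<pi>) * mon_eval (minor v) m2) = (\<lambda>v. 0)"
          by (simp only: mult_zero_left)
        then show ?thesis
          by (simp only: standard_span_0)
      next
        case True
        have \<pi>': "\<pi> permutes {0..<Suc ?k}" "\<pi> ` {0..<?k - r} \<noteq> {0..<?k - r}"
          using \<pi> by auto
        have g: "length (s' \<pi>) = length s" "length (t' \<pi>) = length t"
          "set (s' \<pi>) \<subseteq> index_set n" "set (t' \<pi>) \<subseteq> index_set n"
          "pos_sum (s' \<pi>) < pos_sum s" "pos_sum (s' \<pi>) + pos_sum (t' \<pi>) = pos_sum s + pos_sum t"
          unfolding s'_def t'_def E_def by (rule garnir_term[OF tup len r \<pi>'])+
        define a where "a = tuple_of (set (s' \<pi>))"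
        define b where "b = tuple_of (set (t' \<pi>))"
        note ta = tuple_of[OF g(3), folded a_def] and tb = tuple_of[OF g(4), folded b_def]
        have ma: "mset (s' \<pi>) = mset a" and mb: "mset (t' \<pi>) = mset b"
          using True ta(1,2) tb(1,2)
          by (intro set_eq_iff_mset_eq_distinct[THEN iffD1]; simp)+
        have lab: "length a = length s" "length b = length t"
          using g(1,2) mset_eq_length[OF ma] mset_eq_length[OF mb] by auto
        have ab: "a \<in> tuples n" "b \<in> tuples n"
          using ta tb g(3,4) lab tup by (auto simp: tuples_def)
        have sums: "pos_sum a < pos_sum s" "pos_sum a + pos_sum b = pos_sum s + pos_sum t"
          using g(5,6) pos_sum_mset[OF ma] pos_sum_mset[OF mb] by auto
        let ?m' = "Poly_Mapping.single a 1 + (Poly_Mapping.single b 1 + m2)"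
        have "\<mu> ?m' < \<mu> m"
        proof -
          define d where "d = pos_sum s - pos_sum a"
          have d: "0 < d" "king_key n s = king_key n a + d" "king_key n b = king_key n t + d"
            using sums lab by (auto simp: d_def king_key_def)
          let ?x = "king_key n a" and ?y = "king_key n t"
          have "?x + d \<le> ?y"
            using st(3) d(2) by simp
          then have "?x * d < ?y * d"
            using d(1) by simp
          then have "2 * (?x * d) < 2 * (?y * d)"
            by linarith
          moreover have "(?x + d)\<^sup>2 + ?y\<^sup>2 = ?x\<^sup>2 + d\<^sup>2 + ?y\<^sup>2 + 2 * (?x * d)"
            "?x\<^sup>2 + (?y + d)\<^sup>2 = ?x\<^sup>2 + d\<^sup>2 + ?y\<^sup>2 + 2 * (?y * d)"
            by (simp_all add: power2_eq_square algebra_simps)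
          ultimately have "(?x + d)\<^sup>2 + ?y\<^sup>2 < ?x\<^sup>2 + (?y + d)\<^sup>2"
            by linarith
          then have "(M - ?x\<^sup>2) + (M - (?y + d)\<^sup>2) < (M - (?x + d)\<^sup>2) + (M - ?y\<^sup>2)"
            using keyM[OF ab(1)] keyM[OF ab(2)] keyM[OF tup(1)] keyM[OF tup(2)] unfolding d by linarith
          then show ?thesis
            unfolding \<mu>_def m1(1) m2(1) by (simp add: wt_add wt_single d)
        qed
        moreover have "?m' \<in> monomials (tuples n)"
          using ab m2mon by (intro monomials_add) (auto simp: monomials_def)
        ultimately have "(\<lambda>v. mon_eval (minor v) ?m') \<in> standard_span n"
          by (rule less.hyps)
        moreover obtain \<delta> where "\<And>v. minor v (s' \<pi>) = \<delta> * minor v a"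
          using minor_mset_eq[OF ma] by blast
        moreover obtain \<delta>' where "\<And>v. minor v (t' \<pi>) = \<delta>' * minor v b"
          using minor_mset_eq[OF mb] by blast
        ultimately show ?thesis
          using standard_span_scale[of "\<lambda>v. mon_eval (minor v) ?m'" n "\<delta> * \<delta>'"]
          by (simp add: split[unfolded One_nat_def] mult_ac)
      qed
      then have "(\<lambda>v. \<Sum>\<pi>\<in>?Q. \<epsilon>s * \<epsilon>t * (c * signof \<pi>) *
          (minor v (s' \<pi>) * minor v (t' \<pi>) * mon_eval (minor v) m2)) \<in> standard_span n"
        by (intro standard_span_sum standard_span_scale)
      also have "(\<lambda>v. \<Sum>\<pi>\<in>?Q. \<epsilon>s * \<epsilon>t * (c * signof \<pi>) *
          (minor v (s' \<pi>) * minor v (t' \<pi>) * mon_eval (minor v) m2)) = (\<lambda>v. mon_eval (minor v) m)"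
      proof
        fix v
        have "mon_eval (minor v) m = \<epsilon>s * \<epsilon>t * (minor v ?S * minor v ?T) * mon_eval (minor v) m2"
          by (simp add: m1(1) m2(1) split[unfolded One_nat_def] \<epsilon>)
        then show "(\<Sum>\<pi>\<in>?Q. \<epsilon>s * \<epsilon>t * (c * signof \<pi>) *
          (minor v (s' \<pi>) * minor v (t' \<pi>) * mon_eval (minor v) m2)) = mon_eval (minor v) m"
          by (simp add: c sum_distrib_left sum_distrib_right mult_ac)
      qed
      finally show ?thesis .
    qed
  qed
qed

lemma straightening:
  assumes "p \<in> polys (tuples n)"
  shows "\<exists>s. Poly_Mapping.keys s \<subseteq> standard n \<and> (\<forall>v. peval (minor v) p = peval (minor v) s)"
proof -
  have "(\<lambda>v. \<Sum>m\<in>Poly_Mapping.keys p. Poly_Mapping.lookup p m * mon_eval (minor v) m) \<in> standard_span n"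
    using assms by (intro standard_span_sum standard_span_scale monomial_in_standard_span) (auto simp: polys_def)
  then show ?thesis
    by (simp add: standard_span_def peval_alt)
qed

section \<open>Independence of King's tableaux on echelon frames\<close>

lemma tuples_eqI:
  assumes s: "s \<in> tuples n" and t: "t \<in> tuples n" and "set s = set t"
  shows "s = t"
proof -
  \<comment> \<open>Turns \<open>idx_less\<close> into the usual order: \<open>-n\<close>, ...,
    \<open>-1\<close> become \<open>n + 1\<close>, ..., \<open>2 * n\<close>.\<close>
  define \<kappa> where "\<kappa> = (\<lambda>i. if i > 0 then i else i + 2 * int n + 1)"
  have less: "\<kappa> i < \<kappa> j" if "idx_less i j" "i \<in> index_set n" "j \<in> index_set n" for i j
    using that by (auto simp: \<kappa>_def idx_less_def index_set_def sgn_if split: if_splits)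
  have inj: "inj_on \<kappa> (index_set n)"
    by (auto simp: inj_on_def \<kappa>_def index_set_def split: if_splits)
  have srt: "sorted_wrt (<) (map \<kappa> u)" if "u \<in> tuples n" for u
  proof -
    have "sorted_wrt idx_less u" "set u \<subseteq> index_set n"
      using that by (auto simp: tuples_def)
    then show ?thesis
      using sorted_wrt_mono_rel[of u idx_less "\<lambda>i j. \<kappa> i < \<kappa> j"] less
      unfolding sorted_wrt_map by blast
  qed
  have "map \<kappa> s = map \<kappa> t"
    by (rule strict_sorted_equal[OF srt[OF t] srt[OF s]]) (simp add: assms(3))
  then show ?thesis
    by (rule map_inj_on) (use inj s t in \<open>auto simp: tuples_def intro: inj_on_subset\<close>)
qed

lemma king_le_trans: "king_le s t \<Longrightarrow> king_le t u \<Longrightarrow> king_le s u"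
  unfolding king_le_def by (meson le_trans less_le_trans)

lemma king_le_antisym:
  assumes "s \<in> tuples n" "t \<in> tuples n" "king_le s t" "king_le t s"
  shows "s = t"
proof -
  have len: "length s = length t"
    using assms by (auto simp: king_le_def)
  have "king_sort s = king_sort t"
  proof (rule nth_equalityI)
    fix i assume "i < length (king_sort s)"
    then have "pos (king_sort s ! i) = pos (king_sort t ! i)"
      using assms len by (auto simp: king_le_def intro!: antisym)
    then show "king_sort s ! i = king_sort t ! i"
      by (rule pos_inj)
  qed (simp add: len)
  then have "set s = set t"
    by (metis set_king_sort)
  then show ?thesis
    using tuples_eqI assms by blast
qed

lemma king_sort_strict:
  assumes "distinct t" "r < r'" "r' < length t"
  shows "pos (king_sort t ! r) < pos (king_sort t ! r')"
proof -
  have "distinct (king_sort t)"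
    using assms(1) by (simp add: king_sort_def)
  then have "king_sort t ! r \<noteq> king_sort t ! r'"
    using assms by (simp add: nth_eq_iff_index_eq)
  then have "pos (king_sort t ! r) \<noteq> pos (king_sort t ! r')"
    using pos_inj by blast
  then show ?thesis
    using king_sort_mono[of r r' t] assms by simp
qed

lemma king_minimum:
  assumes "finite K" "K \<noteq> {}" "\<And>s t. s \<in> K \<Longrightarrow> t \<in> K \<Longrightarrow> king_le s t \<or> king_le t s"
  shows "\<exists>s\<in>K. \<forall>t\<in>K. king_le s t"
  using assms
proof (induction K rule: finite_ne_induct)
  case (singleton x)
  then show ?case by (simp add: king_le_refl)
next
  case (insert x K)
  then obtain s where s: "s \<in> K" "\<forall>t\<in>K. king_le s t"
    by (metis insertCI)
  then show ?case
    using insert.prems[of s x] king_le_trans king_le_refl by (metis insert_iff)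
qed

section \<open>Row contents determine a semistandard tableau\<close>

definition row_count :: "int list monomial \<Rightarrow> nat \<Rightarrow> nat \<Rightarrow> nat" where
  "row_count m r q = wt (\<lambda>t. if r < length t \<and> pos (king_sort t ! r) = q then 1 else 0) m"

lemma row_count_pos:
  "row_count m r q > 0 \<longleftrightarrow> (\<exists>t\<in>Poly_Mapping.keys m. r < length t \<and> pos (king_sort t ! r) = q)"
proof -
  have "row_count m r q \<noteq> 0 \<longleftrightarrow> (\<exists>t\<in>Poly_Mapping.keys m. r < length t \<and> pos (king_sort t ! r) = q)"
    unfolding row_count_def wt_def by (subst sum_eq_0_iff) (auto simp: in_keys_iff)
  then show ?thesis
    by simp
qed

lemma row_count_add: "row_count (m + m') r q = row_count m r q + row_count m' r q"
  by (simp add: row_count_def wt_add)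

lemma standard_subset:
  "m \<in> standard n \<Longrightarrow> Poly_Mapping.keys m' \<subseteq> Poly_Mapping.keys m \<Longrightarrow> m' \<in> standard n"
  by (auto simp: standard_def monomials_def)

lemma standard_minimum:
  assumes "m \<in> standard n" "Poly_Mapping.keys m \<noteq> {}"
  shows "\<exists>s\<in>Poly_Mapping.keys m. \<forall>t\<in>Poly_Mapping.keys m. king_le s t"
  using assms by (intro king_minimum) (auto simp: standard_def)

text \<open>Every entry of \<open>s'\<close> occurs in the same row of \<open>m\<close>, where no
  column has a smaller entry than \<open>s\<close>. Applied in both directions, it identifies the
  first columns of two tableaux with equal row contents.\<close>

lemma minimum_le:
  assumes s: "s \<in> Poly_Mapping.keys m" "\<forall>t\<in>Poly_Mapping.keys m. king_le s t"
    and s': "s' \<in> Poly_Mapping.keys m'" and eq: "\<And>r q. row_count m r q = row_count m' r q"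
  shows "king_le s s'"
proof -
  have *: "r < length s \<and> pos (king_sort s ! r) \<le> pos (king_sort s' ! r)" if r: "r < length s'" for r
  proof -
    have "row_count m r (pos (king_sort s' ! r)) > 0"
      unfolding eq row_count_pos using s' r by blast
    then obtain t where "t \<in> Poly_Mapping.keys m" "r < length t" "pos (king_sort t ! r) = pos (king_sort s' ! r)"
      unfolding row_count_pos by blast
    then show ?thesis
      using s(2) by (force simp: king_le_def)
  qed
  have "length s' \<le> length s"
    using *[of "length s' - 1"] by (cases "length s'") auto
  then show ?thesis
    using * by (simp add: king_le_def)
qed

text \<open>Equal row contents force equal first columns; removing these leaves smaller standard
  monomials that still have equal row contents.\<close>

lemma standard_unique:
  assumes "m \<in> standard n" "m' \<in> standard n" "\<And>r q. row_count m r q = row_count m' r q"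
  shows "m = m'"
  using assms
proof (induction "wt (\<lambda>_. 1) m" arbitrary: m m' rule: less_induct)
  case less
  have ne: "\<exists>q. row_count x 0 q > 0" if "x \<in> standard n" "x \<noteq> 0" for x
  proof -
    obtain t where t: "t \<in> Poly_Mapping.keys x"
      using \<open>x \<noteq> 0\<close> by (metis keys_eq_empty ex_in_conv)
    then have "0 < length t"
      using that by (auto simp: standard_def monomials_def tuples_def)
    then show ?thesis
      using t unfolding row_count_pos by blast
  qed
  show ?case
  proof (cases "m = 0 \<or> m' = 0")
    case True
    have "row_count 0 r q = 0" for r q
      by (simp add: row_count_def)
    then show ?thesis
      using True ne[OF less.prems(1)] ne[OF less.prems(2)] less.prems(3) by (metis less_irrefl)
  next
    case False
    obtain s where s: "s \<in> Poly_Mapping.keys m" "\<forall>t\<in>Poly_Mapping.keys m. king_le s t"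
      using standard_minimum[OF less.prems(1)] False by (metis keys_eq_empty)
    obtain s' where s': "s' \<in> Poly_Mapping.keys m'" "\<forall>t\<in>Poly_Mapping.keys m'. king_le s' t"
      using standard_minimum[OF less.prems(2)] False by (metis keys_eq_empty)
    have "s \<in> tuples n" "s' \<in> tuples n"
      using s s' less.prems by (auto simp: standard_def monomials_def)
    then have "s' = s"
      using minimum_le[OF s s'(1) less.prems(3)] minimum_le[OF s' s(1) less.prems(3)[symmetric]]
      by (intro king_le_antisym)
    obtain m1 where m1: "m = Poly_Mapping.single s 1 + m1" "Poly_Mapping.keys m1 \<subseteq> Poly_Mapping.keys m"
      using monomial_split[OF s(1)] by blast
    obtain m1' where m1': "m' = Poly_Mapping.single s 1 + m1'" "Poly_Mapping.keys m1' \<subseteq> Poly_Mapping.keys m'"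
      using monomial_split[OF s'(1)] \<open>s' = s\<close> by blast
    have "m1 = m1'"
    proof (rule less.hyps)
      show "wt (\<lambda>_. 1) m1 < wt (\<lambda>_. 1) m"
        by (subst m1(1)) (simp add: wt_add wt_single)
      show "m1 \<in> standard n" "m1' \<in> standard n"
        using standard_subset[OF less.prems(1) m1(2)] standard_subset[OF less.prems(2) m1'(2)] by auto
      show "row_count m1 r q = row_count m1' r q" for r q
      proof -
        have "row_count (Poly_Mapping.single s 1) r q + row_count m1 r q =
            row_count (Poly_Mapping.single s 1) r q + row_count m1' r q"
          using less.prems(3)[of r q] by (simp only: m1(1) m1'(1) row_count_add)
        then show ?thesis
          by simp
      qed
    qed
    then show ?thesis
      using m1(1) m1'(1) by simp
  qed
qed

lemma sum_powers_less:
  assumes "2 \<le> (B :: nat)"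
  shows "(\<Sum>x<C. B ^ x) < B ^ C"
proof (induction C)
  case (Suc C)
  have "(\<Sum>x<Suc C. B ^ x) < 2 * B ^ C"
    using Suc by simp
  also have "\<dots> \<le> B * B ^ C"
    using assms by (rule mult_le_mono1)
  finally show ?case
    by (simp only: power_Suc)
qed simp

text \<open>Among the terms of a minor of a matrix whose entry in row \<open>a\<close> and column \<open>q\<close> has order
  \<open>B ^ (a * D + q)\<close>, the diagonal one is dominant.\<close>

lemma diagonal_dominates:
  assumes p: "p permutes {0..<k}" "p \<noteq> id" and q: "\<And>i j. i < j \<Longrightarrow> j < k \<Longrightarrow> q i < q j"
    and D: "\<And>i. i < k \<Longrightarrow> q i < D" and B: "(2::nat) \<le> B"
  shows "(\<Sum>i=0..<k. B ^ (p i * D + q i)) < (\<Sum>i=0..<k. B ^ (i * D + q i))"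
proof -
  define N where "N = {i. i < k \<and> p i \<noteq> i}"
  have "N \<noteq> {}"
  proof
    assume "N = {}"
    then have "p i = i" for i
      using permutes_not_in[OF p(1), of i] by (cases "i < k") (auto simp: N_def)
    then show False
      using p(2) by (auto simp: fun_eq_iff)
  qed
  \<comment> \<open>The largest moved index. Beyond it both sums agree, so it suffices to compare
    the indices up to \<open>a\<close>.\<close>
  define a where "a = Max N"
  have finN: "finite N"
    by (simp add: N_def)
  have a: "a < k" "p a \<noteq> a"
    using Max_in[OF finN \<open>N \<noteq> {}\<close>] by (auto simp: a_def N_def)
  have above: "p i = i" if "a < i" "i < k" for i
  proof (rule ccontr)
    assume "p i \<noteq> i"
    then have "i \<le> a"
      unfolding a_def using that by (intro Max_ge[OF finN]) (simp add: N_def)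
    then show False
      using that by simp
  qed
  have injp: "p i = p j \<Longrightarrow> i = j" for i j
    using permutes_inj[OF p(1)] by (auto simp: inj_def)
  have le: "p i \<le> a" if "i \<le> a" for i
  proof (rule ccontr)
    assume "\<not> p i \<le> a"
    moreover have "p i < k"
      using permutes_in_image[OF p(1), of i] that a(1) by simp
    ultimately have "p (p i) = p i"
      by (intro above) auto
    then have "p i = i"
      by (rule injp)
    then show False
      using \<open>\<not> p i \<le> a\<close> that by simp
  qed
  let ?f = "\<lambda>i. p i * D + q i" and ?C = "a * D + q a"
  \<comment> \<open>An index sent to row \<open>a\<close> is smaller than \<open>a\<close> and has
    smaller \<open>q\<close>; otherwise the row is smaller, and \<open>D\<close> exceeds every
    \<open>q\<close>.\<close>
  have lt: "?f i < ?C" if i: "i \<le> a" for i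
  proof (cases "p i = a")
    case True
    then have "i < a"
      using a(2) i by (cases "i = a") auto
    then show ?thesis
      using True q[of i a] a(1) by simp
  next
    case False
    then have "Suc (p i) \<le> a"
      using le[OF i] by simp
    then have "Suc (p i) * D \<le> a * D"
      by (rule mult_le_mono1)
    then show ?thesis
      using D[of i] i a(1) by simp
  qed
  \<comment> \<open>Distinct exponents below \<open>?C\<close> give a sum of powers below
    \<open>B ^ ?C\<close>, which is already one term on the diagonal side.\<close>
  have inj: "inj_on ?f {0..a}"
  proof (rule inj_onI)
    fix i j assume ij: "i \<in> {0..a}" "j \<in> {0..a}" "?f i = ?f j"
    have dv: "(x * D + y) div D = x" if "y < D" for x y
      using that by (subst div_mult_self3) auto
    have "?f i div D = p i" "?f j div D = p j"
      using ij(1,2) a(1) by (intro dv D; simp)+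
    then have "p i = p j"
      using ij(3) by simp
    then show "i = j"
      by (rule injp)
  qed
  have "(\<Sum>i=0..a. B ^ ?f i) = (\<Sum>x\<in>?f ` {0..a}. B ^ x)"
    using inj by (simp add: sum.reindex)
  also have "\<dots> \<le> (\<Sum>x<?C. B ^ x)"
    by (rule sum_mono2) (use lt in auto)
  also have "\<dots> < B ^ ?C"
    by (rule sum_powers_less[OF B])
  also have "\<dots> \<le> (\<Sum>i=0..a. B ^ (i * D + q i))"
    by (rule member_le_sum) auto
  finally have *: "(\<Sum>i=0..a. B ^ ?f i) < (\<Sum>i=0..a. B ^ (i * D + q i))" .
  have split: "(\<Sum>i=0..<k. g i) = (\<Sum>i=0..a. g i) + (\<Sum>i=Suc a..<k. g i)" for g :: "nat \<Rightarrow> nat"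
    using sum.atLeastLessThan_concat[of 0 "Suc a" k g] a(1) by (simp add: atLeastLessThanSuc_atLeastAtMost)
  have "(\<Sum>i=Suc a..<k. B ^ ?f i) = (\<Sum>i=Suc a..<k. B ^ (i * D + q i))"
    by (intro sum.cong refl) (simp add: above)
  then show ?thesis
    unfolding split using * by simp
qed

section \<open>Test frames and leading terms of minors\<close>

definition diagonal_order :: "nat \<Rightarrow> nat \<Rightarrow> int list \<Rightarrow> nat" where
  "diagonal_order n B t = (\<Sum>r=0..<length t. B ^ (r * (2 * n + 1) + pos (king_sort t ! r)))"

text \<open>Each permitted entry has a pole at \<open>u = 0\<close> whose order is its own power of
  \<open>B\<close>. These orders make diagonal terms dominant and, read as base-\<open>B\<close>
  digits, record row contents. The factor \<open>2 * n + 1\<close> exceeds every position.\<close>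

definition test_frame :: "nat \<Rightarrow> nat \<Rightarrow> complex \<Rightarrow> nat \<Rightarrow> int \<Rightarrow> complex" where
  "test_frame n B u a i =
     (if i \<in> index_set n \<and> int a < \<bar>i\<bar> then inverse u ^ B ^ (a * (2 * n + 1) + pos i) else 0)"

lemma test_frame_echelon: "u \<noteq> 0 \<Longrightarrow> test_frame n B u \<in> echelon_frames n"
  by (auto simp: test_frame_def echelon_frames_def CN_def index_set_def)

text \<open>Sorting by \<open>pos\<close> also sorts absolute values. If entry \<open>r\<close>,
  counted from 0, had absolute value \<open>l \<le> r\<close>, then \<open>r + 1\<close> entries
  would be bounded by \<open>l\<close>. Thus the diagonal of the test frame is nonzero on admissible
  columns.\<close>

lemma Theta_king:
  assumes t: "t \<in> Theta n" and r: "r < length t"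
  shows "int r < \<bar>king_sort t ! r\<bar>"
proof (rule ccontr)
  assume "\<not> int r < \<bar>king_sort t ! r\<bar>"
  define l where "l = nat \<bar>king_sort t ! r\<bar>"
  have tt: "t \<in> tuples n" "admissible n t" "length t \<le> n" "distinct t"
    using t tuples_distinct[of t n] by (auto simp: Theta_def tuples_def)
  have "king_sort t ! r \<in> index_set n"
    using nth_mem[of r "king_sort t"] r tt(1) by (auto simp: tuples_def)
  then have l: "l \<in> {1..n}" "l \<le> r"
    using \<open>\<not> int r < \<bar>king_sort t ! r\<bar>\<close> by (auto simp: l_def index_set_def)
  have abs_le: "\<bar>i\<bar> \<le> \<bar>j\<bar>" if "pos i \<le> pos j" for i j
    using that by (auto simp: pos_def split: if_splits)
  have "(\<lambda>j. king_sort t ! j) ` {0..r} \<subseteq> set (filter (\<lambda>i. \<bar>i\<bar> \<le> int l) t)"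
  proof
    fix x assume "x \<in> (\<lambda>j. king_sort t ! j) ` {0..r}"
    then obtain j where j: "j \<le> r" "x = king_sort t ! j"
      by auto
    then have "\<bar>x\<bar> \<le> int l"
      using abs_le[OF king_sort_mono[of j r t]] r by (simp add: l_def)
    moreover have "x \<in> set t"
      using nth_mem[of j "king_sort t"] j r by simp
    ultimately show "x \<in> set (filter (\<lambda>i. \<bar>i\<bar> \<le> int l) t)"
      by simp
  qed
  then have "card ((\<lambda>j. king_sort t ! j) ` {0..r}) \<le> card (set (filter (\<lambda>i. \<bar>i\<bar> \<le> int l) t))"
    by (intro card_mono) auto
  also have "\<dots> \<le> length (filter (\<lambda>i. \<bar>i\<bar> \<le> int l) t)"
    by (rule card_length)
  also have "\<dots> \<le> l"
    using tt(2) l(1) by (auto simp: admissible_def)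
  also have "card ((\<lambda>j. king_sort t ! j) ` {0..r}) = Suc r"
  proof -
    have "inj_on (\<lambda>j. king_sort t ! j) {0..r}"
      using r tt(4) by (intro inj_on_nth) (auto simp: king_sort_def)
    then show ?thesis
      by (simp add: card_image)
  qed
  finally show False
    using l(2) by simp
qed

text \<open>After scaling by the order of the diagonal term, every other Leibniz term is zero or
  tends to 0; the sign comes from sorting \<open>t\<close>.\<close>

lemma tendsto_test_minor:
  assumes t: "t \<in> Theta n" and B: "2 \<le> B"
  shows "\<exists>\<epsilon>\<in>{1, -1}. ((\<lambda>u. u ^ diagonal_order n B t * minor (test_frame n B u) t) \<longlongrightarrow> \<epsilon>) (at 0)"
proof -
  let ?S = "king_sort t" and ?k = "length t" and ?D = "2 * n + 1"
  let ?w = "diagonal_order n B t"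
  have tt: "t \<in> tuples n" "distinct t"
    using t tuples_distinct[of t n] by (auto simp: Theta_def)
  have Sidx: "?S ! i \<in> index_set n" if "i < ?k" for i
    using nth_mem[of i ?S] that tt(1) by (auto simp: tuples_def)
  have lim_term: "((\<lambda>u. u ^ ?w * (\<Prod>i=0..<?k. test_frame n B u (p i) (?S ! i))) \<longlongrightarrow> (if p = id then 1 else 0)) (at 0)"
    if p: "p permutes {0..<?k}" for p
  proof (cases "\<forall>i<?k. int (p i) < \<bar>?S ! i\<bar>")
    case True
    define e where "e = (\<Sum>i=0..<?k. B ^ (p i * ?D + pos (?S ! i)))"
    have "(\<Prod>i=0..<?k. test_frame n B u (p i) (?S ! i)) = inverse u ^ e" for u
      using True Sidx by (simp add: test_frame_def e_def power_sum)
    moreover have "u ^ ?w * inverse u ^ e = u ^ (?w - e)" if "u \<noteq> 0" "e \<le> ?w" for u :: complex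
    proof -
      have "u ^ ?w = u ^ (?w - e) * u ^ e"
        using that(2) by (simp flip: power_add)
      then show ?thesis
        using that(1) by (simp add: power_inverse)
    qed
    moreover have eq: "e = ?w" if "p = id"
      by (simp add: e_def diagonal_order_def that)
    moreover have less: "e < ?w" if "p \<noteq> id"
      unfolding e_def diagonal_order_def
      using p that king_sort_strict[OF tt(2)] pos_le[OF Sidx] B
      by (intro diagonal_dominates) (auto simp: less_Suc_eq_le)
    ultimately have "u ^ (?w - e) = u ^ ?w * (\<Prod>i=0..<?k. test_frame n B u (p i) (?S ! i))" if "u \<noteq> 0" for u
      using that by (cases "p = id") auto
    then have ev: "\<forall>\<^sub>F u in at 0. u ^ (?w - e) = u ^ ?w * (\<Prod>i=0..<?k. test_frame n B u (p i) (?S ! i))"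
      by (auto simp: eventually_at_filter intro!: always_eventually)
    have "((\<lambda>u::complex. u ^ (?w - e)) \<longlongrightarrow> 0 ^ (?w - e)) (at 0)"
      by (intro tendsto_intros)
    moreover have "(0::complex) ^ (?w - e) = (if p = id then 1 else 0)"
      using eq less by (auto simp: zero_power_eq)
    ultimately show ?thesis
      using Lim_transform_eventually[OF _ ev] by simp
  next
    case False
    then obtain i where i: "i < ?k" "\<not> int (p i) < \<bar>?S ! i\<bar>"
      by blast
    then have "(\<Prod>i=0..<?k. test_frame n B u (p i) (?S ! i)) = 0" for u
      by (intro prod_zero bexI[of _ i]) (auto simp: test_frame_def)
    \<comment> \<open>King's condition keeps the diagonal term out of this case.\<close>
    moreover have "p \<noteq> id"
      using i Theta_king[OF t i(1)] by auto
    ultimately show ?thesis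
      by (simp only: mult_zero_right if_False tendsto_const)
  qed
  have "((\<lambda>u. \<Sum>p | p permutes {0..<?k}. signof p * (u ^ ?w * (\<Prod>i=0..<?k. test_frame n B u (p i) (?S ! i))))
      \<longlongrightarrow> (\<Sum>p | p permutes {0..<?k}. signof p * (if p = id then 1 else 0))) (at 0)"
    by (intro tendsto_intros lim_term) auto
  also have "(\<Sum>p | p permutes {0..<?k}. signof p * (if p = id then 1 else 0)) = (1 :: complex)"
    by (simp add: if_distrib[of "(*) _"] sum.delta finite_permutations permutes_id sign_id cong: if_cong)
  also have "(\<lambda>u. \<Sum>p | p permutes {0..<?k}. signof p * (u ^ ?w * (\<Prod>i=0..<?k. test_frame n B u (p i) (?S ! i)))) =
      (\<lambda>u. u ^ ?w * minor (test_frame n B u) ?S)"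
    by (simp add: minor_Leibniz sum_distrib_left mult.left_commute)
  finally have lim: "((\<lambda>u. u ^ ?w * minor (test_frame n B u) ?S) \<longlongrightarrow> 1) (at 0)" .
  obtain \<epsilon> where \<epsilon>: "\<epsilon> \<in> {1, -1}" "\<And>v. minor v t = \<epsilon> * minor v ?S"
    using minor_mset_eq[OF mset_king_sort[symmetric]] by metis
  have "((\<lambda>u. \<epsilon> * (u ^ ?w * minor (test_frame n B u) ?S)) \<longlongrightarrow> \<epsilon> * 1) (at 0)"
    by (intro tendsto_intros lim)
  then have "((\<lambda>u. u ^ ?w * minor (test_frame n B u) t) \<longlongrightarrow> \<epsilon>) (at 0)"
    unfolding \<epsilon>(2) by (simp add: mult.left_commute)
  with \<epsilon>(1) show ?thesis
    by blast
qed

lemma diagonal_order_digits: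
  assumes "t \<in> tuples n"
  shows "diagonal_order n B t = (\<Sum>c<n * (2 * n + 1).
    (if c div (2 * n + 1) < length t \<and> pos (king_sort t ! (c div (2 * n + 1))) = c mod (2 * n + 1) then 1 else 0) * B ^ c)"
proof -
  let ?D = "2 * n + 1"
  define P where "P = (\<lambda>c. c div ?D < length t \<and> pos (king_sort t ! (c div ?D)) = c mod ?D)"
  define f where "f = (\<lambda>r. r * ?D + pos (king_sort t ! r))"
  have small: "pos (king_sort t ! r) < ?D" if "r < length t" for r
  proof -
    have "king_sort t ! r \<in> index_set n"
      using nth_mem[of r "king_sort t"] that assms by (auto simp: tuples_def)
    then show ?thesis
      using pos_le[of "king_sort t ! r" n] by simp
  qed
  have f: "f r div ?D = r" "f r mod ?D = pos (king_sort t ! r)" if "r < length t" for r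
  proof -
    show "f r mod ?D = pos (king_sort t ! r)"
      unfolding f_def mod_mult_self3 by (rule mod_less[OF small[OF that]])
    show "f r div ?D = r"
      unfolding f_def using div_less[OF small[OF that]] by (subst div_mult_self3) auto
  qed
  have "bij_betw f {0..<length t} {c \<in> {..<n * ?D}. P c}"
  proof (rule bij_betwI[of _ _ _ "\<lambda>c. c div ?D"])
    show "f \<in> {0..<length t} \<rightarrow> {c \<in> {..<n * ?D}. P c}"
    proof (rule funcsetI)
      fix r assume "r \<in> {0..<length t}"
      then have r: "r < length t"
        by simp
      then have "Suc r \<le> n"
        using assms by (auto simp: tuples_def)
      then have "Suc r * ?D \<le> n * ?D"
        by (rule mult_le_mono1)
      then have "f r < n * ?D"
        using small[OF r] by (simp add: f_def)
      then show "f r \<in> {c \<in> {..<n * ?D}. P c}"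
        using f[OF r] r by (simp add: P_def)
    qed
    show "(\<lambda>c. c div ?D) \<in> {c \<in> {..<n * ?D}. P c} \<rightarrow> {0..<length t}"
      by (auto simp: P_def)
    show "f (c div ?D) = c" if "c \<in> {c \<in> {..<n * ?D}. P c}" for c
      using that by (simp only: f_def P_def mem_Collect_eq div_mult_mod_eq)
    show "f r div ?D = r" if "r \<in> {0..<length t}" for r
      using f that by simp
  qed
  from sum.reindex_bij_betw[OF this, of "\<lambda>c. B ^ c"]
  have "diagonal_order n B t = (\<Sum>c\<in>{c \<in> {..<n * ?D}. P c}. B ^ c)"
    by (simp add: diagonal_order_def f_def)
  also have "\<dots> = (\<Sum>c<n * ?D. if P c then B ^ c else 0)"
    by (rule sum.inter_filter) simp
  also have "\<dots> = (\<Sum>c<n * ?D. (if P c then 1 else 0) * B ^ c)"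
    by (intro sum.cong) auto
  finally show ?thesis
    unfolding P_def .
qed

lemma wt_diagonal_order:
  assumes "m \<in> monomials (tuples n)"
  shows "wt (diagonal_order n B) m =
    (\<Sum>c<n * (2 * n + 1). row_count m (c div (2 * n + 1)) (c mod (2 * n + 1)) * B ^ c)"
proof -
  have "wt (diagonal_order n B) m = (\<Sum>t\<in>Poly_Mapping.keys m. \<Sum>c<n * (2 * n + 1). Poly_Mapping.lookup m t *
    (if c div (2 * n + 1) < length t \<and> pos (king_sort t ! (c div (2 * n + 1))) = c mod (2 * n + 1) then 1 else 0) * B ^ c)"
    unfolding wt_def using assms
    by (intro sum.cong refl, subst diagonal_order_digits) (auto simp: monomials_def sum_distrib_left mult.assoc)
  then show ?thesis
    by (subst (asm) sum.swap) (simp add: row_count_def wt_def sum_distrib_right del: mult_Suc_right)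
qed

text \<open>As \<open>B\<close> exceeds both degrees, the base-\<open>B\<close> digits of the order
  are the row counts, and these determine a standard monomial.\<close>

lemma diagonal_order_inj:
  assumes "m \<in> standard n" "m' \<in> standard n"
    and "wt (\<lambda>_. 1) m < B" "wt (\<lambda>_. 1) m' < B"
    and "wt (diagonal_order n B) m = wt (diagonal_order n B) m'"
  shows "m = m'"
proof (rule standard_unique[OF assms(1,2)])
  let ?D = "2 * n + 1"
  fix r q
  have mon: "m \<in> monomials (tuples n)" "m' \<in> monomials (tuples n)"
    using assms by (auto simp: standard_def)
  have less: "row_count m r q < B" "row_count m' r q < B" for r q
  proof -
    have "row_count x r q \<le> wt (\<lambda>_. 1) x" for x
      unfolding row_count_def by (rule wt_mono) auto
    then show "row_count m r q < B" "row_count m' r q < B"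
      using assms(3,4) le_less_trans by blast+
  qed
  show "row_count m r q = row_count m' r q"
  proof (cases "r < n \<and> q < ?D")
    case True
    then have "Suc r * ?D \<le> n * ?D"
      by (intro mult_le_mono1) auto
    then have c: "r * ?D + q < n * ?D"
      using True by simp
    have "row_count m ((r * ?D + q) div ?D) ((r * ?D + q) mod ?D) =
        row_count m' ((r * ?D + q) div ?D) ((r * ?D + q) mod ?D)"
      by (rule digits_unique[OF assms(5)[unfolded wt_diagonal_order[OF mon(1)] wt_diagonal_order[OF mon(2)]] less c])
    moreover have "(r * ?D + q) div ?D = r"
      using True by (subst div_mult_self3) auto
    moreover have "(r * ?D + q) mod ?D = q"
      unfolding mod_mult_self3 using True by (intro mod_less) auto
    ultimately show ?thesis
      by metis
  next
    case False
    have "\<not> row_count x r q > 0" if "x \<in> monomials (tuples n)" for x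
    proof
      assume "row_count x r q > 0"
      then obtain t where t: "t \<in> Poly_Mapping.keys x" "r < length t" "pos (king_sort t ! r) = q"
        unfolding row_count_pos by blast
      then have tt: "t \<in> tuples n"
        using that by (auto simp: monomials_def)
      then have "king_sort t ! r \<in> index_set n"
        using nth_mem[of r "king_sort t"] t(2) by (auto simp: tuples_def)
      then have "q < ?D" "r < n"
        using pos_le[of "king_sort t ! r" n] t tt by (auto simp: tuples_def)
      then show False
        using False by simp
    qed
    then show ?thesis
      using mon by simp
  qed
qed

text \<open>On the test frames exactly one monomial of a nonzero \<open>s\<close> has the highest
  pole order \<open>W\<close>. Multiplying by \<open>u ^ W\<close> and letting \<open>u\<close> tend
  to 0 isolates its coefficient times a product of signs, which is not zero.\<close>

lemma standard_independent:
  assumes s: "Poly_Mapping.keys s \<subseteq> standard n" "s \<in> polys (Theta n)"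
    and van: "\<And>z. z \<in> echelon_frames n \<Longrightarrow> peval (minor z) s = 0"
  shows "s = 0"
proof (rule ccontr)
  assume "s \<noteq> 0"
  \<comment> \<open>Exceeds all degrees, so digits do not carry, and is at least 2, as the dominance
    of the diagonal term requires.\<close>
  define B where "B = Suc (Suc (\<Sum>m\<in>Poly_Mapping.keys s. wt (\<lambda>_. 1) m))"
  have B: "2 \<le> B"
    by (simp add: B_def)
  have deg: "wt (\<lambda>_. 1) m < B" if "m \<in> Poly_Mapping.keys s" for m
    using member_le_sum[OF that, of "wt (\<lambda>_. 1)"] by (auto simp: B_def)
  let ?w = "diagonal_order n B"
  define W where "W = Max (wt ?w ` Poly_Mapping.keys s)"
  have ne: "wt ?w ` Poly_Mapping.keys s \<noteq> {}"
    using \<open>s \<noteq> 0\<close> by simp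
  then have "W \<in> wt ?w ` Poly_Mapping.keys s"
    unfolding W_def by (intro Max_in) auto
  then obtain m0 where m0: "m0 \<in> Poly_Mapping.keys s" "wt ?w m0 = W"
    by blast
  have le: "wt ?w m \<le> W" if "m \<in> Poly_Mapping.keys s" for m
    unfolding W_def using that by (intro Max_ge) auto
  have uniq: "wt ?w m < W" if "m \<in> Poly_Mapping.keys s" "m \<noteq> m0" for m
    using diagonal_order_inj[of m n m0 B] le[OF that(1)] that m0 s(1) deg by (auto simp: order_le_less)
  have "\<exists>\<epsilon>\<in>{1, -1}. ((\<lambda>u. u ^ ?w t * minor (test_frame n B u) t) \<longlongrightarrow> \<epsilon>) (at 0)" if "t \<in> Theta n" for t
    using tendsto_test_minor[OF that B] .
  then obtain \<epsilon> where \<epsilon>: "\<And>t. t \<in> Theta n \<Longrightarrow> \<epsilon> t \<noteq> 0"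
    "\<And>t. t \<in> Theta n \<Longrightarrow> ((\<lambda>u. u ^ ?w t * minor (test_frame n B u) t) \<longlongrightarrow> \<epsilon> t) (at 0)"
    by (metis insertE singletonD zero_neq_neg_one zero_neq_one)
  have keysT: "t \<in> Theta n" if "m \<in> Poly_Mapping.keys s" "t \<in> Poly_Mapping.keys m" for m t
    using s(2) that by (auto simp: polys_def monomials_def)
  define F where "F = (\<lambda>u. \<Sum>m\<in>Poly_Mapping.keys s. Poly_Mapping.lookup s m *
      (u ^ (W - wt ?w m) * mon_eval (\<lambda>t. u ^ ?w t * minor (test_frame n B u) t) m))"
  have F0: "F u = 0" if u: "u \<noteq> 0" for u
  proof -
    have "F u = u ^ W * peval (minor (test_frame n B u)) s"
      unfolding F_def peval_alt sum_distrib_left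
    proof (rule sum.cong[OF refl])
      fix m assume "m \<in> Poly_Mapping.keys s"
      then have "u ^ W = u ^ (W - wt ?w m) * u ^ wt ?w m"
        using le by (simp flip: power_add)
      then show "Poly_Mapping.lookup s m *
          (u ^ (W - wt ?w m) * mon_eval (\<lambda>t. u ^ ?w t * minor (test_frame n B u) t) m) =
          u ^ W * (Poly_Mapping.lookup s m * mon_eval (minor (test_frame n B u)) m)"
        by (simp add: mon_eval_rescale)
    qed
    then show ?thesis
      using van test_frame_echelon[OF u] by simp
  qed
  have lim: "(F \<longlongrightarrow> (\<Sum>m\<in>Poly_Mapping.keys s. Poly_Mapping.lookup s m * (0 ^ (W - wt ?w m) * mon_eval \<epsilon> m))) (at 0)"
    unfolding F_def mon_eval_def using keysT by (intro tendsto_intros \<epsilon>(2)) auto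
  have "(F \<longlongrightarrow> 0) (at 0)"
    by (rule tendsto_eventually) (auto simp: eventually_at_filter F0)
  from tendsto_unique[OF _ this lim]
  have "0 = (\<Sum>m\<in>Poly_Mapping.keys s. Poly_Mapping.lookup s m * (0 ^ (W - wt ?w m) * mon_eval \<epsilon> m))"
    by simp
  also have "\<dots> = (\<Sum>m\<in>{m0}. Poly_Mapping.lookup s m * (0 ^ (W - wt ?w m) * mon_eval \<epsilon> m))"
    using m0(1) by (intro sum.mono_neutral_right) (auto dest!: uniq)
  also have "\<dots> = Poly_Mapping.lookup s m0 * mon_eval \<epsilon> m0"
    using m0(2) by simp
  finally have "mon_eval \<epsilon> m0 = 0"
    using m0(1) by (simp add: in_keys_iff)
  then show False
    using \<epsilon>(1) keysT[OF m0(1)] by (auto simp: mon_eval_def)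
qed

section \<open>Comparison of the ideals\<close>

text \<open>More than \<open>l\<close> columns have absolute value at most \<open>l\<close>, but
  only the \<open>l\<close> rows 0..l-1 precede row \<open>l\<close>. So each Leibniz term pairs
  some column \<open>i\<close> with a row of number at least its absolute value, where
  \<open>z\<close> is 0.\<close>

lemma echelon_not_admissible:
  assumes z: "z \<in> echelon_frames n" and t: "t \<in> tuples n" "t \<notin> Theta n"
  shows "minor z t = 0"
proof -
  obtain l where l: "l \<in> {1..n}" "length (filter (\<lambda>i. \<bar>i\<bar> \<le> int l) t) > l"
    using t by (auto simp: Theta_def admissible_def not_le)
  define J where "J = {i. i < length t \<and> \<bar>t ! i\<bar> \<le> int l}"
  have J: "card J > l"
    using l(2) by (simp add: J_def length_filter_conv_card)
  have "(\<Prod>i=0..<length t. z (p i) (t ! i)) = 0" if p: "p permutes {0..<length t}" for p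
  proof -
    have "\<exists>i\<in>J. \<bar>t ! i\<bar> \<le> int (p i)"
    proof (rule ccontr)
      assume *: "\<not> (\<exists>i\<in>J. \<bar>t ! i\<bar> \<le> int (p i))"
      have "p ` J \<subseteq> {..<l}"
      proof
        fix x assume "x \<in> p ` J"
        then obtain i where i: "i \<in> J" "x = p i"
          by blast
        have "\<not> \<bar>t ! i\<bar> \<le> int (p i)"
          using * i(1) by blast
        moreover have "\<bar>t ! i\<bar> \<le> int l"
          using i(1) by (simp add: J_def)
        ultimately show "x \<in> {..<l}"
          using i(2) by simp
      qed
      then have "card (p ` J) \<le> card {..<l}"
        by (rule card_mono[OF finite_lessThan])
      moreover have "card (p ` J) = card J"
        by (rule card_image[OF inj_on_subset[OF permutes_inj[OF p] subset_UNIV]])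
      ultimately show False
        using J by simp
    qed
    then obtain i where i: "i \<in> J" "\<bar>t ! i\<bar> \<le> int (p i)"
      by blast
    have "p i < length t"
      using permutes_in_image[OF p, of i] i by (auto simp: J_def)
    moreover have "length t \<le> n"
      using t(1) by (auto simp: tuples_def)
    ultimately have "z (p i) (t ! i) = 0"
      using z i(2) by (auto simp: echelon_frames_def)
    then show ?thesis
      using i(1) by (intro prod_zero) (auto simp: J_def)
  qed
  then show ?thesis
    unfolding minor_Leibniz by (intro sum.neutral ballI) (simp only: mem_Collect_eq mult_zero_right)
qed

lemma peval_proj_Theta:
  assumes z: "z \<in> echelon_frames n" and p: "p \<in> polys (tuples n)"
  shows "peval (minor z) (proj_Theta n p) = peval (minor z) p"
proof -
  have "peval (minor z) (proj_Theta n p) =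
      (\<Sum>m\<in>{m \<in> Poly_Mapping.keys p. Poly_Mapping.keys m \<subseteq> Theta n}. Poly_Mapping.lookup p m * mon_eval (minor z) m)"
    unfolding peval_alt proj_Theta_eq_restrict keys_restrict_poly lookup_restrict_poly
    by (intro sum.cong) auto
  also have "\<dots> = peval (minor z) p"
    unfolding peval_alt
  proof (rule sum.mono_neutral_left)
    show "\<forall>m\<in>Poly_Mapping.keys p - {m \<in> Poly_Mapping.keys p. Poly_Mapping.keys m \<subseteq> Theta n}.
        Poly_Mapping.lookup p m * mon_eval (minor z) m = 0"
    proof
      fix m assume "m \<in> Poly_Mapping.keys p - {m \<in> Poly_Mapping.keys p. Poly_Mapping.keys m \<subseteq> Theta n}"
      then obtain t where t: "m \<in> Poly_Mapping.keys p" "t \<in> Poly_Mapping.keys m" "t \<notin> Theta n"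
        by blast
      then have "t \<in> tuples n"
        using p by (auto simp: polys_def monomials_def)
      then have "minor z t = 0"
        using echelon_not_admissible[OF z] t(3) by blast
      then have "mon_eval (minor z) m = 0"
        unfolding mon_eval_def using t(2)
        by (intro prod_zero bexI[of _ t]) (auto simp: zero_power_eq in_keys_iff)
      then show "Poly_Mapping.lookup p m * mon_eval (minor z) m = 0"
        by simp
    qed
  qed auto
  finally show ?thesis .
qed

lemma vanishing_subset_proj:
  assumes p: "p \<in> vanishing (Theta n) (echelon_frames n)"
  shows "p \<in> proj_Theta n ` typeA_plucker_ideal n"
proof -
  have pT: "p \<in> polys (Theta n)" and p0: "\<And>z. z \<in> echelon_frames n \<Longrightarrow> peval (minor z) p = 0"
    using p by (auto simp: vanishing_def)
  then have pA: "p \<in> polys (tuples n)"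
    using polys_mono[OF Theta_subset] by blast
  obtain s where s: "Poly_Mapping.keys s \<subseteq> standard n" "\<And>v. peval (minor v) p = peval (minor v) s"
    using straightening[OF pA] by blast
  have sA: "s \<in> polys (tuples n)"
    using s(1) by (auto simp: polys_def standard_def)
  \<comment> \<open>The straightening identity holds for every \<open>v\<close>, not just on
    \<open>Z\<close>, so the difference vanishes on all frames.\<close>
  have i: "p - s \<in> typeA_plucker_ideal n"
    unfolding typeA_plucker_ideal_eq vanishing_def
    using s(2) polys_diff[OF pA sA] by (auto simp: peval_diff)
  have "proj_Theta n s = 0"
  proof (rule standard_independent)
    show "Poly_Mapping.keys (proj_Theta n s) \<subseteq> standard n"
      using s(1) by (auto simp: proj_Theta_eq_restrict keys_restrict_poly)
    show "proj_Theta n s \<in> polys (Theta n)"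
      by (auto simp: proj_Theta_eq_restrict keys_restrict_poly polys_def monomials_def)
    show "peval (minor z) (proj_Theta n s) = 0" if "z \<in> echelon_frames n" for z
      using peval_proj_Theta[OF that sA] s(2) p0[OF that] by simp
  qed
  moreover have "proj_Theta n p = p"
    using pT by (intro poly_mapping_eqI)
      (auto simp: proj_Theta_eq_restrict lookup_restrict_poly polys_def monomials_def in_keys_iff)
  moreover have "proj_Theta n p = proj_Theta n (p - s) + proj_Theta n s"
    unfolding proj_Theta_eq_restrict by (simp flip: restrict_poly_add)
  ultimately have "p = proj_Theta n (p - s)"
    by simp
  with i show ?thesis
    by blast
qed

theorem theorem3:
  fixes n :: nat
  assumes "n \<ge> 2"
  shows "\<exists>lt. monomial_order (Theta n) lt \<and>
           initial_ideal lt (symplectic_plucker_ideal n) = proj_Theta n ` typeA_plucker_ideal n"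
proof (intro exI conjI equalityI subsetI)
  show "monomial_order (Theta n) (weight_less n)"
    by (rule monomial_order_weight)
  show "p \<in> proj_Theta n ` typeA_plucker_ideal n"
    if "p \<in> initial_ideal (weight_less n) (symplectic_plucker_ideal n)" for p
    using initial_ideal_vanishing that by (intro vanishing_subset_proj) blast
  show "p \<in> initial_ideal (weight_less n) (symplectic_plucker_ideal n)"
    if "p \<in> proj_Theta n ` typeA_plucker_ideal n" for p
    using that proj_subset_initial by blast
qed

end
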